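(* Let $\mathfrak C=(n,\Lambda,L,P)$ be a stabilizer code, let $\iota:\Gamma\to\Lambda$ be an embedding of abelian groups with image of finite index, and let $\iota^*\mathfrak C=(n,\Gamma,\iota^*L,\iota^*P)$ be the coarse-grained code. Then $$S(\iota^*\mathfrak C)=\iota^*S(\mathfrak C),\qquad Z(\iota^*\mathfrak C)=\iota^*Z(\mathfrak C),\qquad Q^i(\iota^*\mathfrak C)\cong\iota^*Q^i(\mathfrak C)\quad(i\ge 0).$$
   Context: Let $n$ be a positive integer, $\mathbb Z_n=\mathbb Z/n\mathbb Z$, $\Lambda$ a finitely generated abelian group, $R=\mathbb Z_n[\Lambda]$, $x^\lambda\in R$ the element corresponding to $\lambda\in\Lambda$. The antipode is $\overline{\sum_\lambda r_\lambda x^\lambda}=\sum_\lambda r_\lambda x^{-\lambda}$; for an $R$-module $M$, $\overline M$ is the same abelian group with $R$-action twisted by the antipode. A stabilizer code $\mathfrak C=(n,\Lambda,L,P)$ consists of: $P=P_0[\Lambda]=P_0\otimes_{\mathbb Z_n}R$, where $P_0$ is a finitely generated $\mathbb Z_n$-module with an alternating ($\omega_0(a,a)=0$), nondegenerate ($\omega_0(\cdot,a)=0\Rightarrow a=0$) bilinear form $\omega_0:P_0\times P_0\to\mathbb Z_n$, equipped with $\omega:P\times P\to R$, $\omega(a x^\lambda,b x^\mu)=\omega_0(a,b)x^{\mu-\lambda}$ (extended $\mathbb Z_n$-bilinearly); and an $R$-submodule $L\subset P$ with $\omega|_{L\times L}=0$. For a submodule $N\subset P$, $N^\omega=\{p\in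 P:\omega(m,p)=0\ \forall m\in N\}$. Put $S(\mathfrak C)=L^\omega/L^{\omega\omega}$, $Z(\mathfrak C)=L^{\omega\omega}/L$ and $Q^i(\mathfrak C)=\mathrm{Ext}^{i+1}_R(\overline{P/L},R)$ for $i\ge0$. Coarse graining: for a $\mathbb Z_n[\Lambda]$-module $M$, $\iota^*M$ is $M$ regarded as a $\mathbb Z_n[\Gamma]$-module by restriction along $\iota$. The code $\iota^*\mathfrak C=(n,\Gamma,\iota^*L,\iota^*P)$ over $\mathbb Z_n[\Gamma]$ carries the form on $\iota^*P$ with the same scalar part, namely $\omega_\Gamma(p,p')=\sum_{\gamma\in\Gamma}\omega(p,p')_{\iota(\gamma)}x^\gamma\in\mathbb Z_n[\Gamma]$, where $r_\lambda$ denotes the coefficient of $x^\lambda$ in $r\in R$. *)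

theory Defs
  imports
    "HOL-Algebra.IntRing"
    "HOL-Algebra.Module"
    "HOL-Algebra.Generated_Groups"
    "HOL-Library.Tree"
begin

section \<open>Modules\<close>

text \<open>
  Modules are records of type \<open>('r, 'm) module\<close>. Their ring multiplication and unit are
  meaningless; the constructions below set them to \<open>undefined\<close>.
\<close>

definition fin_gen_module :: "('r, 'a) ring_scheme \<Rightarrow> ('r, 'm) module \<Rightarrow> bool" where
  "fin_gen_module R M \<longleftrightarrow>
    (\<exists>S. finite S \<and> S \<subseteq> carrier M \<and>
      (\<forall>m\<in>carrier M. \<exists>c\<in>S \<rightarrow> carrier R. m = (\<Oplus>\<^bsub>M\<^esub>s\<in>S. c s \<odot>\<^bsub>M\<^esub> s)))"

definition mod_hom ::
  "('r, 'a) ring_scheme \<Rightarrow> ('r, 'm) module \<Rightarrow> ('r, 'n) module \<Rightarrow> ('m \<Rightarrow> 'n) set" where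
  "mod_hom R M N = {h \<in> carrier M \<rightarrow> carrier N.
    (\<forall>x\<in>carrier M. \<forall>y\<in>carrier M. h (x \<oplus>\<^bsub>M\<^esub> y) = h x \<oplus>\<^bsub>N\<^esub> h y) \<and>
    (\<forall>r\<in>carrier R. \<forall>x\<in>carrier M. h (r \<odot>\<^bsub>M\<^esub> x) = r \<odot>\<^bsub>N\<^esub> h x)}"

definition mod_iso :: "('r, 'a) ring_scheme \<Rightarrow> ('r, 'm) module \<Rightarrow> ('r, 'n) module \<Rightarrow> bool" where
  "mod_iso R M N \<longleftrightarrow> (\<exists>h\<in>mod_hom R M N. bij_betw h (carrier M) (carrier N))"

definition mod_ker :: "('r, 'm) module \<Rightarrow> ('r, 'n) module \<Rightarrow> ('m \<Rightarrow> 'n) \<Rightarrow> 'm set" where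
  "mod_ker M N h = {x \<in> carrier M. h x = \<zero>\<^bsub>N\<^esub>}"

definition quotient_module :: "('r, 'm) module \<Rightarrow> 'm set \<Rightarrow> ('r, 'm set) module" where
  "quotient_module M N =
    \<lparr>carrier = a_rcosets\<^bsub>M\<^esub> N, mult = undefined, one = undefined, zero = N,
     add = set_add M, smult = (\<lambda>r X. \<Union>x\<in>X. N +>\<^bsub>M\<^esub> (r \<odot>\<^bsub>M\<^esub> x))\<rparr>"

definition restrict_scalars :: "('s \<Rightarrow> 'r) \<Rightarrow> ('r, 'm) module \<Rightarrow> ('s, 'm) module" where
  "restrict_scalars \<phi> M =
    \<lparr>carrier = carrier M, mult = undefined, one = undefined, zero = \<zero>\<^bsub>M\<^esub>,
     add = add M, smult = (\<lambda>s x. \<phi> s \<odot>\<^bsub>M\<^esub> x)\<rparr>"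

definition regular_module :: "('r, 'a) ring_scheme \<Rightarrow> ('r, 'r) module" where
  "regular_module R =
    \<lparr>carrier = carrier R, mult = undefined, one = undefined, zero = \<zero>\<^bsub>R\<^esub>,
     add = add R, smult = mult R\<rparr>"

definition finsupp :: "'x set \<Rightarrow> ('m, 'a) ring_scheme \<Rightarrow> ('x \<Rightarrow> 'm) set" where
  "finsupp X M =
    {f \<in> X \<rightarrow> carrier M. (\<forall>x. x \<notin> X \<longrightarrow> f x = \<zero>\<^bsub>M\<^esub>) \<and> finite {x. f x \<noteq> \<zero>\<^bsub>M\<^esub>}}"


section \<open>Ext\<close>

definition free_module :: "('r, 'a) ring_scheme \<Rightarrow> 'x set \<Rightarrow> ('r, 'x \<Rightarrow> 'r) module" where
  "free_module R X =
    \<lparr>carrier = finsupp X R, mult = undefined, one = undefined, zero = (\<lambda>_. \<zero>\<^bsub>R\<^esub>),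
     add = (\<lambda>f g x. f x \<oplus>\<^bsub>R\<^esub> g x), smult = (\<lambda>r f x. r \<otimes>\<^bsub>R\<^esub> f x)\<rparr>"

text \<open>\<open>X k\<close> is the basis of the \<open>k\<close>-th term, \<open>d k\<close> the differential from degree
  \<open>k + 1\<close> to degree \<open>k\<close>, and \<open>\<epsilon>\<close> the augmentation.\<close>

definition free_resolution ::
  "('r, 'a) ring_scheme \<Rightarrow> ('r, 'm) module \<Rightarrow> (nat \<Rightarrow> 'x set) \<Rightarrow>
    (nat \<Rightarrow> ('x \<Rightarrow> 'r) \<Rightarrow> ('x \<Rightarrow> 'r)) \<Rightarrow> (('x \<Rightarrow> 'r) \<Rightarrow> 'm) \<Rightarrow> bool" where
  "free_resolution R M X d \<epsilon> \<longleftrightarrow>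
    \<epsilon> \<in> mod_hom R (free_module R (X 0)) M \<and>
    \<epsilon> ` carrier (free_module R (X 0)) = carrier M \<and>
    (\<forall>k. d k \<in> mod_hom R (free_module R (X (Suc k))) (free_module R (X k))) \<and>
    d 0 ` carrier (free_module R (X (Suc 0))) = mod_ker (free_module R (X 0)) M \<epsilon> \<and>
    (\<forall>k. d (Suc k) ` carrier (free_module R (X (Suc (Suc k)))) =
      mod_ker (free_module R (X (Suc k))) (free_module R (X k)) (d k))"

definition Hom_module ::
  "('r, 'a) ring_scheme \<Rightarrow> ('r, 'm) module \<Rightarrow> ('r, 'n) module \<Rightarrow> ('r, 'm \<Rightarrow> 'n) module" where
  "Hom_module R M N =
    \<lparr>carrier = mod_hom R M N \<inter> extensional (carrier M), mult = undefined, one = undefined,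
     zero = (\<lambda>x\<in>carrier M. \<zero>\<^bsub>N\<^esub>),
     add = (\<lambda>f g. \<lambda>x\<in>carrier M. f x \<oplus>\<^bsub>N\<^esub> g x),
     smult = (\<lambda>r f. \<lambda>x\<in>carrier M. r \<odot>\<^bsub>N\<^esub> f x)\<rparr>"

context
  fixes R :: "('r, 'a) ring_scheme"
    and X :: "nat \<Rightarrow> 'x set" and d :: "nat \<Rightarrow> ('x \<Rightarrow> 'r) \<Rightarrow> ('x \<Rightarrow> 'r)"
    and N :: "('r, 'n) module"
begin

definition cochains :: "nat \<Rightarrow> ('r, ('x \<Rightarrow> 'r) \<Rightarrow> 'n) module" where
  "cochains k = Hom_module R (free_module R (X k)) N"

definition coboundary :: "nat \<Rightarrow> (('x \<Rightarrow> 'r) \<Rightarrow> 'n) \<Rightarrow> (('x \<Rightarrow> 'r) \<Rightarrow> 'n)" where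
  "coboundary k f = compose (carrier (free_module R (X (Suc k)))) f (d k)"

definition cocycles :: "nat \<Rightarrow> (('x \<Rightarrow> 'r) \<Rightarrow> 'n) set" where
  "cocycles k = mod_ker (cochains k) (cochains (Suc k)) (coboundary k)"

definition coboundaries :: "nat \<Rightarrow> (('x \<Rightarrow> 'r) \<Rightarrow> 'n) set" where
  "coboundaries k =
    (case k of 0 \<Rightarrow> {\<zero>\<^bsub>cochains 0\<^esub>} | Suc j \<Rightarrow> coboundary j ` carrier (cochains j))"

definition cohomology :: "nat \<Rightarrow> ('r, (('x \<Rightarrow> 'r) \<Rightarrow> 'n) set) module" where
  "cohomology k = quotient_module ((cochains k)\<lparr>carrier := cocycles k\<rparr>) (coboundaries k)"

end

text \<open>
  \<open>Ext\<close> over a commutative ring is computed from a chosen free resolution; as usual, another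
  choice gives an isomorphic module. The bases are taken inside the type \<open>('m + 'r) tree\<close>, which
  contains a copy of \<open>'m\<close> and of the finitely supported functions from itself to \<open>'r\<close>, and so
  is large enough for every module to have a resolution: see \<open>free_resolution_exists\<close> below.
\<close>

definition chosen_resolution ::
  "('r, 'a) ring_scheme \<Rightarrow> ('r, 'm) module \<Rightarrow> (nat \<Rightarrow> ('m + 'r) tree set) \<times>
    (nat \<Rightarrow> (('m + 'r) tree \<Rightarrow> 'r) \<Rightarrow> (('m + 'r) tree \<Rightarrow> 'r))" where
  "chosen_resolution R M = (SOME (X, d). \<exists>\<epsilon>. free_resolution R M X d \<epsilon>)"

definition Ext ::
  "('r, 'a) ring_scheme \<Rightarrow> nat \<Rightarrow> ('r, 'm) module \<Rightarrow> ('r, 'n) module \<Rightarrow>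
    ('r, ((('m + 'r) tree \<Rightarrow> 'r) \<Rightarrow> 'n) set) module" where
  "Ext R k M N = (case chosen_resolution R M of (X, d) \<Rightarrow> cohomology R X d N k)"

lemma free_module_simps [simp]:
  "carrier (free_module R X) = finsupp X R"
  "\<zero>\<^bsub>free_module R X\<^esub> = (\<lambda>_. \<zero>\<^bsub>R\<^esub>)"
  "f \<oplus>\<^bsub>free_module R X\<^esub> g = (\<lambda>x. f x \<oplus>\<^bsub>R\<^esub> g x)"
  "r \<odot>\<^bsub>free_module R X\<^esub> f = (\<lambda>x. r \<otimes>\<^bsub>R\<^esub> f x)"
  by (simp_all add: free_module_def)

lemma finsuppI:
  assumes "\<And>x. x \<in> X \<Longrightarrow> f x \<in> carrier R" "\<And>x. x \<notin> X \<Longrightarrow> f x = \<zero>\<^bsub>R\<^esub>"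
    and "finite A" "\<And>x. x \<notin> A \<Longrightarrow> f x = \<zero>\<^bsub>R\<^esub>"
  shows "f \<in> finsupp X R"
proof -
  have "{x. f x \<noteq> \<zero>\<^bsub>R\<^esub>} \<subseteq> A" using assms(4) by blast
  then show ?thesis using assms by (auto simp: finsupp_def intro: finite_subset)
qed

lemma free_module_is_module:
  assumes "cring R"
  shows "module R (free_module R X)"
proof -
  interpret R: cring R by fact
  have cl: "f x \<in> carrier R" if "f \<in> finsupp X R" for f x
    using that by (cases "x \<in> X") (auto simp: finsupp_def)
  have fin: "finite {x. f x \<noteq> \<zero>\<^bsub>R\<^esub>}" if "f \<in> finsupp X R" for f
    using that by (auto simp: finsupp_def)
  have out: "f x = \<zero>\<^bsub>R\<^esub>" if "f \<in> finsupp X R" "x \<notin> X" for f x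
    using that by (auto simp: finsupp_def)
  have add: "(\<lambda>x. f x \<oplus>\<^bsub>R\<^esub> g x) \<in> finsupp X R" if "f \<in> finsupp X R" "g \<in> finsupp X R" for f g
    by (rule finsuppI[where A = "{x. f x \<noteq> \<zero>\<^bsub>R\<^esub>} \<union> {x. g x \<noteq> \<zero>\<^bsub>R\<^esub>}"])
       (use that in \<open>auto simp: cl fin out\<close>)
  have sm: "(\<lambda>x. r \<otimes>\<^bsub>R\<^esub> f x) \<in> finsupp X R" if "f \<in> finsupp X R" "r \<in> carrier R" for f r
    by (rule finsuppI[where A = "{x. f x \<noteq> \<zero>\<^bsub>R\<^esub>}"]) (use that in \<open>auto simp: cl fin out\<close>)
  have neg: "(\<lambda>x. \<ominus>\<^bsub>R\<^esub> f x) \<in> finsupp X R" if "f \<in> finsupp X R" for f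
    by (rule finsuppI[where A = "{x. f x \<noteq> \<zero>\<^bsub>R\<^esub>}"]) (use that in \<open>auto simp: cl fin out\<close>)
  have zero: "(\<lambda>x. \<zero>\<^bsub>R\<^esub>) \<in> finsupp X R"
    by (rule finsuppI[where A = "{}"]) auto
  show ?thesis
  proof (rule moduleI)
    show "abelian_group (free_module R X)"
    proof (rule abelian_groupI)
      fix f assume f: "f \<in> carrier (free_module R X)"
      show "\<exists>y\<in>carrier (free_module R X). y \<oplus>\<^bsub>free_module R X\<^esub> f = \<zero>\<^bsub>free_module R X\<^esub>"
        by (rule bexI[where x = "\<lambda>x. \<ominus>\<^bsub>R\<^esub> f x"]) (use f neg cl in \<open>auto simp: R.l_neg\<close>)
    qed (auto simp: add zero cl R.a_ac)
  qed (auto simp: assms sm cl R.l_distr R.r_distr R.m_assoc)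
qed

lemma mod_homD:
  assumes "h \<in> mod_hom R M N"
  shows "x \<in> carrier M \<Longrightarrow> h x \<in> carrier N"
    and "x \<in> carrier M \<Longrightarrow> y \<in> carrier M \<Longrightarrow> h (x \<oplus>\<^bsub>M\<^esub> y) = h x \<oplus>\<^bsub>N\<^esub> h y"
    and "r \<in> carrier R \<Longrightarrow> x \<in> carrier M \<Longrightarrow> h (r \<odot>\<^bsub>M\<^esub> x) = r \<odot>\<^bsub>N\<^esub> h x"
  using assms by (auto simp: mod_hom_def)

lemma submodule_mod_ker:
  assumes M: "module R M" and N: "module R N" and h: "h \<in> mod_hom R M N"
  shows "submodule (mod_ker M N h) R M"
proof -
  interpret M: module R M by fact
  interpret N: module R N by fact
  note hD = mod_homD[OF h]
  have h0: "h \<zero>\<^bsub>M\<^esub> = \<zero>\<^bsub>N\<^esub>"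
    using hD(3)[of "\<zero>\<^bsub>R\<^esub>" "\<zero>\<^bsub>M\<^esub>"] hD(1)[of "\<zero>\<^bsub>M\<^esub>"] by simp
  have neg: "h (\<ominus>\<^bsub>M\<^esub> a) = \<zero>\<^bsub>N\<^esub>" if a: "a \<in> carrier M" "h a = \<zero>\<^bsub>N\<^esub>" for a
  proof -
    have "h (\<ominus>\<^bsub>M\<^esub> a) \<oplus>\<^bsub>N\<^esub> h a = \<zero>\<^bsub>N\<^esub>"
      using hD(2)[of "\<ominus>\<^bsub>M\<^esub> a" a] a by (simp add: M.M.l_neg h0)
    then show ?thesis using a hD(1)[of "\<ominus>\<^bsub>M\<^esub> a"] by simp
  qed
  show ?thesis
    by (rule M.submoduleI) (auto simp: mod_ker_def h0 hD neg)
qed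

text \<open>Every submodule \<open>K\<close> is the image of a free module whose basis is a copy of \<open>K\<close>.\<close>

lemma free_cover:
  fixes M :: "('r, 'm) module" and c :: "'m \<Rightarrow> 'x"
  assumes M: "module R M" and K: "submodule K R M" and c: "inj_on c K"
  shows "\<exists>h\<in>mod_hom R (free_module R (c ` K)) M. h ` carrier (free_module R (c ` K)) = K"
proof -
  interpret M: module R M by fact
  note KE = M.submoduleE[OF K]
  have K0: "\<zero>\<^bsub>M\<^esub> \<in> K"
    using subgroup.one_closed[OF submodule.axioms(1)[OF K]] by simp
  define e where "e = inv_into K c"
  have eK: "e x \<in> K" if "x \<in> c ` K" for x using that by (auto simp: e_def inv_into_into)
  have eM: "e x \<in> carrier M" if "x \<in> c ` K" for x using eK[OF that] KE(1) by auto
  define h where "h f = (\<Oplus>\<^bsub>M\<^esub>x\<in>{x. f x \<noteq> \<zero>\<^bsub>R\<^esub>}. f x \<odot>\<^bsub>M\<^esub> e x)" for f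
  let ?F = "finsupp (c ` K) R"
  have cl: "f x \<in> carrier R" if "f \<in> ?F" for f x
    using that by (cases "x \<in> c ` K") (auto simp: finsupp_def)
  have fin: "finite {x. f x \<noteq> \<zero>\<^bsub>R\<^esub>}" if "f \<in> ?F" for f
    using that by (auto simp: finsupp_def)
  have sub: "x \<in> c ` K" if "f \<in> ?F" "f x \<noteq> \<zero>\<^bsub>R\<^esub>" for f x
    using that by (auto simp: finsupp_def)
  have h_eq: "h f = (\<Oplus>\<^bsub>M\<^esub>x\<in>A. f x \<odot>\<^bsub>M\<^esub> e x)"
    if "f \<in> ?F" "finite A" "{x. f x \<noteq> \<zero>\<^bsub>R\<^esub>} \<subseteq> A" "A \<subseteq> c ` K" for f A
    unfolding h_def
    by (rule M.M.add.finprod_mono_neutral_cong_left)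
       (use that in \<open>auto simp: cl eM subset_iff\<close>)
  have sumK: "finite A \<Longrightarrow> A \<subseteq> c ` K \<Longrightarrow> (\<Oplus>\<^bsub>M\<^esub>x\<in>A. f x \<odot>\<^bsub>M\<^esub> e x) \<in> K" if f: "f \<in> ?F" for f A
  proof (induction A rule: finite_induct)
    case empty then show ?case by (simp add: K0)
  next
    case (insert a A)
    have "(\<Oplus>\<^bsub>M\<^esub>x\<in>insert a A. f x \<odot>\<^bsub>M\<^esub> e x) = f a \<odot>\<^bsub>M\<^esub> e a \<oplus>\<^bsub>M\<^esub> (\<Oplus>\<^bsub>M\<^esub>x\<in>A. f x \<odot>\<^bsub>M\<^esub> e x)"
      by (rule M.M.finsum_insert) (use insert in \<open>auto simp: cl[OF f] eM subset_iff\<close>)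
    then show ?case using insert by (simp add: KE(4,5) cl[OF f] eK)
  qed
  have hK: "h f \<in> K" if "f \<in> ?F" for f
    unfolding h_def by (rule sumK) (use that in \<open>auto simp: fin dest: sub\<close>)
  have hom: "h \<in> mod_hom R (free_module R (c ` K)) M"
    unfolding mod_hom_def
  proof (intro CollectI conjI ballI)
    show "h \<in> carrier (free_module R (c ` K)) \<rightarrow> carrier M" using hK KE(1) by auto
  next
    fix f g assume "f \<in> carrier (free_module R (c ` K))" "g \<in> carrier (free_module R (c ` K))"
    then have fg: "f \<in> ?F" "g \<in> ?F" by auto
    let ?A = "{x. f x \<noteq> \<zero>\<^bsub>R\<^esub>} \<union> {x. g x \<noteq> \<zero>\<^bsub>R\<^esub>}"
    have A: "finite ?A" "?A \<subseteq> c ` K" using fg by (auto simp: fin dest: sub)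
    interpret F: module R "free_module R (c ` K)"
      by (rule free_module_is_module) (rule M.R.is_cring)
    have fg': "(\<lambda>x. f x \<oplus>\<^bsub>R\<^esub> g x) \<in> ?F" using F.M.a_closed[of f g] fg by simp
    have "h (\<lambda>x. f x \<oplus>\<^bsub>R\<^esub> g x) = (\<Oplus>\<^bsub>M\<^esub>x\<in>?A. (f x \<oplus>\<^bsub>R\<^esub> g x) \<odot>\<^bsub>M\<^esub> e x)"
      by (rule h_eq[OF fg' A(1) _ A(2)]) auto
    also have "\<dots> = (\<Oplus>\<^bsub>M\<^esub>x\<in>?A. f x \<odot>\<^bsub>M\<^esub> e x \<oplus>\<^bsub>M\<^esub> g x \<odot>\<^bsub>M\<^esub> e x)"
      by (rule M.M.finsum_cong') (use A in \<open>auto simp: cl fg eM M.smult_l_distr subset_iff\<close>)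
    also have "\<dots> = (\<Oplus>\<^bsub>M\<^esub>x\<in>?A. f x \<odot>\<^bsub>M\<^esub> e x) \<oplus>\<^bsub>M\<^esub> (\<Oplus>\<^bsub>M\<^esub>x\<in>?A. g x \<odot>\<^bsub>M\<^esub> e x)"
      by (rule M.M.finsum_addf) (use A in \<open>auto simp: cl fg eM subset_iff\<close>)
    also have "\<dots> = h f \<oplus>\<^bsub>M\<^esub> h g"
      using h_eq[OF fg(1) A(1) _ A(2)] h_eq[OF fg(2) A(1) _ A(2)] by simp
    finally show "h (f \<oplus>\<^bsub>free_module R (c ` K)\<^esub> g) = h f \<oplus>\<^bsub>M\<^esub> h g" by simp
  next
    fix r f assume r: "r \<in> carrier R" and "f \<in> carrier (free_module R (c ` K))"
    then have f: "f \<in> ?F" by auto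
    let ?A = "{x. f x \<noteq> \<zero>\<^bsub>R\<^esub>}"
    have A: "finite ?A" "?A \<subseteq> c ` K" using f by (auto simp: fin dest: sub)
    interpret F: module R "free_module R (c ` K)"
      by (rule free_module_is_module) (rule M.R.is_cring)
    have f': "(\<lambda>x. r \<otimes>\<^bsub>R\<^esub> f x) \<in> ?F" using F.smult_closed[of r f] f r by simp
    have "h (\<lambda>x. r \<otimes>\<^bsub>R\<^esub> f x) = (\<Oplus>\<^bsub>M\<^esub>x\<in>?A. (r \<otimes>\<^bsub>R\<^esub> f x) \<odot>\<^bsub>M\<^esub> e x)"
      by (rule h_eq[OF f' A(1) _ A(2)]) (use r in auto)
    also have "\<dots> = (\<Oplus>\<^bsub>M\<^esub>x\<in>?A. r \<odot>\<^bsub>M\<^esub> (f x \<odot>\<^bsub>M\<^esub> e x))"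
      by (rule M.M.finsum_cong') (use A r in \<open>auto simp: cl f eM M.smult_assoc1 subset_iff\<close>)
    also have "\<dots> = r \<odot>\<^bsub>M\<^esub> h f"
      unfolding h_def
      by (rule M.finsum_smult_ldistr[symmetric]) (use A r in \<open>auto simp: cl f eM subset_iff\<close>)
    finally show "h (r \<odot>\<^bsub>free_module R (c ` K)\<^esub> f) = r \<odot>\<^bsub>M\<^esub> h f" by simp
  qed
  have "K \<subseteq> h ` ?F"
  proof
    fix k assume k: "k \<in> K"
    let ?f = "\<lambda>x. if x = c k then \<one>\<^bsub>R\<^esub> else \<zero>\<^bsub>R\<^esub>"
    have f: "?f \<in> ?F" by (rule finsuppI[where A = "{c k}"]) (use k in auto)
    have ek: "e (c k) = k" using k c by (simp add: e_def)
    have kM: "k \<in> carrier M" using k KE(1) by auto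
    have "h ?f = (\<Oplus>\<^bsub>M\<^esub>x\<in>{c k}. ?f x \<odot>\<^bsub>M\<^esub> e x)"
      by (rule h_eq[OF f]) (use k in auto)
    also have "\<dots> = k" using kM by (simp add: ek)
    finally show "k \<in> h ` ?F" using f by (metis image_eqI)
  qed
  then have "h ` carrier (free_module R (c ` K)) = K" using hK by auto
  with hom show ?thesis by blast
qed

text \<open>A finitely supported function \<open>f\<close> from trees to \<open>'r\<close> is encoded by a list of the pairs
  \<open>(t, f t)\<close> over its support, strung along the right spine of a tree.\<close>

fun spine :: "('m + 'r) tree list \<Rightarrow> (('m + 'r) tree \<Rightarrow> 'r) \<Rightarrow> ('m + 'r) tree" where
  "spine [] f = Leaf"
| "spine (t # ts) f = Node t (Inr (f t)) (spine ts f)"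

lemma spine_inject: "spine ts f = spine us g \<Longrightarrow> ts = us \<and> (\<forall>t\<in>set ts. f t = g t)"
  by (induction ts arbitrary: us; case_tac us) auto

lemma ex_code: "\<exists>c :: (('m + 'r) tree \<Rightarrow> 'r) \<Rightarrow> ('m + 'r) tree. inj_on c (finsupp X R)"
proof -
  define l where "l f = (SOME ts. set ts = {t. f t \<noteq> \<zero>\<^bsub>R\<^esub>})" for f :: "('m + 'r) tree \<Rightarrow> 'r"
  have l: "set (l f) = {t. f t \<noteq> \<zero>\<^bsub>R\<^esub>}" if "f \<in> finsupp X R" for f
    unfolding l_def by (rule someI_ex, rule finite_list) (use that in \<open>auto simp: finsupp_def\<close>)
  have "inj_on (\<lambda>f. spine (l f) f) (finsupp X R)"
  proof (rule inj_onI)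
    fix f g assume f: "f \<in> finsupp X R" and g: "g \<in> finsupp X R"
      and eq: "spine (l f) f = spine (l g) g"
    have s: "l f = l g" "\<forall>t\<in>set (l f). f t = g t" using spine_inject[OF eq] by auto
    show "f = g"
    proof
      fix t show "f t = g t" using s l[OF f] l[OF g] by (cases "t \<in> set (l f)") auto
    qed
  qed
  then show ?thesis by blast
qed

lemma free_resolution_exists:
  fixes R :: "('r, 'a) ring_scheme" and M :: "('r, 'm) module"
  assumes M: "module R M"
  shows "\<exists>(X :: nat \<Rightarrow> ('m + 'r) tree set) d \<epsilon>. free_resolution R M X d \<epsilon>"
proof -
  interpret M: module R M by fact
  let ?F = "\<lambda>X :: ('m + 'r) tree set. free_module R X"
  have F: "module R (?F X)" for X by (rule free_module_is_module) (rule M.R.is_cring)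
  define c0 :: "'m \<Rightarrow> ('m + 'r) tree" where "c0 m = Node Leaf (Inl m) Leaf" for m
  have c0: "inj_on c0 (carrier M)" by (auto simp: inj_on_def c0_def)
  define X0 where "X0 = c0 ` carrier M"
  from free_cover[OF M M.carrier_is_submodule c0] obtain \<epsilon>
    where \<epsilon>: "\<epsilon> \<in> mod_hom R (?F X0) M" "\<epsilon> ` carrier (?F X0) = carrier M"
    unfolding X0_def by blast
  define P where "P n s \<longleftrightarrow> submodule (snd s) R (?F (fst s)) \<and>
      (n = 0 \<longrightarrow> s = (X0, mod_ker (?F X0) M \<epsilon>))"
    for n :: nat and s :: "('m + 'r) tree set \<times> (('m + 'r) tree \<Rightarrow> 'r) set"
  define Q where "Q s s' h \<longleftrightarrow> h \<in> mod_hom R (?F (fst s')) (?F (fst s)) \<and>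
      h ` carrier (?F (fst s')) = snd s \<and> snd s' = mod_ker (?F (fst s')) (?F (fst s)) h" for s s' h
  have "\<exists>s. \<forall>n. P n (s n) \<and> (\<exists>h. Q (s n) (s (Suc n)) h)"
  proof (rule dependent_nat_choice)
    show "\<exists>s. P 0 s" by (auto simp: P_def intro: submodule_mod_ker[OF F M \<epsilon>(1)])
  next
    fix s n assume "P n s"
    then have K: "submodule (snd s) R (?F (fst s))" by (simp add: P_def)
    obtain c :: "(('m + 'r) tree \<Rightarrow> 'r) \<Rightarrow> ('m + 'r) tree" where "inj_on c (finsupp (fst s) R)"
      using ex_code by blast
    then have c: "inj_on c (snd s)"
      using module.submoduleE(1)[OF F K] by (auto intro: inj_on_subset)
    from free_cover[OF F K c] obtain h where
      h: "h \<in> mod_hom R (?F (c ` snd s)) (?F (fst s))" "h ` carrier (?F (c ` snd s)) = snd s"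
      by blast
    let ?s = "(c ` snd s, mod_ker (?F (c ` snd s)) (?F (fst s)) h)"
    have "P (Suc n) ?s" using submodule_mod_ker[OF F F h(1)] by (simp add: P_def)
    moreover have "Q s ?s h" using h by (simp add: Q_def)
    ultimately show "\<exists>s'. P (Suc n) s' \<and> (\<exists>h. Q s s' h)" by blast
  qed
  then obtain s d where P: "\<And>n. P n (s n)" and Q: "\<And>n. Q (s n) (s (Suc n)) (d n)" by metis
  have s0: "s 0 = (X0, mod_ker (?F X0) M \<epsilon>)" using P[of 0] by (simp add: P_def)
  have "free_resolution R M (\<lambda>n. fst (s n)) d \<epsilon>"
    unfolding free_resolution_def
    using \<epsilon> s0 Q[unfolded Q_def] by (metis fst_conv snd_conv)
  then show ?thesis by blast
qed

section \<open>Group rings\<close>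

text \<open>
  Abelian groups are written multiplicatively, so \<open>\<mu> - \<lambda>\<close> becomes
  \<open>inv \<lambda> \<otimes> \<mu>\<close>. An element \<open>\<Sum>r\<^sub>\<lambda> x\<^sup>\<lambda>\<close> is the function
  \<open>\<lambda> \<mapsto> r\<^sub>\<lambda>\<close>, which is zero off the carrier of the group.
\<close>

definition group_ring :: "('a, 'c) ring_scheme \<Rightarrow> ('l, 'd) monoid_scheme \<Rightarrow> ('l \<Rightarrow> 'a) ring" where
  "group_ring A G =
    \<lparr>carrier = finsupp (carrier G) A,
     mult = (\<lambda>r s x. if x \<in> carrier G
       then \<Oplus>\<^bsub>A\<^esub>y\<in>{y. r y \<noteq> \<zero>\<^bsub>A\<^esub>}. r y \<otimes>\<^bsub>A\<^esub> s (inv\<^bsub>G\<^esub> y \<otimes>\<^bsub>G\<^esub> x) else \<zero>\<^bsub>A\<^esub>),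
     one = (\<lambda>x. if x = \<one>\<^bsub>G\<^esub> then \<one>\<^bsub>A\<^esub> else \<zero>\<^bsub>A\<^esub>),
     zero = (\<lambda>_. \<zero>\<^bsub>A\<^esub>),
     add = (\<lambda>r s x. r x \<oplus>\<^bsub>A\<^esub> s x)\<rparr>"

text \<open>The \<open>A[G]\<close>-module \<open>P\<^sub>0[G]\<close>.\<close>

definition group_module ::
  "('a, 'c) ring_scheme \<Rightarrow> ('l, 'd) monoid_scheme \<Rightarrow> ('a, 'p) module \<Rightarrow> ('l \<Rightarrow> 'a, 'l \<Rightarrow> 'p) module" where
  "group_module A G P\<^sub>0 =
    \<lparr>carrier = finsupp (carrier G) P\<^sub>0, mult = undefined, one = undefined,
     zero = (\<lambda>_. \<zero>\<^bsub>P\<^sub>0\<^esub>),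
     add = (\<lambda>p q x. p x \<oplus>\<^bsub>P\<^sub>0\<^esub> q x),
     smult = (\<lambda>r p x. if x \<in> carrier G
       then \<Oplus>\<^bsub>P\<^sub>0\<^esub>y\<in>{y. r y \<noteq> \<zero>\<^bsub>A\<^esub>}. r y \<odot>\<^bsub>P\<^sub>0\<^esub> p (inv\<^bsub>G\<^esub> y \<otimes>\<^bsub>G\<^esub> x) else \<zero>\<^bsub>P\<^sub>0\<^esub>)\<rparr>"

definition antipode ::
  "('a, 'c) ring_scheme \<Rightarrow> ('l, 'd) monoid_scheme \<Rightarrow> ('l \<Rightarrow> 'a) \<Rightarrow> ('l \<Rightarrow> 'a)" where
  "antipode A G r = (\<lambda>x. if x \<in> carrier G then r (inv\<^bsub>G\<^esub> x) else \<zero>\<^bsub>A\<^esub>)"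

text \<open>The ring homomorphism \<open>\<Sum>r\<^sub>\<gamma> x\<^sup>\<gamma> \<mapsto> \<Sum>r\<^sub>\<gamma> x\<^bsup>\<iota> \<gamma>\<^esup>\<close> from \<open>A[H]\<close> to \<open>A[G]\<close>.\<close>

definition group_ring_map ::
  "('a, 'c) ring_scheme \<Rightarrow> ('h, 'd) monoid_scheme \<Rightarrow> ('h \<Rightarrow> 'l) \<Rightarrow> ('h \<Rightarrow> 'a) \<Rightarrow> ('l \<Rightarrow> 'a)" where
  "group_ring_map A H \<iota> r = (\<lambda>x. \<Oplus>\<^bsub>A\<^esub>y\<in>{y \<in> carrier H. \<iota> y = x \<and> r y \<noteq> \<zero>\<^bsub>A\<^esub>}. r y)"


section \<open>Stabilizer codes\<close>

definition bilinear_form ::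
  "('a, 'c) ring_scheme \<Rightarrow> ('a, 'p) module \<Rightarrow> ('p \<Rightarrow> 'p \<Rightarrow> 'a) \<Rightarrow> bool" where
  "bilinear_form A M w \<longleftrightarrow>
    (\<forall>a\<in>carrier M. w a \<in> mod_hom A M (regular_module A)) \<and>
    (\<forall>b\<in>carrier M. (\<lambda>a. w a b) \<in> mod_hom A M (regular_module A))"

text \<open>
  The extension of \<open>w\<close> to \<open>P\<^sub>0[G]\<close> with
  \<open>\<omega>(a x\<^sup>\<lambda>, b x\<^sup>\<mu>) = w(a, b) x\<^bsup>\<mu> - \<lambda>\<^esup>\<close>: the coefficient of \<open>x\<^sup>\<nu>\<close> in
  \<open>\<omega>(p, q)\<close> is the sum over \<open>\<lambda>\<close> of \<open>w(p\<^sub>\<lambda>, q\<^bsub>\<lambda> + \<nu>\<^esub>)\<close>.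
\<close>

definition group_form ::
  "('a, 'c) ring_scheme \<Rightarrow> ('l, 'd) monoid_scheme \<Rightarrow> ('a, 'p) module \<Rightarrow> ('p \<Rightarrow> 'p \<Rightarrow> 'a) \<Rightarrow>
    ('l \<Rightarrow> 'p) \<Rightarrow> ('l \<Rightarrow> 'p) \<Rightarrow> ('l \<Rightarrow> 'a)" where
  "group_form A G P\<^sub>0 w p q =
    (\<lambda>x. if x \<in> carrier G then \<Oplus>\<^bsub>A\<^esub>y\<in>{y. p y \<noteq> \<zero>\<^bsub>P\<^sub>0\<^esub>}. w (p y) (q (y \<otimes>\<^bsub>G\<^esub> x)) else \<zero>\<^bsub>A\<^esub>)"

text \<open>
  The data \<open>(n, \<Lambda>, L, P)\<close> together with the form on \<open>P\<close>. The conditions that make it a stabilizer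
  code are stated separately in \<open>stabilizer_code\<close>, since a coarse-grained \<open>P\<close> is still a set of
  functions on the original group, and only isomorphic to one of the form \<open>P\<^sub>0[\<Gamma>]\<close>.
\<close>

record ('l, 'm) code_data =
  modulus :: nat
  translation_group :: "'l monoid"
  stabilizers :: "'m set"
  paulis :: "('l \<Rightarrow> int set, 'm) module"
  pauli_form :: "'m \<Rightarrow> 'm \<Rightarrow> ('l \<Rightarrow> int set)"

definition scalars :: "('l, 'm) code_data \<Rightarrow> int set ring" where
  "scalars C = ZFact (int (modulus C))"

definition code_ring :: "('l, 'm) code_data \<Rightarrow> ('l \<Rightarrow> int set) ring" where
  "code_ring C = group_ring (scalars C) (translation_group C)"

definition stabilizer_code :: "('l, 'l \<Rightarrow> 'p) code_data \<Rightarrow> bool" where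
  "stabilizer_code C \<longleftrightarrow>
    modulus C > 0 \<and>
    comm_group (translation_group C) \<and>
    (\<exists>S. finite S \<and> S \<subseteq> carrier (translation_group C) \<and>
      generate (translation_group C) S = carrier (translation_group C)) \<and>
    (\<exists>P\<^sub>0 w.
      module (scalars C) P\<^sub>0 \<and> fin_gen_module (scalars C) P\<^sub>0 \<and>
      bilinear_form (scalars C) P\<^sub>0 w \<and>
      (\<forall>a\<in>carrier P\<^sub>0. w a a = \<zero>\<^bsub>scalars C\<^esub>) \<and>
      (\<forall>a\<in>carrier P\<^sub>0. (\<forall>b\<in>carrier P\<^sub>0. w b a = \<zero>\<^bsub>scalars C\<^esub>) \<longrightarrow> a = \<zero>\<^bsub>P\<^sub>0\<^esub>) \<and>
      paulis C = group_module (scalars C) (translation_group C) P\<^sub>0 \<and>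
      pauli_form C = group_form (scalars C) (translation_group C) P\<^sub>0 w) \<and>
    submodule (stabilizers C) (code_ring C) (paulis C) \<and>
    (\<forall>a\<in>stabilizers C. \<forall>b\<in>stabilizers C. pauli_form C a b = \<zero>\<^bsub>code_ring C\<^esub>)"

definition orthogonal :: "('l, 'm) code_data \<Rightarrow> 'm set \<Rightarrow> 'm set" where
  "orthogonal C N = {p \<in> carrier (paulis C). \<forall>m\<in>N. pauli_form C m p = \<zero>\<^bsub>code_ring C\<^esub>}"

definition S_module :: "('l, 'm) code_data \<Rightarrow> ('l \<Rightarrow> int set, 'm set) module" where
  "S_module C =
    quotient_module ((paulis C)\<lparr>carrier := orthogonal C (stabilizers C)\<rparr>)
      (orthogonal C (orthogonal C (stabilizers C)))"

definition Z_module :: "('l, 'm) code_data \<Rightarrow> ('l \<Rightarrow> int set, 'm set) module" where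
  "Z_module C =
    quotient_module ((paulis C)\<lparr>carrier := orthogonal C (orthogonal C (stabilizers C))\<rparr>)
      (stabilizers C)"

definition conjugate_module ::
  "('l, 'm) code_data \<Rightarrow> ('l \<Rightarrow> int set, 'n) module \<Rightarrow> ('l \<Rightarrow> int set, 'n) module" where
  "conjugate_module C M = restrict_scalars (antipode (scalars C) (translation_group C)) M"

definition Q_module where
  "Q_module i C =
    Ext (code_ring C) (i + 1) (conjugate_module C (quotient_module (paulis C) (stabilizers C)))
      (regular_module (code_ring C))"


section \<open>Coarse graining\<close>

definition coarse_module ::
  "'g monoid \<Rightarrow> ('g \<Rightarrow> 'l) \<Rightarrow> ('l, 'm) code_data \<Rightarrow> ('l \<Rightarrow> int set, 'n) module \<Rightarrow>
    ('g \<Rightarrow> int set, 'n) module" where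
  "coarse_module \<Gamma> \<iota> C M = restrict_scalars (group_ring_map (scalars C) \<Gamma> \<iota>) M"

definition coarse_code ::
  "'g monoid \<Rightarrow> ('g \<Rightarrow> 'l) \<Rightarrow> ('l, 'm) code_data \<Rightarrow> ('g, 'm) code_data" where
  "coarse_code \<Gamma> \<iota> C =
    \<lparr>modulus = modulus C, translation_group = \<Gamma>, stabilizers = stabilizers C,
     paulis = coarse_module \<Gamma> \<iota> C (paulis C),
     pauli_form = (\<lambda>p q x. if x \<in> carrier \<Gamma> then pauli_form C p q (\<iota> x) else \<zero>\<^bsub>scalars C\<^esub>)\<rparr>"

end

theory Submission
  imports Defs
begin

text \<open>
  The coefficient of \<open>\<omega>(m, p)\<close> at \<open>\<lambda>\<close> is the coefficient of \<open>\<omega>(x\<^sup>\<lambda> m, p)\<close> at \<open>0\<close>. Hence the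
  orthogonal complement of a translation invariant set does not change under coarse graining,
  which gives the equalities for \<open>S\<close> and \<open>Z\<close>.

  For \<open>Q\<close>, a free resolution over \<open>A[\<Lambda>]\<close> restricts to a resolution over \<open>A[\<Gamma>]\<close>, which is again
  free because \<open>A[\<Lambda>]\<close> is free over \<open>A[\<Gamma>]\<close> on a transversal. The comparison theorem identifies its
  cohomology with the one of the resolution chosen over \<open>A[\<Gamma>]\<close>. Finally, composition with the
  projection \<open>A[\<Lambda>] \<rightarrow> A[\<Gamma>]\<close> onto the coefficients in \<open>\<Gamma>\<close> is an isomorphism
  \<open>Hom(F, A[\<Lambda>]) \<rightarrow> Hom(F, A[\<Gamma>])\<close>, natural in the \<open>A[\<Lambda>]\<close>-module \<open>F\<close>; this is where the index has
  to be finite.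
\<close>

section \<open>Modules\<close>

text \<open>\<open>Ext\<close> is tied to one chosen resolution per ring, and the two choices have
  bases in different types, because the tree type mentions the ring. They can meet only over the
  smaller group ring, as two resolutions of the same module. The terms of the restricted one still
  consist of functions into A[\<Lambda>]: they are isomorphic to free modules without being of the
  form \<open>free_module\<close>. Hence the comparison theorem is stated for
  \<open>resolution\<close>, with arbitrary modules as terms, and freeness up to isomorphism is a
  separate hypothesis.

  The equalities for S and Z hold between records: coarse graining leaves carrier and addition alone
  and pulls the action on cosets back along one ring map. For Q there is one more obstacle. The
  module under \<open>Ext\<close> is conjugated by the antipode, after restriction on one side and
  before it on the other. The antipode commutes with A[\<Gamma>] \<rightarrow> A[\<Lambda>] on the
  carrier, which is as much agreement as a resolution can see.\<close>

lemma mod_homI: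
  assumes "\<And>x. x \<in> carrier M \<Longrightarrow> h x \<in> carrier N"
    and "\<And>x y. x \<in> carrier M \<Longrightarrow> y \<in> carrier M \<Longrightarrow> h (x \<oplus>\<^bsub>M\<^esub> y) = h x \<oplus>\<^bsub>N\<^esub> h y"
    and "\<And>r x. r \<in> carrier R \<Longrightarrow> x \<in> carrier M \<Longrightarrow> h (r \<odot>\<^bsub>M\<^esub> x) = r \<odot>\<^bsub>N\<^esub> h x"
  shows "h \<in> mod_hom R M N"
  using assms by (auto simp: mod_hom_def)

lemma mod_hom_zero:
  assumes M: "module R M" and N: "module R N" and h: "h \<in> mod_hom R M N"
  shows "h \<zero>\<^bsub>M\<^esub> = \<zero>\<^bsub>N\<^esub>"
proof -
  interpret M: module R M by fact
  interpret N: module R N by fact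
  show ?thesis
    using mod_homD(3)[OF h, of "\<zero>\<^bsub>R\<^esub>" "\<zero>\<^bsub>M\<^esub>"] mod_homD(1)[OF h, of "\<zero>\<^bsub>M\<^esub>"] by simp
qed

lemma mod_hom_uminus:
  assumes M: "module R M" and N: "module R N" and h: "h \<in> mod_hom R M N" and x: "x \<in> carrier M"
  shows "h (\<ominus>\<^bsub>M\<^esub> x) = \<ominus>\<^bsub>N\<^esub> h x"
proof -
  interpret M: module R M by fact
  interpret N: module R N by fact
  have "h (\<ominus>\<^bsub>M\<^esub> x) = h ((\<ominus>\<^bsub>R\<^esub> \<one>\<^bsub>R\<^esub>) \<odot>\<^bsub>M\<^esub> x)"
    using x by (simp add: M.smult_l_minus)
  also have "\<dots> = \<ominus>\<^bsub>N\<^esub> h x"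
    using x mod_homD(1)[OF h x] by (simp add: mod_homD(3)[OF h] N.smult_l_minus)
  finally show ?thesis .
qed

lemma mod_hom_minus:
  assumes M: "module R M" and N: "module R N" and h: "h \<in> mod_hom R M N"
    and x: "x \<in> carrier M" "y \<in> carrier M"
  shows "h (x \<ominus>\<^bsub>M\<^esub> y) = h x \<ominus>\<^bsub>N\<^esub> h y"
proof -
  interpret M: module R M by fact
  show ?thesis
    using x by (simp add: a_minus_def mod_homD(2)[OF h] mod_hom_uminus[OF M N h])
qed

lemma mod_hom_comp:
  assumes "g \<in> mod_hom R M N" "h \<in> mod_hom R N K"
  shows "(\<lambda>x. h (g x)) \<in> mod_hom R M K"
  using assms by (auto simp: mod_hom_def Pi_iff)

lemma mod_hom_id: "(\<lambda>x. x) \<in> mod_hom R M M"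
  by (auto simp: mod_hom_def)

lemma mod_hom_cong:
  assumes M: "module R M" and "\<And>x. x \<in> carrier M \<Longrightarrow> f x = g x"
  shows "f \<in> mod_hom R M N \<longleftrightarrow> g \<in> mod_hom R M N"
proof -
  interpret M: module R M by fact
  show ?thesis using assms(2) by (auto simp: mod_hom_def Pi_iff)
qed

lemma mod_hom_add:
  assumes M: "module R M" and N: "module R N" and "f \<in> mod_hom R M N" "g \<in> mod_hom R M N"
  shows "(\<lambda>x. f x \<oplus>\<^bsub>N\<^esub> g x) \<in> mod_hom R M N"
proof -
  interpret M: module R M by fact
  interpret N: module R N by fact
  note f = mod_homD[OF assms(3)] and g = mod_homD[OF assms(4)]
  show ?thesis
    by (rule mod_homI) (simp_all add: f g N.M.a_ac N.smult_r_distr)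
qed

lemma mod_hom_smult:
  assumes M: "module R M" and N: "module R N" and "f \<in> mod_hom R M N" "r \<in> carrier R"
  shows "(\<lambda>x. r \<odot>\<^bsub>N\<^esub> f x) \<in> mod_hom R M N"
proof -
  interpret M: module R M by fact
  interpret N: module R N by fact
  note f = mod_homD[OF assms(3)]
  show ?thesis
  proof (rule mod_homI)
    fix s x assume sx: "s \<in> carrier R" "x \<in> carrier M"
    then show "r \<odot>\<^bsub>N\<^esub> f (s \<odot>\<^bsub>M\<^esub> x) = s \<odot>\<^bsub>N\<^esub> (r \<odot>\<^bsub>N\<^esub> f x)"
      using assms(4) f by (simp add: N.smult_assoc1[symmetric] M.R.m_comm)
  qed (use assms(4) f in \<open>simp_all add: N.smult_r_distr\<close>)
qed

lemma mod_hom_diff: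
  assumes M: "module R M" and N: "module R N" and "f \<in> mod_hom R M N" "g \<in> mod_hom R M N"
  shows "(\<lambda>x. f x \<ominus>\<^bsub>N\<^esub> g x) \<in> mod_hom R M N"
proof -
  interpret M: module R M by fact
  interpret N: module R N by fact
  have "(\<lambda>x. f x \<oplus>\<^bsub>N\<^esub> (\<ominus>\<^bsub>R\<^esub> \<one>\<^bsub>R\<^esub>) \<odot>\<^bsub>N\<^esub> g x) \<in> mod_hom R M N"
    by (intro mod_hom_add mod_hom_smult assms) simp
  then show ?thesis
    using mod_homD(1)[OF assms(4)]
    by (subst mod_hom_cong[OF M, where g = "\<lambda>x. f x \<oplus>\<^bsub>N\<^esub> (\<ominus>\<^bsub>R\<^esub> \<one>\<^bsub>R\<^esub>) \<odot>\<^bsub>N\<^esub> g x"])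
       (simp_all add: N.smult_l_minus a_minus_def)
qed

lemma mod_iso_refl: "mod_iso R M M"
  using mod_hom_id[of R M] unfolding mod_iso_def by (blast intro: bij_betw_id[unfolded id_def])

lemma mod_hom_inv_into:
  assumes M: "module R M" and h: "h \<in> mod_hom R M N" and b: "bij_betw h (carrier M) (carrier N)"
  shows "inv_into (carrier M) h \<in> mod_hom R N M"
proof -
  interpret M: module R M by fact
  let ?g = "inv_into (carrier M) h"
  have gc: "?g y \<in> carrier M" if "y \<in> carrier N" for y
    using bij_betw_inv_into[OF b] that by (auto dest: bij_betwE)
  have hg: "h (?g y) = y" if "y \<in> carrier N" for y
    using b that by (simp add: bij_betw_inv_into_right)
  have gh: "?g (h x) = x" if "x \<in> carrier M" for x
    using b that by (simp add: bij_betw_inv_into_left)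
  show ?thesis
  proof (rule mod_homI)
    fix x y assume "x \<in> carrier N" "y \<in> carrier N"
    then show "?g (x \<oplus>\<^bsub>N\<^esub> y) = ?g x \<oplus>\<^bsub>M\<^esub> ?g y"
      using gh[of "?g x \<oplus>\<^bsub>M\<^esub> ?g y"] by (simp add: mod_homD(2)[OF h] gc hg)
  next
    fix r x assume "r \<in> carrier R" "x \<in> carrier N"
    then show "?g (r \<odot>\<^bsub>N\<^esub> x) = r \<odot>\<^bsub>M\<^esub> ?g x"
      using gh[of "r \<odot>\<^bsub>M\<^esub> ?g x"] by (simp add: mod_homD(3)[OF h] gc hg)
  qed (rule gc)
qed

lemma mod_iso_sym:
  assumes M: "module R M" and iso: "mod_iso R M N"
  shows "mod_iso R N M"
  using iso mod_hom_inv_into[OF M] bij_betw_inv_into unfolding mod_iso_def by blast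

lemma mod_iso_trans:
  assumes "mod_iso R M N" "mod_iso R N K"
  shows "mod_iso R M K"
proof -
  obtain f where f: "f \<in> mod_hom R M N" "bij_betw f (carrier M) (carrier N)"
    using assms(1) by (auto simp: mod_iso_def)
  obtain g where g: "g \<in> mod_hom R N K" "bij_betw g (carrier N) (carrier K)"
    using assms(2) by (auto simp: mod_iso_def)
  show ?thesis
    unfolding mod_iso_def
    using mod_hom_comp[OF f(1) g(1)] bij_betw_trans[OF f(2) g(2)] by (auto simp: comp_def)
qed

section \<open>Submodules; closure under negation is closure under the scalar -1\<close>

lemma submodule_add_smultI:
  assumes M: "module R M" and "H \<subseteq> carrier M" "\<zero>\<^bsub>M\<^esub> \<in> H"
    and "\<And>x y. x \<in> H \<Longrightarrow> y \<in> H \<Longrightarrow> x \<oplus>\<^bsub>M\<^esub> y \<in> H"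
    and sm: "\<And>r x. r \<in> carrier R \<Longrightarrow> x \<in> H \<Longrightarrow> r \<odot>\<^bsub>M\<^esub> x \<in> H"
  shows "submodule H R M"
proof -
  interpret M: module R M by fact
  show ?thesis
  proof (rule M.submoduleI)
    fix a assume a: "a \<in> H"
    then have "(\<ominus>\<^bsub>R\<^esub> \<one>\<^bsub>R\<^esub>) \<odot>\<^bsub>M\<^esub> a \<in> H" by (intro sm) auto
    moreover have "a \<in> carrier M" using a assms(2) by blast
    ultimately show "\<ominus>\<^bsub>M\<^esub> a \<in> H" by (simp add: M.smult_l_minus)
  qed (use assms in auto)
qed

lemma submodule_zero_closed: "submodule H R M \<Longrightarrow> \<zero>\<^bsub>M\<^esub> \<in> H"
  using subgroup.one_closed[OF submodule.axioms(1)] by fastforce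

lemma submodule_of_submodule:
  assumes M: "module R M" and K: "submodule K R M" and H: "submodule H R M" and "H \<subseteq> K"
  shows "submodule H R (M\<lparr>carrier := K\<rparr>)"
  by (rule submodule_add_smultI[OF submodule.submodule_is_module[OF K M]])
     (use assms module.submoduleE[OF M H] submodule_zero_closed[OF H] in auto)

lemma submodule_image:
  assumes M: "module R M" and N: "module R N" and h: "h \<in> mod_hom R M N"
  shows "submodule (h ` carrier M) R N"
proof -
  interpret M: module R M by fact
  note hD = mod_homD[OF h]
  show ?thesis
  proof (rule submodule_add_smultI[OF N])
    show "\<zero>\<^bsub>N\<^esub> \<in> h ` carrier M"
      using mod_hom_zero[OF M N h] by (metis M.M.zero_closed imageI)
    fix x y assume "x \<in> h ` carrier M" "y \<in> h ` carrier M"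
    then show "x \<oplus>\<^bsub>N\<^esub> y \<in> h ` carrier M" by (auto simp: hD(2)[symmetric])
  qed (auto simp: hD(1) hD(3)[symmetric])
qed

section \<open>Restriction of scalars and the regular module\<close>

lemma restrict_scalars_simps [simp]:
  "carrier (restrict_scalars \<phi> M) = carrier M"
  "\<zero>\<^bsub>restrict_scalars \<phi> M\<^esub> = \<zero>\<^bsub>M\<^esub>"
  "add (restrict_scalars \<phi> M) = add M"
  "r \<odot>\<^bsub>restrict_scalars \<phi> M\<^esub> x = \<phi> r \<odot>\<^bsub>M\<^esub> x"
  by (simp_all add: restrict_scalars_def)

lemma restrict_scalars_module:
  assumes R: "cring R" and S: "module S M" and \<phi>: "\<phi> \<in> ring_hom R S"
  shows "module R (restrict_scalars \<phi> M)"
proof -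
  interpret M: module S M by fact
  show ?thesis
  proof (rule moduleI[OF R])
    show "abelian_group (restrict_scalars \<phi> M)"
      by (rule abelian_groupI) (auto simp: M.M.a_ac intro: M.M.l_neg)
  qed (use ring_hom_memE[OF \<phi>] in
      \<open>auto simp: M.smult_l_distr M.smult_r_distr M.smult_assoc1\<close>)
qed

lemma restrict_scalars_mod_hom:
  assumes \<phi>: "\<phi> \<in> ring_hom R S" and h: "h \<in> mod_hom S M N"
  shows "h \<in> mod_hom R (restrict_scalars \<phi> M) (restrict_scalars \<phi> N)"
  by (rule mod_homI) (simp_all add: mod_homD[OF h] ring_hom_closed[OF \<phi>])

lemma regular_module_simps [simp]:
  "carrier (regular_module R) = carrier R"
  "\<zero>\<^bsub>regular_module R\<^esub> = \<zero>\<^bsub>R\<^esub>"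
  "add (regular_module R) = add R"
  "smult (regular_module R) = mult R"
  by (simp_all add: regular_module_def)

lemma regular_module_is_module:
  assumes "cring R"
  shows "module R (regular_module R)"
proof -
  interpret R: cring R by fact
  show ?thesis
  proof (rule moduleI[OF assms])
    show "abelian_group (regular_module R)"
      by (rule abelian_groupI) (auto simp: R.a_ac intro: R.l_neg)
  qed (auto simp: R.l_distr R.r_distr R.m_assoc)
qed


section \<open>Quotient modules\<close>

lemma abelian_subgroup_submodule:
  assumes "module R M" "submodule N R M"
  shows "abelian_subgroup N M"
  using assms by (intro abelian_subgroupI3 additive_subgroup.intro)
    (auto intro: submodule.axioms(1) module.axioms(2))

lemma quotient_module_simps [simp]:
  "carrier (quotient_module M N) = a_rcosets\<^bsub>M\<^esub> N"
  "\<zero>\<^bsub>quotient_module M N\<^esub> = N"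
  "add (quotient_module M N) = set_add M"
  "r \<odot>\<^bsub>quotient_module M N\<^esub> X = (\<Union>x\<in>X. N +>\<^bsub>M\<^esub> (r \<odot>\<^bsub>M\<^esub> x))"
  by (simp_all add: quotient_module_def)

lemma carrier_quotient_module:
  "a_rcosets\<^bsub>M\<^esub> N = (\<lambda>x. N +>\<^bsub>M\<^esub> x) ` carrier M"
  by (auto simp: A_RCOSETS_def' a_r_coset_def')

lemma coset_eqI:
  assumes M: "module R M" and N: "submodule N R M"
    and "x \<in> carrier M" "n \<in> N" "y = n \<oplus>\<^bsub>M\<^esub> x"
  shows "N +>\<^bsub>M\<^esub> y = N +>\<^bsub>M\<^esub> x"
proof -
  interpret M: module R M by fact
  have "y \<in> N +>\<^bsub>M\<^esub> x" using assms by (auto simp: a_r_coset_def')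
  then show ?thesis
    using M.M.a_repr_independence[OF _ assms(3) submodule.axioms(1)[OF N]] by simp
qed

text \<open>Both the scalar action of \<open>quotient_module\<close> and the induced map in
  \<open>mod_iso_quotientI\<close> are written as unions over the representatives of a coset.
  Independence of the representative makes all members of the union equal, so it collapses to one of
  them.\<close>

lemma UN_coset_eq:
  assumes M: "module R M" and N: "submodule N R M" and x: "x \<in> carrier M"
    and f: "\<And>n. n \<in> N \<Longrightarrow> f (n \<oplus>\<^bsub>M\<^esub> x) = f x"
  shows "(\<Union>y\<in>N +>\<^bsub>M\<^esub> x. f y) = f x"
proof -
  have "N \<noteq> {}" using module.submoduleE(2)[OF M N] .
  then show ?thesis using f by (auto simp: a_r_coset_def')
qed

lemma quotient_module_smult:
  assumes M: "module R M" and N: "submodule N R M" and x: "x \<in> carrier M" and r: "r \<in> carrier R"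
  shows "r \<odot>\<^bsub>quotient_module M N\<^esub> (N +>\<^bsub>M\<^esub> x) = N +>\<^bsub>M\<^esub> (r \<odot>\<^bsub>M\<^esub> x)"
proof -
  interpret M: module R M by fact
  note NE = M.submoduleE[OF N]
  have "N +>\<^bsub>M\<^esub> (r \<odot>\<^bsub>M\<^esub> (n \<oplus>\<^bsub>M\<^esub> x)) = N +>\<^bsub>M\<^esub> (r \<odot>\<^bsub>M\<^esub> x)" if "n \<in> N" for n
    by (rule coset_eqI[OF M N, of _ "r \<odot>\<^bsub>M\<^esub> n"])
       (use that NE(1,4) r x in \<open>auto intro!: M.smult_r_distr\<close>)
  then show ?thesis using UN_coset_eq[OF M N x, of "\<lambda>x. N +>\<^bsub>M\<^esub> (r \<odot>\<^bsub>M\<^esub> x)"] by simp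
qed

lemma quotient_module_is_module:
  assumes M: "module R M" and N: "submodule N R M"
  shows "module R (quotient_module M N)"
proof -
  interpret M: module R M by fact
  interpret N: abelian_subgroup N M by (rule abelian_subgroup_submodule[OF M N])
  have N0: "N +>\<^bsub>M\<^esub> \<zero>\<^bsub>M\<^esub> = N" using N.a_subset by simp
  note sm = quotient_module_smult[OF M N]
  note sum = N.a_rcos_sum
  show ?thesis
  proof (rule moduleI)
    show "abelian_group (quotient_module M N)"
    proof (rule abelian_groupI)
      show "\<zero>\<^bsub>quotient_module M N\<^esub> \<in> carrier (quotient_module M N)"
        using N0 by (metis M.M.zero_closed carrier_quotient_module imageI quotient_module_simps(1,2))
      fix X assume "X \<in> carrier (quotient_module M N)"
      then obtain x where x: "x \<in> carrier M" "X = N +>\<^bsub>M\<^esub> x" by (auto simp: carrier_quotient_module)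
      show "\<zero>\<^bsub>quotient_module M N\<^esub> \<oplus>\<^bsub>quotient_module M N\<^esub> X = X"
        using sum[of "\<zero>\<^bsub>M\<^esub>" x] x N0 by simp
      show "\<exists>Y\<in>carrier (quotient_module M N). Y \<oplus>\<^bsub>quotient_module M N\<^esub> X = \<zero>\<^bsub>quotient_module M N\<^esub>"
        by (rule bexI[of _ "N +>\<^bsub>M\<^esub> (\<ominus>\<^bsub>M\<^esub> x)"])
           (use x N0 in \<open>auto simp: carrier_quotient_module sum M.M.l_neg\<close>)
    qed (auto simp: carrier_quotient_module sum M.M.a_ac)
  qed (use N0 in \<open>auto simp: carrier_quotient_module sum sm M.smult_l_distr M.smult_r_distr
        M.smult_assoc1 M.R.is_cring simp del: quotient_module_simps(4)\<close>)
qed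

text \<open>The condition that N is the full preimage of N' does two jobs: one direction makes the
  induced map on cosets well defined, the other makes it injective. Surjectivity is asked only
  modulo N', as is natural for cohomology classes.\<close>

lemma mod_iso_quotientI:
  assumes M: "module R M" and M': "module R M'"
    and N: "submodule N R M" and N': "submodule N' R M'"
    and \<alpha>: "\<alpha> \<in> mod_hom R M M'"
    and ker: "\<And>a. a \<in> carrier M \<Longrightarrow> \<alpha> a \<in> N' \<longleftrightarrow> a \<in> N"
    and surj: "\<And>b. b \<in> carrier M' \<Longrightarrow> \<exists>a\<in>carrier M. \<exists>n\<in>N'. b = n \<oplus>\<^bsub>M'\<^esub> \<alpha> a"
  shows "mod_iso R (quotient_module M N) (quotient_module M' N')"
proof -
  interpret M: module R M by fact
  interpret M': module R M' by fact
  interpret N: abelian_subgroup N M by (rule abelian_subgroup_submodule[OF M N])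
  interpret N': abelian_subgroup N' M' by (rule abelian_subgroup_submodule[OF M' N'])
  note \<alpha>D = mod_homD[OF \<alpha>]
  define h where "h X = (\<Union>x\<in>X. N' +>\<^bsub>M'\<^esub> \<alpha> x)" for X
  have h: "h (N +>\<^bsub>M\<^esub> x) = N' +>\<^bsub>M'\<^esub> \<alpha> x" if "x \<in> carrier M" for x
    unfolding h_def
  proof (rule UN_coset_eq[OF M N that])
    fix n assume "n \<in> N"
    then show "N' +>\<^bsub>M'\<^esub> \<alpha> (n \<oplus>\<^bsub>M\<^esub> x) = N' +>\<^bsub>M'\<^esub> \<alpha> x"
      using that by (intro coset_eqI[OF M' N', of _ "\<alpha> n"]) (auto simp: \<alpha>D ker)
  qed
  have hom: "h \<in> mod_hom R (quotient_module M N) (quotient_module M' N')"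
    by (rule mod_homI)
       (auto simp: carrier_quotient_module h \<alpha>D N.a_rcos_sum N'.a_rcos_sum
         quotient_module_smult[OF M N] quotient_module_smult[OF M' N']
         simp del: quotient_module_simps(4))
  have inj: "inj_on h (a_rcosets\<^bsub>M\<^esub> N)"
  proof (rule inj_onI)
    fix X Y assume "X \<in> a_rcosets\<^bsub>M\<^esub> N" "Y \<in> a_rcosets\<^bsub>M\<^esub> N" and eq: "h X = h Y"
    then obtain x y where x: "x \<in> carrier M" "X = N +>\<^bsub>M\<^esub> x" and y: "y \<in> carrier M" "Y = N +>\<^bsub>M\<^esub> y"
      by (auto simp: carrier_quotient_module)
    have "\<alpha> x \<in> N' +>\<^bsub>M'\<^esub> \<alpha> y" using eq x y N'.a_rcos_self[of "\<alpha> x"] by (simp add: h \<alpha>D)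
    then obtain n where n: "n \<in> N'" "\<alpha> x = n \<oplus>\<^bsub>M'\<^esub> \<alpha> y" by (auto simp: a_r_coset_def')
    have "\<alpha> (x \<ominus>\<^bsub>M\<^esub> y) = \<alpha> x \<ominus>\<^bsub>M'\<^esub> \<alpha> y" using x y by (simp add: mod_hom_minus[OF M M' \<alpha>])
    also have "\<dots> = n"
      using y n by (simp add: \<alpha>D a_minus_def M'.M.a_assoc M'.M.r_neg)
    finally have "\<alpha> (x \<ominus>\<^bsub>M\<^esub> y) = n" .
    then have "x \<ominus>\<^bsub>M\<^esub> y \<in> N" using ker[of "x \<ominus>\<^bsub>M\<^esub> y"] n x y by simp
    moreover have "x = (x \<ominus>\<^bsub>M\<^esub> y) \<oplus>\<^bsub>M\<^esub> y"
      using x y by (simp add: a_minus_def M.M.a_assoc M.M.l_neg)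
    ultimately show "X = Y" using coset_eqI[OF M N y(1)] x y by blast
  qed
  have "h ` (a_rcosets\<^bsub>M\<^esub> N) = a_rcosets\<^bsub>M'\<^esub> N'"
  proof
    show "h ` (a_rcosets\<^bsub>M\<^esub> N) \<subseteq> a_rcosets\<^bsub>M'\<^esub> N'"
      by (auto simp: carrier_quotient_module h \<alpha>D)
    show "a_rcosets\<^bsub>M'\<^esub> N' \<subseteq> h ` (a_rcosets\<^bsub>M\<^esub> N)"
    proof
      fix Y assume "Y \<in> a_rcosets\<^bsub>M'\<^esub> N'"
      then obtain b where b: "b \<in> carrier M'" "Y = N' +>\<^bsub>M'\<^esub> b" by (auto simp: carrier_quotient_module)
      obtain a n where a: "a \<in> carrier M" and n: "n \<in> N'" "b = n \<oplus>\<^bsub>M'\<^esub> \<alpha> a"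
        using surj[OF b(1)] by blast
      have "Y = h (N +>\<^bsub>M\<^esub> a)" using coset_eqI[OF M' N' \<alpha>D(1)[OF a] n] b by (simp add: h a)
      then show "Y \<in> h ` (a_rcosets\<^bsub>M\<^esub> N)" using a by (auto simp: carrier_quotient_module)
    qed
  qed
  with hom inj show ?thesis by (auto simp: mod_iso_def bij_betw_def)
qed

text \<open>Cosets and their sums depend on the additive structure alone, and the scalar action on a
  coset is built elementwise from the action on the module. Both orders of construction therefore
  give the same record, which is why S and Z come out as equalities rather than
  isomorphisms.\<close>

lemma restrict_scalars_quotient:
  "restrict_scalars \<phi> (quotient_module (M\<lparr>carrier := Z\<rparr>) N) =
    quotient_module ((restrict_scalars \<phi> M)\<lparr>carrier := Z\<rparr>) N"
  by (simp add: restrict_scalars_def quotient_module_def A_RCOSETS_def' a_r_coset_def' set_add_def' fun_eq_iff)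

lemma restrict_scalars_quotient_module:
  "restrict_scalars \<phi> (quotient_module M N) = quotient_module (restrict_scalars \<phi> M) N"
  by (simp add: restrict_scalars_def quotient_module_def A_RCOSETS_def' a_r_coset_def' set_add_def' fun_eq_iff)


section \<open>Modules of homomorphisms\<close>

lemma Hom_module_simps [simp]:
  "carrier (Hom_module R M N) = mod_hom R M N \<inter> extensional (carrier M)"
  "\<zero>\<^bsub>Hom_module R M N\<^esub> = (\<lambda>x\<in>carrier M. \<zero>\<^bsub>N\<^esub>)"
  "f \<oplus>\<^bsub>Hom_module R M N\<^esub> g = (\<lambda>x\<in>carrier M. f x \<oplus>\<^bsub>N\<^esub> g x)"
  "r \<odot>\<^bsub>Hom_module R M N\<^esub> f = (\<lambda>x\<in>carrier M. r \<odot>\<^bsub>N\<^esub> f x)"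
  by (simp_all add: Hom_module_def)

lemma mod_hom_restrict:
  assumes "module R M"
  shows "restrict f (carrier M) \<in> mod_hom R M N \<longleftrightarrow> f \<in> mod_hom R M N"
  by (rule mod_hom_cong[OF assms]) simp

lemma Hom_module_is_module:
  assumes M: "module R M" and N: "module R N"
  shows "module R (Hom_module R M N)"
proof -
  interpret M: module R M by fact
  interpret N: module R N by fact
  have zero: "(\<lambda>x. \<zero>\<^bsub>N\<^esub>) \<in> mod_hom R M N" by (rule mod_homI) auto
  note ext = extensionalityI[where A = "carrier M"]
  note D = mod_homD(1)[where R = R and M = M and N = N]
  show ?thesis
  proof (rule moduleI)
    show "abelian_group (Hom_module R M N)"
    proof (rule abelian_groupI)
      fix f assume f: "f \<in> carrier (Hom_module R M N)"
      have "(\<lambda>x. \<zero>\<^bsub>N\<^esub> \<ominus>\<^bsub>N\<^esub> f x) \<in> mod_hom R M N"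
        using mod_hom_diff[OF M N zero] f by auto
      then show "\<exists>g\<in>carrier (Hom_module R M N). g \<oplus>\<^bsub>Hom_module R M N\<^esub> f = \<zero>\<^bsub>Hom_module R M N\<^esub>"
        using f by (intro bexI[of _ "\<lambda>x\<in>carrier M. \<zero>\<^bsub>N\<^esub> \<ominus>\<^bsub>N\<^esub> f x"])
          (auto simp: mod_hom_restrict[OF M] a_minus_def N.M.l_neg D intro!: ext)
    qed (auto simp: mod_hom_restrict[OF M] zero mod_hom_add[OF M N] D N.M.a_ac
        intro!: ext)
  qed (auto simp: M.R.is_cring mod_hom_restrict[OF M] mod_hom_smult[OF M N] D N.smult_l_distr
      N.smult_r_distr N.smult_assoc1 intro!: ext)
qed

text \<open>Contravariance of Hom. \<open>compose\<close> also cuts the result down to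
  \<open>carrier M\<close>, as the extensional elements of \<open>Hom_module\<close>
  require.\<close>

lemma mod_hom_precompose:
  assumes M: "module R M" and M': "module R M'" and c: "c \<in> mod_hom R M M'"
  shows "(\<lambda>f. compose (carrier M) f c) \<in> mod_hom R (Hom_module R M' N) (Hom_module R M N)"
  by (rule mod_homI)
     (auto simp: compose_def mod_hom_restrict[OF M] mod_homD[OF c] fun_eq_iff
       intro: mod_hom_comp[OF c])


section \<open>Finitely supported functions\<close>

text \<open>With a = 1 over a ring this is a basis vector of a free module; in a group ring or group
  module it is the monomial a x^g.\<close>

definition single :: "('m, 'a) ring_scheme \<Rightarrow> 'x \<Rightarrow> 'm \<Rightarrow> 'x \<Rightarrow> 'm" where
  "single M x a = (\<lambda>y. if y = x then a else \<zero>\<^bsub>M\<^esub>)"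

lemma finsupp_closed:
  assumes "f \<in> finsupp X M" "\<zero>\<^bsub>M\<^esub> \<in> carrier M"
  shows "f x \<in> carrier M"
  using assms by (cases "x \<in> X") (auto simp: finsupp_def)

lemma finsuppD:
  assumes "f \<in> finsupp X M"
  shows "finite {x. f x \<noteq> \<zero>\<^bsub>M\<^esub>}" and "x \<notin> X \<Longrightarrow> f x = \<zero>\<^bsub>M\<^esub>" and "f x \<noteq> \<zero>\<^bsub>M\<^esub> \<Longrightarrow> x \<in> X"
    and "{x. f x \<noteq> \<zero>\<^bsub>M\<^esub>} \<subseteq> X"
  using assms by (auto simp: finsupp_def)

lemma zero_finsupp: "\<zero>\<^bsub>M\<^esub> \<in> carrier M \<Longrightarrow> (\<lambda>_. \<zero>\<^bsub>M\<^esub>) \<in> finsupp X M"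
  by (rule finsuppI[where A = "{}"]) auto

lemma single_finsupp:
  assumes "a \<in> carrier M" "x \<in> X" "\<zero>\<^bsub>M\<^esub> \<in> carrier M"
  shows "single M x a \<in> finsupp X M"
  by (rule finsuppI[where A = "{x}"]) (use assms in \<open>auto simp: single_def\<close>)

lemma (in abelian_monoid) add_finsupp:
  assumes "f \<in> finsupp X G" "g \<in> finsupp X G"
  shows "(\<lambda>x. f x \<oplus> g x) \<in> finsupp X G"
  by (rule finsuppI[where A = "{x. f x \<noteq> \<zero>} \<union> {x. g x \<noteq> \<zero>}"])
     (use assms in \<open>auto simp: finsupp_closed finsuppD(1) finsuppD(2)[OF assms(1)] finsuppD(2)[OF assms(2)]\<close>)

text \<open>A finitely supported function is a finite sum of monomials. All additive statements
  about group rings below are reduced to monomials by this rule.\<close>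

lemma (in abelian_monoid) finsupp_induct [consumes 1, case_names zero add]:
  assumes f: "f \<in> finsupp X G" and zero: "P (\<lambda>_. \<zero>)"
    and step: "\<And>a x f. a \<in> carrier G \<Longrightarrow> x \<in> X \<Longrightarrow> f \<in> finsupp X G \<Longrightarrow> P f \<Longrightarrow>
      P (\<lambda>y. single G x a y \<oplus> f y)"
  shows "P f"
proof -
  \<comment> \<open>The induction runs over a finite set containing the support instead of the
    support itself, so the value at the removed point is allowed to be zero.\<close>
  have "P f" if "finite S" "S \<subseteq> X" "f \<in> finsupp X G" "{x. f x \<noteq> \<zero>} \<subseteq> S" for S
    using that
  proof (induction S arbitrary: f)
    case empty
    then have "f = (\<lambda>_. \<zero>)" by auto
    then show ?case using zero by simp
  next
    case (insert x S)
    let ?g = "f(x := \<zero>)"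
    have fc: "f y \<in> carrier G" for y using insert.prems(2) by (simp add: finsupp_closed)
    have g: "?g \<in> finsupp X G"
      by (rule finsuppI[where A = "insert x S"]) (use insert.hyps insert.prems(1,3) finsuppD(2)[OF insert.prems(2)] in \<open>auto simp: fc\<close>)
    have "P (\<lambda>y. single G x (f x) y \<oplus> ?g y)"
    proof (rule step[OF fc _ g insert.IH[OF _ g]])
      show "x \<in> X" "S \<subseteq> X" "{y. ?g y \<noteq> \<zero>} \<subseteq> S" using insert.prems(1,3) by auto
    qed
    moreover have "(\<lambda>y. single G x (f x) y \<oplus> ?g y) = f"
      by (auto simp: single_def fc)
    ultimately show ?case by simp
  qed
  then show ?thesis using f finsuppD[OF f] by blast
qed

lemma mod_hom_free_eqI:
  assumes R: "cring R" and N: "module R N"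
    and f: "f \<in> mod_hom R (free_module R X) N" and g: "g \<in> mod_hom R (free_module R X) N"
    and eq: "\<And>x. x \<in> X \<Longrightarrow> f (single R x \<one>\<^bsub>R\<^esub>) = g (single R x \<one>\<^bsub>R\<^esub>)"
    and v: "v \<in> finsupp X R"
  shows "f v = g v"
proof -
  interpret R: cring R by fact
  have F: "module R (free_module R X)" by (rule free_module_is_module[OF R])
  show ?thesis
    using v
  proof (induction v rule: R.finsupp_induct)
    case zero
    then show ?case using mod_hom_zero[OF F N f] mod_hom_zero[OF F N g] by simp
  next
    case (add a x v)
    have s: "single R x a = a \<odot>\<^bsub>free_module R X\<^esub> single R x \<one>\<^bsub>R\<^esub>"
      using add by (auto simp: single_def)
    have "f (single R x a) = g (single R x a)"
      unfolding s using add eq by (simp add: mod_homD(3)[OF f] mod_homD(3)[OF g] single_finsupp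
        del: free_module_simps(4))
    then show ?case
      using add mod_homD(2)[OF f, of "single R x a" v] mod_homD(2)[OF g, of "single R x a" v]
      by (simp add: single_finsupp)
  qed
qed

lemma free_module_extension:
  assumes N: "module R N" and u: "\<And>x. x \<in> X \<Longrightarrow> u x \<in> carrier N"
  obtains h where "h \<in> mod_hom R (free_module R X) N"
    and "\<And>x. x \<in> X \<Longrightarrow> h (single R x \<one>\<^bsub>R\<^esub>) = u x"
proof -
  interpret N: module R N by fact
  define h where "h f = (\<Oplus>\<^bsub>N\<^esub>x\<in>{x. f x \<noteq> \<zero>\<^bsub>R\<^esub>}. f x \<odot>\<^bsub>N\<^esub> u x)" for f
  \<comment> \<open>Cancellation can make the support of a sum or multiple smaller than expected.
    Letting the sum range over any finite set between the support and \<open>X\<close> gives the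
    terms of an identity a common index set.\<close>
  have eq: "h f = (\<Oplus>\<^bsub>N\<^esub>x\<in>A. f x \<odot>\<^bsub>N\<^esub> u x)"
    if "f \<in> finsupp X R" "finite A" "{x. f x \<noteq> \<zero>\<^bsub>R\<^esub>} \<subseteq> A" "A \<subseteq> X" for f A
    unfolding h_def
    by (rule N.M.add.finprod_mono_neutral_cong_left)
       (use that u in \<open>auto simp: finsupp_closed subset_iff\<close>)
  have hom: "h \<in> mod_hom R (free_module R X) N"
  proof (rule mod_homI)
    fix f assume f: "f \<in> carrier (free_module R X)"
    then have "f x \<in> carrier R" "f x \<noteq> \<zero>\<^bsub>R\<^esub> \<Longrightarrow> x \<in> X" for x
      using finsupp_closed[of f X R] finsuppD(3)[of f X R] by auto
    then show "h f \<in> carrier N"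
      unfolding h_def using u by (intro N.M.finsum_closed) auto
    fix g assume g: "g \<in> carrier (free_module R X)"
    let ?A = "{x. f x \<noteq> \<zero>\<^bsub>R\<^esub>} \<union> {x. g x \<noteq> \<zero>\<^bsub>R\<^esub>}"
    have A: "finite ?A" "?A \<subseteq> X" using finsuppD(1,4)[of f X R] finsuppD(1,4)[of g X R] f g by auto
    have fg: "(\<lambda>x. f x \<oplus>\<^bsub>R\<^esub> g x) \<in> finsupp X R" using f g by (auto intro: N.R.add_finsupp)
    have fc: "f x \<in> carrier R" and gc: "g x \<in> carrier R" for x
      using finsupp_closed[of f X R] finsupp_closed[of g X R] f g by auto
    have uA: "u x \<in> carrier N" if "x \<in> ?A" for x using A(2) u that by blast
    have "h (\<lambda>x. f x \<oplus>\<^bsub>R\<^esub> g x) = (\<Oplus>\<^bsub>N\<^esub>x\<in>?A. (f x \<oplus>\<^bsub>R\<^esub> g x) \<odot>\<^bsub>N\<^esub> u x)"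
      by (rule eq[OF fg A(1) _ A(2)]) auto
    also have "\<dots> = (\<Oplus>\<^bsub>N\<^esub>x\<in>?A. f x \<odot>\<^bsub>N\<^esub> u x \<oplus>\<^bsub>N\<^esub> g x \<odot>\<^bsub>N\<^esub> u x)"
      using fc gc uA by (intro N.M.finsum_cong') (auto simp: N.smult_l_distr)
    also have "\<dots> = (\<Oplus>\<^bsub>N\<^esub>x\<in>?A. f x \<odot>\<^bsub>N\<^esub> u x) \<oplus>\<^bsub>N\<^esub> (\<Oplus>\<^bsub>N\<^esub>x\<in>?A. g x \<odot>\<^bsub>N\<^esub> u x)"
      using fc gc uA by (intro N.M.finsum_addf) auto
    also have "(\<Oplus>\<^bsub>N\<^esub>x\<in>?A. f x \<odot>\<^bsub>N\<^esub> u x) = h f"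
      by (rule eq[OF _ A(1) _ A(2), symmetric]) (use f in auto)
    also have "(\<Oplus>\<^bsub>N\<^esub>x\<in>?A. g x \<odot>\<^bsub>N\<^esub> u x) = h g"
      by (rule eq[OF _ A(1) _ A(2), symmetric]) (use g in auto)
    finally show "h (f \<oplus>\<^bsub>free_module R X\<^esub> g) = h f \<oplus>\<^bsub>N\<^esub> h g" by simp
  next
    fix r f assume r: "r \<in> carrier R" and f: "f \<in> carrier (free_module R X)"
    let ?A = "{x. f x \<noteq> \<zero>\<^bsub>R\<^esub>}"
    have A: "finite ?A" "?A \<subseteq> X" using finsuppD(1,4)[of f X R] f by auto
    have fc: "f x \<in> carrier R" for x using finsupp_closed[of f X R] f by auto
    have uA: "u x \<in> carrier N" if "x \<in> ?A" for x using A(2) u that by blast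
    have rf: "(\<lambda>x. r \<otimes>\<^bsub>R\<^esub> f x) \<in> finsupp X R"
      by (rule finsuppI[where A = ?A]) (use r A fc finsuppD(2)[of f X R] f in auto)
    have "h (\<lambda>x. r \<otimes>\<^bsub>R\<^esub> f x) = (\<Oplus>\<^bsub>N\<^esub>x\<in>?A. (r \<otimes>\<^bsub>R\<^esub> f x) \<odot>\<^bsub>N\<^esub> u x)"
      by (rule eq[OF rf A(1) _ A(2)]) (use r in auto)
    also have "\<dots> = (\<Oplus>\<^bsub>N\<^esub>x\<in>?A. r \<odot>\<^bsub>N\<^esub> (f x \<odot>\<^bsub>N\<^esub> u x))"
      using r fc uA by (intro N.M.finsum_cong') (auto simp: N.smult_assoc1)
    also have "\<dots> = r \<odot>\<^bsub>N\<^esub> h f"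
      unfolding h_def using A r fc uA by (intro N.finsum_smult_ldistr[symmetric]) auto
    finally show "h (r \<odot>\<^bsub>free_module R X\<^esub> f) = r \<odot>\<^bsub>N\<^esub> h f" by simp
  qed
  have "h (single R x \<one>\<^bsub>R\<^esub>) = u x" if "x \<in> X" for x
    using that u[OF that]
    by (subst eq[where A = "{x}"]) (auto simp: single_finsupp, auto simp: single_def split: if_splits)
  with hom that show ?thesis by blast
qed


section \<open>Comparison of resolutions\<close>

text \<open>Projectivity: choose preimages of the values on the basis and extend linearly. The
  condition compares the image of \<open>h\<close> with that of \<open>p\<close>, since exactness of
  a resolution provides exactly such inclusions.\<close>

lemma free_lift:
  assumes N: "module R N" and N': "module R N'" and p: "p \<in> mod_hom R N N'"
    and h: "h \<in> mod_hom R (free_module R X) N'" and im: "h ` finsupp X R \<subseteq> p ` carrier N"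
  obtains h' where "h' \<in> mod_hom R (free_module R X) N"
    and "\<And>v. v \<in> finsupp X R \<Longrightarrow> p (h' v) = h v"
proof -
  interpret N: module R N by fact
  have s: "single R x \<one>\<^bsub>R\<^esub> \<in> finsupp X R" if "x \<in> X" for x using that by (simp add: single_finsupp)
  define u where "u x = (SOME y. y \<in> carrier N \<and> p y = h (single R x \<one>\<^bsub>R\<^esub>))" for x
  have u: "u x \<in> carrier N \<and> p (u x) = h (single R x \<one>\<^bsub>R\<^esub>)" if "x \<in> X" for x
  proof -
    have "h (single R x \<one>\<^bsub>R\<^esub>) \<in> p ` carrier N" using im s[OF that] by blast
    then have "\<exists>y. y \<in> carrier N \<and> p y = h (single R x \<one>\<^bsub>R\<^esub>)" by auto
    then show ?thesis unfolding u_def by (rule someI_ex)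
  qed
  obtain h' where h': "h' \<in> mod_hom R (free_module R X) N"
    "\<And>x. x \<in> X \<Longrightarrow> h' (single R x \<one>\<^bsub>R\<^esub>) = u x"
    using free_module_extension[OF N, of X u] u by blast
  have "p (h' v) = h v" if "v \<in> finsupp X R" for v
    using mod_hom_free_eqI[OF N.R.is_cring N' mod_hom_comp[OF h'(1) p] h _ that] h'(2) u by simp
  with h'(1) that show ?thesis by blast
qed

text \<open>The form of projectivity that applies to the terms of a restricted resolution, which are
  free only up to isomorphism: lift from the free module and compose with the isomorphism.\<close>

lemma mod_iso_free_lift:
  assumes P: "module R P" and free: "mod_iso R P (free_module R X)"
    and N: "module R N" and N': "module R N'" and p: "p \<in> mod_hom R N N'"
    and h: "h \<in> mod_hom R P N'" and im: "\<And>v. v \<in> carrier P \<Longrightarrow> h v \<in> p ` carrier N"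
  shows "\<exists>h'\<in>mod_hom R P N. \<forall>v\<in>carrier P. p (h' v) = h v"
proof -
  obtain \<psi> where \<psi>: "\<psi> \<in> mod_hom R P (free_module R X)"
    and b: "bij_betw \<psi> (carrier P) (carrier (free_module R X))"
    using free by (auto simp: mod_iso_def)
  let ?\<theta> = "inv_into (carrier P) \<psi>"
  have \<theta>: "?\<theta> \<in> mod_hom R (free_module R X) P" by (rule mod_hom_inv_into[OF P \<psi> b])
  have \<theta>\<psi>: "?\<theta> (\<psi> v) = v" if "v \<in> carrier P" for v
    using b that by (simp add: bij_betw_inv_into_left)
  have "(\<lambda>w. h (?\<theta> w)) ` finsupp X R \<subseteq> p ` carrier N" using im mod_homD(1)[OF \<theta>] by auto
  then obtain k where k: "k \<in> mod_hom R (free_module R X) N"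
    "\<And>w. w \<in> finsupp X R \<Longrightarrow> p (k w) = h (?\<theta> w)"
    using free_lift[OF N N' p mod_hom_comp[OF \<theta> h]] by blast
  show ?thesis
    using mod_hom_comp[OF \<psi> k(1)] k(2) mod_homD(1)[OF \<psi>] \<theta>\<psi>
    by (intro bexI[of _ "\<lambda>v. k (\<psi> v)"]) auto
qed

text \<open>Generalises \<open>free_resolution\<close> to arbitrary terms, so that the restriction
  of a free resolution to the smaller group ring is again an instance.\<close>

definition resolution ::
  "('r, 'a) ring_scheme \<Rightarrow> ('r, 'm) module \<Rightarrow> (nat \<Rightarrow> ('r, 'p) module) \<Rightarrow>
    (nat \<Rightarrow> 'p \<Rightarrow> 'p) \<Rightarrow> ('p \<Rightarrow> 'm) \<Rightarrow> bool" where
  "resolution R M F d \<epsilon> \<longleftrightarrow>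
    (\<forall>k. module R (F k)) \<and>
    \<epsilon> \<in> mod_hom R (F 0) M \<and> \<epsilon> ` carrier (F 0) = carrier M \<and>
    (\<forall>k. d k \<in> mod_hom R (F (Suc k)) (F k)) \<and>
    d 0 ` carrier (F (Suc 0)) = mod_ker (F 0) M \<epsilon> \<and>
    (\<forall>k. d (Suc k) ` carrier (F (Suc (Suc k))) = mod_ker (F (Suc k)) (F k) (d k))"

lemma resolutionD:
  assumes "resolution R M F d \<epsilon>"
  shows "module R (F k)" and "\<epsilon> \<in> mod_hom R (F 0) M" and "\<epsilon> ` carrier (F 0) = carrier M"
    and "d k \<in> mod_hom R (F (Suc k)) (F k)"
    and "d 0 ` carrier (F (Suc 0)) = mod_ker (F 0) M \<epsilon>"
    and "d (Suc k) ` carrier (F (Suc (Suc k))) = mod_ker (F (Suc k)) (F k) (d k)"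
  using assms by (auto simp: resolution_def)

lemma resolution_dd:
  assumes "resolution R M F d \<epsilon>"
  shows "v \<in> carrier (F (Suc (Suc k))) \<Longrightarrow> d k (d (Suc k) v) = \<zero>\<^bsub>F k\<^esub>"
    and "v \<in> carrier (F (Suc 0)) \<Longrightarrow> \<epsilon> (d 0 v) = \<zero>\<^bsub>M\<^esub>"
  using resolutionD(5)[OF assms] resolutionD(6)[OF assms, of k] by (auto simp: mod_ker_def)

lemma resolution_free:
  assumes "cring R"
  shows "free_resolution R M X d \<epsilon> \<longleftrightarrow> resolution R M (\<lambda>k. free_module R (X k)) d \<epsilon>"
  by (simp add: free_resolution_def resolution_def free_module_is_module[OF assms])

section \<open>Chain maps and chain homotopies between resolutions\<close>

definition chain_map ::
  "('r, 'a) ring_scheme \<Rightarrow> (nat \<Rightarrow> ('r, 'p) module) \<Rightarrow> (nat \<Rightarrow> 'p \<Rightarrow> 'p) \<Rightarrow>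
    (nat \<Rightarrow> ('r, 'q) module) \<Rightarrow> (nat \<Rightarrow> 'q \<Rightarrow> 'q) \<Rightarrow> (nat \<Rightarrow> 'p \<Rightarrow> 'q) \<Rightarrow> bool" where
  "chain_map R F d E e f \<longleftrightarrow>
    (\<forall>k. f k \<in> mod_hom R (F k) (E k)) \<and>
    (\<forall>k. \<forall>v\<in>carrier (F (Suc k)). e k (f (Suc k) v) = f k (d k v))"

lemma chain_mapD:
  assumes "chain_map R F d E e f"
  shows "f k \<in> mod_hom R (F k) (E k)"
    and "v \<in> carrier (F (Suc k)) \<Longrightarrow> e k (f (Suc k) v) = f k (d k v)"
  using assms by (auto simp: chain_map_def)

lemma chain_map_id: "chain_map R F d F d (\<lambda>k v. v)"
  by (auto simp: chain_map_def mod_hom_id)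

lemma chain_map_comp:
  assumes f: "chain_map R F d E e f" and g: "chain_map R E e D c g"
  shows "chain_map R F d D c (\<lambda>k v. g k (f k v))"
  using mod_hom_comp[OF chain_mapD(1)[OF f] chain_mapD(1)[OF g]]
    mod_homD(1)[OF chain_mapD(1)[OF f]] chain_mapD(2)[OF f] chain_mapD(2)[OF g]
  by (auto simp: chain_map_def)

text \<open>Existence half of the comparison theorem. In each degree \<open>f n\<close> composed
  with the differential is killed by the differential of \<open>E\<close>, hence by exactness lands
  in the image of the next one, and freeness of the terms of \<open>F\<close> provides the
  lift.\<close>

lemma chain_map_exists:
  fixes X :: "nat \<Rightarrow> 'x set"
  assumes F: "resolution R M F d \<epsilon>" and E: "resolution R M E e \<eta>"
    and free: "\<And>k. mod_iso R (F k) (free_module R (X k))" and M: "module R M"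
  obtains f where "chain_map R F d E e f" and "\<And>v. v \<in> carrier (F 0) \<Longrightarrow> \<eta> (f 0 v) = \<epsilon> v"
proof -
  note FD = resolutionD[OF F] and ED = resolutionD[OF E]
  note dd = resolution_dd[OF F]
  \<comment> \<open>The last conjunct prepares the next lift. Keeping it in the invariant hides that
    exactness at degree 0 refers to the augmentation, so that a single induction step serves all
    degrees.\<close>
  define P where "P n f \<longleftrightarrow> f \<in> mod_hom R (F n) (E n) \<and>
      (n = 0 \<longrightarrow> (\<forall>v\<in>carrier (F 0). \<eta> (f v) = \<epsilon> v)) \<and>
      (\<forall>v\<in>carrier (F (Suc n)). f (d n v) \<in> e n ` carrier (E (Suc n)))" for n f
  define Q where "Q n f f' \<longleftrightarrow> (\<forall>v\<in>carrier (F (Suc n)). e n (f' v) = f (d n v))"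
    for n and f f' :: "_ \<Rightarrow> _"
  have "\<exists>f. \<forall>n. P n (f n) \<and> Q n (f n) (f (Suc n))"
  proof (rule dependent_nat_choice)
    obtain f where f: "f \<in> mod_hom R (F 0) (E 0)" "\<forall>v\<in>carrier (F 0). \<eta> (f v) = \<epsilon> v"
      using mod_iso_free_lift[OF FD(1) free ED(1) M ED(2) FD(2)] ED(3) mod_homD(1)[OF FD(2)]
      by blast
    have "f (d 0 v) \<in> e 0 ` carrier (E (Suc 0))" if "v \<in> carrier (F (Suc 0))" for v
      unfolding ED(5)
      using that f(2) mod_homD(1)[OF f(1)] mod_homD(1)[OF FD(4)] dd(2) by (simp add: mod_ker_def)
    with f show "\<exists>f. P 0 f" unfolding P_def by blast
  next
    fix f n assume f: "P n f"
    then obtain f' where f': "f' \<in> mod_hom R (F (Suc n)) (E (Suc n))"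
      "\<forall>v\<in>carrier (F (Suc n)). e n (f' v) = f (d n v)"
      using mod_iso_free_lift[OF FD(1) free ED(1) ED(1) ED(4) mod_hom_comp[OF FD(4)], of f n n]
      unfolding P_def by blast
    have "f' (d (Suc n) v) \<in> e (Suc n) ` carrier (E (Suc (Suc n)))"
      if v: "v \<in> carrier (F (Suc (Suc n)))" for v
    proof -
      have dv: "d (Suc n) v \<in> carrier (F (Suc n))" using mod_homD(1)[OF FD(4) v] .
      have "f (d n (d (Suc n) v)) = \<zero>\<^bsub>E n\<^esub>"
        using dd(1)[OF v] mod_hom_zero[OF FD(1) ED(1), of f n n] f by (simp add: P_def)
      then show ?thesis
        unfolding ED(6) using f' dv mod_homD(1)[OF f'(1)] by (simp add: mod_ker_def)
    qed
    with f' show "\<exists>f'. P (Suc n) f' \<and> Q n f f'" unfolding P_def Q_def by auto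
  qed
  then obtain f where "\<And>n. P n (f n)" "\<And>n. Q n (f n) (f (Suc n))" by blast
  then show ?thesis by (intro that[of f]) (auto simp: P_def Q_def chain_map_def)
qed

text \<open>Uniqueness half of the comparison theorem: the defect p - q - s d is a cycle in
  \<open>E\<close>, and s in the next degree is a lift of it through e. The homotopy equation is
  stated without subtraction and in positive degrees, the form in which linear maps are applied to
  it later.\<close>

lemma chain_homotopy_exists:
  fixes X :: "nat \<Rightarrow> 'x set"
  assumes F: "resolution R M F d \<epsilon>" and E: "resolution R M E e \<eta>"
    and free: "\<And>k. mod_iso R (F k) (free_module R (X k))" and M: "module R M"
    and p: "chain_map R F d E e p" and q: "chain_map R F d E e q"
    and aug: "\<And>v. v \<in> carrier (F 0) \<Longrightarrow> \<eta> (p 0 v) = \<eta> (q 0 v)"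
  obtains s where "\<And>k. s k \<in> mod_hom R (F k) (E (Suc k))"
    and "\<And>k v. v \<in> carrier (F (Suc k)) \<Longrightarrow>
      p (Suc k) v = q (Suc k) v \<oplus>\<^bsub>E (Suc k)\<^esub> (e (Suc k) (s (Suc k) v) \<oplus>\<^bsub>E (Suc k)\<^esub> s k (d k v))"
proof -
  note FD = resolutionD[OF F] and ED = resolutionD[OF E]
  note dd = resolution_dd[OF F]
  note pD = chain_mapD[OF p] and qD = chain_mapD[OF q]
  note pc = mod_homD(1)[OF pD(1)] and qc = mod_homD(1)[OF qD(1)]
  \<comment> \<open>This is the equation e s = p - q - s d evaluated on boundaries, where the last
    term drops out because d d = 0. In this shape it also covers degree 0, and together with e p = p
    d and e q = q d it says that the next defect is a cycle.\<close>
  define P where "P n s \<longleftrightarrow> s \<in> mod_hom R (F n) (E (Suc n)) \<and>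
      (\<forall>v\<in>carrier (F (Suc n)). e n (s (d n v)) = p n (d n v) \<ominus>\<^bsub>E n\<^esub> q n (d n v))" for n s
  define Q where "Q n s s' \<longleftrightarrow> (\<forall>v\<in>carrier (F (Suc n)).
      e (Suc n) (s' v) = (p (Suc n) v \<ominus>\<^bsub>E (Suc n)\<^esub> q (Suc n) v) \<ominus>\<^bsub>E (Suc n)\<^esub> s (d n v))"
    for n and s s' :: "_ \<Rightarrow> _"
  have "\<exists>s. \<forall>n. P n (s n) \<and> Q n (s n) (s (Suc n))"
  proof (rule dependent_nat_choice)
    have pq: "(\<lambda>v. p 0 v \<ominus>\<^bsub>E 0\<^esub> q 0 v) \<in> mod_hom R (F 0) (E 0)"
      by (rule mod_hom_diff[OF FD(1) ED(1) pD(1) qD(1)])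
    have "p 0 v \<ominus>\<^bsub>E 0\<^esub> q 0 v \<in> e 0 ` carrier (E (Suc 0))" if v: "v \<in> carrier (F 0)" for v
    proof -
      interpret M: module R M by fact
      have "\<eta> (p 0 v \<ominus>\<^bsub>E 0\<^esub> q 0 v) = \<eta> (q 0 v) \<ominus>\<^bsub>M\<^esub> \<eta> (q 0 v)"
        using v aug pc qc by (simp add: mod_hom_minus[OF ED(1) M ED(2)])
      also have "\<dots> = \<zero>\<^bsub>M\<^esub>"
        using mod_homD(1)[OF ED(2) qc[OF v]] by (simp add: a_minus_def M.M.r_neg)
      finally have "\<eta> (p 0 v \<ominus>\<^bsub>E 0\<^esub> q 0 v) = \<zero>\<^bsub>M\<^esub>" .
      then show ?thesis unfolding ED(5) using mod_homD(1)[OF pq v] by (simp add: mod_ker_def)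
    qed
    from mod_iso_free_lift[OF FD(1) free ED(1) ED(1) ED(4) pq this]
    obtain s where s: "s \<in> mod_hom R (F 0) (E (Suc 0))"
      "\<forall>v\<in>carrier (F 0). e 0 (s v) = p 0 v \<ominus>\<^bsub>E 0\<^esub> q 0 v" by blast
    then show "\<exists>s. P 0 s" unfolding P_def using mod_homD(1)[OF FD(4)] by blast
  next
    fix s n assume "P n s"
    then have s: "s \<in> mod_hom R (F n) (E (Suc n))"
      "\<And>v. v \<in> carrier (F (Suc n)) \<Longrightarrow> e n (s (d n v)) = p n (d n v) \<ominus>\<^bsub>E n\<^esub> q n (d n v)"
      by (auto simp: P_def)
    interpret En: module R "E n" by (rule ED(1))
    interpret En': module R "E (Suc n)" by (rule ED(1))
    let ?h = "\<lambda>v. (p (Suc n) v \<ominus>\<^bsub>E (Suc n)\<^esub> q (Suc n) v) \<ominus>\<^bsub>E (Suc n)\<^esub> s (d n v)"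
    have h: "?h \<in> mod_hom R (F (Suc n)) (E (Suc n))"
      by (intro mod_hom_diff FD(1) ED(1) pD(1) qD(1) mod_hom_comp[OF FD(4)] s(1))
    have "?h v \<in> e (Suc n) ` carrier (E (Suc (Suc n)))" if v: "v \<in> carrier (F (Suc n))" for v
    proof -
      note dv = mod_homD(1)[OF FD(4) v]
      have "e n (?h v) = (p n (d n v) \<ominus>\<^bsub>E n\<^esub> q n (d n v)) \<ominus>\<^bsub>E n\<^esub> (p n (d n v) \<ominus>\<^bsub>E n\<^esub> q n (d n v))"
        using v dv pc qc mod_homD(1)[OF s(1)] pD(2) qD(2) s(2)
        by (simp add: mod_hom_minus[OF ED(1) ED(1) ED(4)])
      also have "\<dots> = \<zero>\<^bsub>E n\<^esub>"
        using dv pc qc by (metis En.M.minus_closed En.M.r_neg a_minus_def)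
      finally show ?thesis unfolding ED(6) using mod_homD(1)[OF h v] by (simp add: mod_ker_def)
    qed
    from mod_iso_free_lift[OF FD(1) free ED(1) ED(1) ED(4) h this]
    obtain s' where s': "s' \<in> mod_hom R (F (Suc n)) (E (Suc (Suc n)))"
      "\<forall>v\<in>carrier (F (Suc n)). e (Suc n) (s' v) = ?h v" by blast
    have "e (Suc n) (s' (d (Suc n) v)) =
        p (Suc n) (d (Suc n) v) \<ominus>\<^bsub>E (Suc n)\<^esub> q (Suc n) (d (Suc n) v)"
      if v: "v \<in> carrier (F (Suc (Suc n)))" for v
    proof -
      note dv = mod_homD(1)[OF FD(4) v]
      have "s (d n (d (Suc n) v)) = \<zero>\<^bsub>E (Suc n)\<^esub>"
        using dd(1)[OF v] mod_hom_zero[OF FD(1) ED(1) s(1)] by simp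
      then show ?thesis
        using s'(2) dv pc qc by (simp add: a_minus_def)
    qed
    then show "\<exists>s'. P (Suc n) s' \<and> Q n s s'" using s' unfolding P_def Q_def by blast
  qed
  then obtain s where P: "\<And>n. P n (s n)" and Q: "\<And>n. Q n (s n) (s (Suc n))" by blast
  show ?thesis
  proof (rule that[of s])
    show s: "s k \<in> mod_hom R (F k) (E (Suc k))" for k using P by (simp add: P_def)
    fix k v assume v: "v \<in> carrier (F (Suc k))"
    interpret E: module R "E (Suc k)" by (rule ED(1))
    have sd: "s k (d k v) \<in> carrier (E (Suc k))"
      using mod_homD(1)[OF s] mod_homD(1)[OF FD(4) v] by blast
    have "e (Suc k) (s (Suc k) v) = (p (Suc k) v \<ominus>\<^bsub>E (Suc k)\<^esub> q (Suc k) v) \<ominus>\<^bsub>E (Suc k)\<^esub> s k (d k v)"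
      using Q v by (simp add: Q_def)
    then have "e (Suc k) (s (Suc k) v) \<oplus>\<^bsub>E (Suc k)\<^esub> s k (d k v) = p (Suc k) v \<ominus>\<^bsub>E (Suc k)\<^esub> q (Suc k) v"
      using pc[OF v] qc[OF v] sd by (simp add: a_minus_def E.M.a_assoc E.M.l_neg)
    then show "p (Suc k) v = q (Suc k) v \<oplus>\<^bsub>E (Suc k)\<^esub>
        (e (Suc k) (s (Suc k) v) \<oplus>\<^bsub>E (Suc k)\<^esub> s k (d k v))"
      using pc[OF v] qc[OF v] by (simp add: a_minus_def E.M.a_lcomm[of "q (Suc k) v"] E.M.r_neg)
  qed
qed


section \<open>Cohomology\<close>

text \<open>A map in the middle degree alone is compared on cohomology. The last four assumptions
  say that \<open>\<alpha>\<close> respects cocycles and coboundaries and is injective and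
  surjective on classes. They serve both for a homotopy equivalence of resolutions and for an
  isomorphism of cochain complexes.\<close>

lemma mod_iso_cohomologyI:
  assumes C: "module R C0" "module R C1" "module R C2" and D: "module R D0" "module R D1" "module R D2"
    and c: "c0 \<in> mod_hom R C0 C1" "c1 \<in> mod_hom R C1 C2" "\<And>u. u \<in> carrier C0 \<Longrightarrow> c1 (c0 u) = \<zero>\<^bsub>C2\<^esub>"
    and d: "d0 \<in> mod_hom R D0 D1" "d1 \<in> mod_hom R D1 D2" "\<And>u. u \<in> carrier D0 \<Longrightarrow> d1 (d0 u) = \<zero>\<^bsub>D2\<^esub>"
    and \<alpha>: "\<alpha> \<in> mod_hom R C1 D1"
    and cocycle: "\<And>a. a \<in> mod_ker C1 C2 c1 \<Longrightarrow> d1 (\<alpha> a) = \<zero>\<^bsub>D2\<^esub>"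
    and coboundary: "\<And>u. u \<in> carrier C0 \<Longrightarrow> \<alpha> (c0 u) \<in> d0 ` carrier D0"
    and inj: "\<And>a. a \<in> mod_ker C1 C2 c1 \<Longrightarrow> \<alpha> a \<in> d0 ` carrier D0 \<Longrightarrow> a \<in> c0 ` carrier C0"
    and surj: "\<And>b. b \<in> mod_ker D1 D2 d1 \<Longrightarrow>
      \<exists>a\<in>mod_ker C1 C2 c1. \<exists>n\<in>d0 ` carrier D0. b = n \<oplus>\<^bsub>D1\<^esub> \<alpha> a"
  shows "mod_iso R
    (quotient_module (C1\<lparr>carrier := mod_ker C1 C2 c1\<rparr>) (c0 ` carrier C0))
    (quotient_module (D1\<lparr>carrier := mod_ker D1 D2 d1\<rparr>) (d0 ` carrier D0))"
proof -
  have ZC: "submodule (mod_ker C1 C2 c1) R C1" by (rule submodule_mod_ker[OF C(2,3) c(2)])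
  have ZD: "submodule (mod_ker D1 D2 d1) R D1" by (rule submodule_mod_ker[OF D(2,3) d(2)])
  show ?thesis
  proof (rule mod_iso_quotientI)
    show "module R (C1\<lparr>carrier := mod_ker C1 C2 c1\<rparr>)" "module R (D1\<lparr>carrier := mod_ker D1 D2 d1\<rparr>)"
      using submodule.submodule_is_module ZC ZD C(2) D(2) by blast+
    show "submodule (c0 ` carrier C0) R (C1\<lparr>carrier := mod_ker C1 C2 c1\<rparr>)"
      using c mod_homD(1)[OF c(1)]
      by (intro submodule_of_submodule[OF C(2) ZC] submodule_image[OF C(1,2)]) (auto simp: mod_ker_def)
    show "submodule (d0 ` carrier D0) R (D1\<lparr>carrier := mod_ker D1 D2 d1\<rparr>)"
      using d mod_homD(1)[OF d(1)]
      by (intro submodule_of_submodule[OF D(2) ZD] submodule_image[OF D(1,2)]) (auto simp: mod_ker_def)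
    show "\<alpha> \<in> mod_hom R (C1\<lparr>carrier := mod_ker C1 C2 c1\<rparr>) (D1\<lparr>carrier := mod_ker D1 D2 d1\<rparr>)"
      using cocycle by (intro mod_homI) (auto simp: mod_ker_def mod_homD[OF \<alpha>])
    show "\<alpha> a \<in> d0 ` carrier D0 \<longleftrightarrow> a \<in> c0 ` carrier C0"
      if "a \<in> carrier (C1\<lparr>carrier := mod_ker C1 C2 c1\<rparr>)" for a
      using that inj coboundary by auto
  qed (use surj in simp)
qed

text \<open>The index is shifted: \<open>k\<close> stands for cohomological degree k + 1. Only
  positive degrees of \<open>Ext\<close> occur in Q, and there the coboundaries are always an
  image.\<close>

definition hom_cohomology ::
  "('r, 'a) ring_scheme \<Rightarrow> (nat \<Rightarrow> ('r, 'p) module) \<Rightarrow> (nat \<Rightarrow> 'p \<Rightarrow> 'p) \<Rightarrow> ('r, 'n) module \<Rightarrow>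
    nat \<Rightarrow> ('r, ('p \<Rightarrow> 'n) set) module" where
  "hom_cohomology R F d N k = quotient_module
    ((Hom_module R (F (Suc k)) N)\<lparr>carrier := mod_ker (Hom_module R (F (Suc k)) N)
      (Hom_module R (F (Suc (Suc k))) N) (\<lambda>f. compose (carrier (F (Suc (Suc k)))) f (d (Suc k)))\<rparr>)
    ((\<lambda>f. compose (carrier (F (Suc k))) f (d k)) ` carrier (Hom_module R (F k) N))"

lemma cohomology_Suc:
  "cohomology R X d N (Suc k) = hom_cohomology R (\<lambda>k. free_module R (X k)) d N k"
  by (simp add: cohomology_def hom_cohomology_def cocycles_def coboundaries_def cochains_def
      coboundary_def[abs_def])

lemma compose_eq_const_iff: "compose A f g = (\<lambda>x\<in>A. z) \<longleftrightarrow> (\<forall>x\<in>A. f (g x) = z)"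
  by (auto simp: compose_def fun_eq_iff)

text \<open>Witnesses such as w g + a s are linear but not extensional. Restricting them to the
  carrier changes nothing on the range of \<open>d\<close>.\<close>

lemma Hom_coboundaryI:
  assumes "module R F" "w \<in> mod_hom R F N" "x \<in> extensional (carrier G)"
    and "d \<in> mod_hom R G F" and "\<And>v. v \<in> carrier G \<Longrightarrow> x v = w (d v)"
  shows "x \<in> (\<lambda>f. compose (carrier G) f d) ` carrier (Hom_module R F N)"
proof (rule image_eqI)
  show "restrict w (carrier F) \<in> carrier (Hom_module R F N)"
    using assms(1,2) by (simp add: mod_hom_restrict)
  show "x = compose (carrier G) (restrict w (carrier F)) d"
    using assms(3,5) mod_homD(1)[OF assms(4)]
    by (intro extensionalityI[where A = "carrier G"]) (auto simp: compose_def)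
qed

text \<open>Since d d = 0, coboundaries are cocycles and the quotient makes sense. The fact is
  needed to reverse the isomorphism of \<open>restricted_cohomology\<close> by
  \<open>mod_iso_sym\<close>.\<close>

lemma hom_cohomology_is_module:
  assumes N: "module R N" and F: "\<And>k. module R (F k)" "\<And>k. d k \<in> mod_hom R (F (Suc k)) (F k)"
    and dd: "\<And>k v. v \<in> carrier (F (Suc (Suc k))) \<Longrightarrow> d k (d (Suc k) v) = \<zero>\<^bsub>F k\<^esub>"
  shows "module R (hom_cohomology R F d N k)"
proof -
  note H = Hom_module_is_module[OF F(1) N]
  note pre = mod_hom_precompose[OF F(1) F(1) F(2), where N = N]
  let ?K = "mod_ker (Hom_module R (F (Suc k)) N)
      (Hom_module R (F (Suc (Suc k))) N) (\<lambda>f. compose (carrier (F (Suc (Suc k)))) f (d (Suc k)))"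
  let ?B = "(\<lambda>f. compose (carrier (F (Suc k))) f (d k)) ` carrier (Hom_module R (F k) N)"
  have K: "submodule ?K R (Hom_module R (F (Suc k)) N)" by (rule submodule_mod_ker[OF H H pre])
  have B: "submodule ?B R (Hom_module R (F (Suc k)) N)" by (rule submodule_image[OF H H pre])
  have "?B \<subseteq> ?K"
  proof
    fix x assume "x \<in> ?B"
    then obtain u where u: "u \<in> carrier (Hom_module R (F k) N)" "x = compose (carrier (F (Suc k))) u (d k)"
      by blast
    moreover have "compose (carrier (F (Suc (Suc k)))) x (d (Suc k)) = \<zero>\<^bsub>Hom_module R (F (Suc (Suc k))) N\<^esub>"
      using u mod_hom_zero[OF F(1) N, of u k] mod_homD(1)[OF F(2)]
      by (auto simp: compose_eq_const_iff compose_def dd)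
    ultimately show "x \<in> ?K" using mod_homD(1)[OF pre] by (simp add: mod_ker_def)
  qed
  then show ?thesis
    unfolding hom_cohomology_def
    by (intro quotient_module_is_module submodule.submodule_is_module[OF K H] submodule_of_submodule H K B)
qed

text \<open>The isomorphism is pullback along a chain map \<open>f\<close> from \<open>F\<close> to
  \<open>E\<close>. With \<open>g\<close> in the other direction, the homotopy \<open>s\<close>
  between the identity and f g gives injectivity on classes, and the homotopy \<open>t\<close>
  between the identity and g f gives surjectivity.\<close>

lemma hom_cohomology_mod_iso:
  fixes X :: "nat \<Rightarrow> 'x set" and Y :: "nat \<Rightarrow> 'y set"
  assumes M: "module R M" and N: "module R N"
    and F: "resolution R M F d \<epsilon>" and E: "resolution R M E e \<eta>"
    and freeF: "\<And>k. mod_iso R (F k) (free_module R (X k))"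
    and freeE: "\<And>k. mod_iso R (E k) (free_module R (Y k))"
  shows "mod_iso R (hom_cohomology R E e N k) (hom_cohomology R F d N k)"
proof -
  note FD = resolutionD[OF F] and ED = resolutionD[OF E]
  obtain f where f: "chain_map R F d E e f" and fa: "\<And>v. v \<in> carrier (F 0) \<Longrightarrow> \<eta> (f 0 v) = \<epsilon> v"
    using chain_map_exists[OF F E freeF M] by blast
  obtain g where g: "chain_map R E e F d g" and ga: "\<And>v. v \<in> carrier (E 0) \<Longrightarrow> \<epsilon> (g 0 v) = \<eta> v"
    using chain_map_exists[OF E F freeE M] by blast
  note fD = chain_mapD[OF f] and gD = chain_mapD[OF g]
  note fc = mod_homD(1)[OF fD(1)] and gc = mod_homD(1)[OF gD(1)]
  note dc = mod_homD(1)[OF FD(4)] and ec = mod_homD(1)[OF ED(4)]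
  obtain s where s: "\<And>k. s k \<in> mod_hom R (E k) (E (Suc k))" and sh: "\<And>k v. v \<in> carrier (E (Suc k)) \<Longrightarrow>
      v = f (Suc k) (g (Suc k) v) \<oplus>\<^bsub>E (Suc k)\<^esub> (e (Suc k) (s (Suc k) v) \<oplus>\<^bsub>E (Suc k)\<^esub> s k (e k v))"
    using chain_homotopy_exists[OF E E freeE M chain_map_id chain_map_comp[OF g f]] fa ga gc
    by metis
  obtain t where t: "\<And>k. t k \<in> mod_hom R (F k) (F (Suc k))" and th: "\<And>k v. v \<in> carrier (F (Suc k)) \<Longrightarrow>
      v = g (Suc k) (f (Suc k) v) \<oplus>\<^bsub>F (Suc k)\<^esub> (d (Suc k) (t (Suc k) v) \<oplus>\<^bsub>F (Suc k)\<^esub> t k (d k v))"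
    using chain_homotopy_exists[OF F F freeF M chain_map_id chain_map_comp[OF f g]] fa ga fc
    by metis
  note sc = mod_homD(1)[OF s] and tc = mod_homD(1)[OF t]
  interpret N: module R N by fact
  note Hm = Hom_module_is_module[OF _ N]
  note pre = mod_hom_precompose[where N = N]
  have ezero: "e j (e (Suc j) v) = \<zero>\<^bsub>E j\<^esub>" if "v \<in> carrier (E (Suc (Suc j)))" for j v
    using resolution_dd(1)[OF E that] .
  have dzero: "d j (d (Suc j) v) = \<zero>\<^bsub>F j\<^esub>" if "v \<in> carrier (F (Suc (Suc j)))" for j v
    using resolution_dd(1)[OF F that] .
  show ?thesis
    unfolding hom_cohomology_def
  proof (rule mod_iso_cohomologyI[where \<alpha> = "\<lambda>u. compose (carrier (F (Suc k))) u (f (Suc k))"])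
    fix u assume u: "u \<in> carrier (Hom_module R (E k) N)"
    show "compose (carrier (E (Suc (Suc k)))) (compose (carrier (E (Suc k))) u (e k)) (e (Suc k)) =
      \<zero>\<^bsub>Hom_module R (E (Suc (Suc k))) N\<^esub>"
      using u mod_hom_zero[OF ED(1) N, of u k] ec by (auto simp: compose_eq_const_iff compose_def ezero)
    show "compose (carrier (F (Suc k))) (compose (carrier (E (Suc k))) u (e k)) (f (Suc k))
      \<in> (\<lambda>f. compose (carrier (F (Suc k))) f (d k)) ` carrier (Hom_module R (F k) N)"
      using u fc by (intro Hom_coboundaryI[OF FD(1) mod_hom_comp[OF fD(1)] _ FD(4), of u])
        (auto simp: compose_def fD(2))
  next
    fix u assume u: "u \<in> carrier (Hom_module R (F k) N)"
    show "compose (carrier (F (Suc (Suc k)))) (compose (carrier (F (Suc k))) u (d k)) (d (Suc k)) =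
      \<zero>\<^bsub>Hom_module R (F (Suc (Suc k))) N\<^esub>"
      using u mod_hom_zero[OF FD(1) N, of u k] dc by (auto simp: compose_eq_const_iff compose_def dzero)
  next
    fix a assume "a \<in> mod_ker (Hom_module R (E (Suc k)) N) (Hom_module R (E (Suc (Suc k))) N)
       (\<lambda>f. compose (carrier (E (Suc (Suc k)))) f (e (Suc k)))"
    then have a: "a \<in> mod_hom R (E (Suc k)) N" "a \<in> extensional (carrier (E (Suc k)))"
      and a0: "\<And>v. v \<in> carrier (E (Suc (Suc k))) \<Longrightarrow> a (e (Suc k) v) = \<zero>\<^bsub>N\<^esub>"
      by (auto simp: mod_ker_def compose_eq_const_iff)
    show "compose (carrier (F (Suc (Suc k)))) (compose (carrier (F (Suc k))) a (f (Suc k))) (d (Suc k)) =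
      \<zero>\<^bsub>Hom_module R (F (Suc (Suc k))) N\<^esub>"
      using a0 fc dc by (auto simp: compose_eq_const_iff compose_def fD(2)[symmetric])
    assume "compose (carrier (F (Suc k))) a (f (Suc k))
      \<in> (\<lambda>f. compose (carrier (F (Suc k))) f (d k)) ` carrier (Hom_module R (F k) N)"
    then obtain w where w: "w \<in> mod_hom R (F k) N" and
      "compose (carrier (F (Suc k))) a (f (Suc k)) = compose (carrier (F (Suc k))) w (d k)" by auto
    then have wd: "a (f (Suc k) v) = w (d k v)" if "v \<in> carrier (F (Suc k))" for v
      using that by (metis compose_eq)
    \<comment> \<open>Apply \<open>a\<close> to the homotopy equation. The term with e s vanishes
      because \<open>a\<close> is a cocycle, and a f = w d turns the rest into the coboundary of w g
      + a s.\<close>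
    have "a v = w (g k (e k v)) \<oplus>\<^bsub>N\<^esub> a (s k (e k v))" if v: "v \<in> carrier (E (Suc k))" for v
    proof -
      have "a v = a (f (Suc k) (g (Suc k) v) \<oplus>\<^bsub>E (Suc k)\<^esub>
          (e (Suc k) (s (Suc k) v) \<oplus>\<^bsub>E (Suc k)\<^esub> s k (e k v)))"
        using sh[OF v] by simp
      also have "\<dots> = a (f (Suc k) (g (Suc k) v)) \<oplus>\<^bsub>N\<^esub> (\<zero>\<^bsub>N\<^esub> \<oplus>\<^bsub>N\<^esub> a (s k (e k v)))"
      proof -
        interpret Ek: module R "E (Suc k)" by (rule ED(1))
        show ?thesis
          using v by (simp add: mod_homD(2)[OF a(1)] fc gc ec sc a0)
      qed
      finally show ?thesis
        using v by (simp add: wd fc gc ec sc mod_homD(1)[OF a(1)] gD(2))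
    qed
    then show "a \<in> (\<lambda>f. compose (carrier (E (Suc k))) f (e k)) ` carrier (Hom_module R (E k) N)"
      by (intro Hom_coboundaryI[OF ED(1) _ a(2) ED(4), of
            "\<lambda>v. w (g k v) \<oplus>\<^bsub>N\<^esub> a (s k v)"] mod_hom_add ED(1) N
          mod_hom_comp[OF gD(1) w] mod_hom_comp[OF s a(1)])
  next
    fix b assume "b \<in> mod_ker (Hom_module R (F (Suc k)) N) (Hom_module R (F (Suc (Suc k))) N)
       (\<lambda>f. compose (carrier (F (Suc (Suc k)))) f (d (Suc k)))"
    then have b: "b \<in> mod_hom R (F (Suc k)) N" "b \<in> extensional (carrier (F (Suc k)))"
      and b0: "\<And>v. v \<in> carrier (F (Suc (Suc k))) \<Longrightarrow> b (d (Suc k) v) = \<zero>\<^bsub>N\<^esub>"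
      by (auto simp: mod_ker_def compose_eq_const_iff)
    \<comment> \<open>The candidate preimage of \<open>b\<close> is its pullback along
      \<open>g\<close>. Pulling that back along \<open>f\<close> misses \<open>b\<close> by the
      coboundary of b t, by the homotopy for g f.\<close>
    let ?a = "compose (carrier (E (Suc k))) b (g (Suc k))"
    let ?n = "compose (carrier (F (Suc k))) (\<lambda>v\<in>carrier (F k). b (t k v)) (d k)"
    have "?a \<in> mod_ker (Hom_module R (E (Suc k)) N) (Hom_module R (E (Suc (Suc k))) N)
       (\<lambda>f. compose (carrier (E (Suc (Suc k)))) f (e (Suc k)))"
      using mod_homD(1)[OF pre[OF ED(1) FD(1) gD(1)], of b "Suc k"] b b0
      by (auto simp: mod_ker_def compose_eq_const_iff compose_def gc ec gD(2)[symmetric])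
    moreover have "?n \<in> (\<lambda>f. compose (carrier (F (Suc k))) f (d k)) ` carrier (Hom_module R (F k) N)"
      using mod_hom_comp[OF t b(1)] by (auto simp: mod_hom_restrict[OF FD(1)])
    moreover have "b = ?n \<oplus>\<^bsub>Hom_module R (F (Suc k)) N\<^esub> compose (carrier (F (Suc k))) ?a (f (Suc k))"
    proof (rule extensionalityI[OF b(2)])
      fix v assume v: "v \<in> carrier (F (Suc k))"
      interpret Fk: module R "F (Suc k)" by (rule FD(1))
      have "b v = b (g (Suc k) (f (Suc k) v) \<oplus>\<^bsub>F (Suc k)\<^esub>
          (d (Suc k) (t (Suc k) v) \<oplus>\<^bsub>F (Suc k)\<^esub> t k (d k v)))"
        using th[OF v] by simp
      also have "\<dots> = b (g (Suc k) (f (Suc k) v)) \<oplus>\<^bsub>N\<^esub> (\<zero>\<^bsub>N\<^esub> \<oplus>\<^bsub>N\<^esub> b (t k (d k v)))"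
        using v by (simp add: mod_homD(2)[OF b(1)] fc gc dc tc b0)
      also have "\<dots> = (?n \<oplus>\<^bsub>Hom_module R (F (Suc k)) N\<^esub> compose (carrier (F (Suc k))) ?a (f (Suc k))) v"
        using v by (simp add: compose_def fc gc dc tc mod_homD(1)[OF b(1)] N.M.a_comm)
      finally show "b v =
        (?n \<oplus>\<^bsub>Hom_module R (F (Suc k)) N\<^esub> compose (carrier (F (Suc k))) ?a (f (Suc k))) v" .
    qed simp
    ultimately show "\<exists>a\<in>mod_ker (Hom_module R (E (Suc k)) N) (Hom_module R (E (Suc (Suc k))) N)
        (\<lambda>f. compose (carrier (E (Suc (Suc k)))) f (e (Suc k))).
      \<exists>n\<in>(\<lambda>f. compose (carrier (F (Suc k))) f (d k)) ` carrier (Hom_module R (F k) N).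
        b = n \<oplus>\<^bsub>Hom_module R (F (Suc k)) N\<^esub> compose (carrier (F (Suc k))) a (f (Suc k))"
      by blast
  qed (intro Hm pre FD(1,4) ED(1,4) fD(1))+
qed


section \<open>Group rings\<close>

lemma finsupp_regular_module [simp]: "finsupp X (regular_module R) = finsupp X R"
  by (simp add: finsupp_def)

lemma single_regular_module [simp]: "single (regular_module R) = single R"
  by (simp add: single_def fun_eq_iff)

text \<open>The last rule reads multiplication in A[G] as the action on P[G] for P = A, so that one
  set of computations covers both. \<open>finsum\<close> is unfolded in the proof because
  \<open>A\<close> and its regular module are different records with the same addition.\<close>

lemma group_ring_simps:
  "carrier (group_ring A G) = finsupp (carrier G) A"
  "\<zero>\<^bsub>group_ring A G\<^esub> = (\<lambda>_. \<zero>\<^bsub>A\<^esub>)"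
  "\<one>\<^bsub>group_ring A G\<^esub> = single A \<one>\<^bsub>G\<^esub> \<one>\<^bsub>A\<^esub>"
  "r \<oplus>\<^bsub>group_ring A G\<^esub> s = (\<lambda>x. r x \<oplus>\<^bsub>A\<^esub> s x)"
  "r \<otimes>\<^bsub>group_ring A G\<^esub> s = r \<odot>\<^bsub>group_module A G (regular_module A)\<^esub> s"
  by (simp_all add: group_ring_def group_module_def single_def finsum_def finprod_def fun_eq_iff)

lemma group_module_simps:
  "carrier (group_module A G P) = finsupp (carrier G) P"
  "\<zero>\<^bsub>group_module A G P\<^esub> = (\<lambda>_. \<zero>\<^bsub>P\<^esub>)"
  "p \<oplus>\<^bsub>group_module A G P\<^esub> q = (\<lambda>x. p x \<oplus>\<^bsub>P\<^esub> q x)"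
  by (simp_all add: group_module_def)

section \<open>The action of a group ring on a group module\<close>

locale group_algebra = A: cring A + G: comm_group G for A G

locale group_algebra_module = group_algebra A G + P: module A P
  for A :: "('a, 'c) ring_scheme" and G :: "('g, 'd) monoid_scheme" and P :: "('a, 'p) module"
begin

abbreviation act (infixl "\<cdot>" 70) where "r \<cdot> p \<equiv> r \<odot>\<^bsub>group_module A G P\<^esub> p"

lemma act_outside: "x \<notin> carrier G \<Longrightarrow> (r \<cdot> p) x = \<zero>\<^bsub>P\<^esub>"
  by (simp add: group_module_def)

text \<open>Two convolution sums can be added only over a common index set, hence the freedom in
  choosing \<open>S\<close>.\<close>

lemma act_eq:
  assumes r: "r \<in> finsupp (carrier G) A" and p: "p \<in> finsupp (carrier G) P" and x: "x \<in> carrier G"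
    and S: "finite S" "{y. r y \<noteq> \<zero>\<^bsub>A\<^esub>} \<subseteq> S" "S \<subseteq> carrier G"
  shows "(r \<cdot> p) x = (\<Oplus>\<^bsub>P\<^esub>y\<in>S. r y \<odot>\<^bsub>P\<^esub> p (inv\<^bsub>G\<^esub> y \<otimes>\<^bsub>G\<^esub> x))"
proof -
  have c: "r y \<in> carrier A" "p z \<in> carrier P" for y z using r p by (auto simp: finsupp_closed)
  show ?thesis
    using x S c by (auto simp: group_module_def intro!: P.M.add.finprod_mono_neutral_cong_left)
qed

lemma act_zero_left: "p \<in> finsupp (carrier G) P \<Longrightarrow> (\<lambda>_. \<zero>\<^bsub>A\<^esub>) \<cdot> p = (\<lambda>_. \<zero>\<^bsub>P\<^esub>)"
  by (simp add: group_module_def fun_eq_iff)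

lemma act_zero_right:
  assumes "r \<in> finsupp (carrier G) A"
  shows "r \<cdot> (\<lambda>_. \<zero>\<^bsub>P\<^esub>) = (\<lambda>_. \<zero>\<^bsub>P\<^esub>)"
proof -
  have "r y \<in> carrier A" for y using assms by (simp add: finsupp_closed)
  then show ?thesis by (simp add: group_module_def fun_eq_iff)
qed

lemma act_add_left:
  assumes r: "r \<in> finsupp (carrier G) A" and s: "s \<in> finsupp (carrier G) A"
    and p: "p \<in> finsupp (carrier G) P"
  shows "(\<lambda>x. r x \<oplus>\<^bsub>A\<^esub> s x) \<cdot> p = (\<lambda>x. (r \<cdot> p) x \<oplus>\<^bsub>P\<^esub> (s \<cdot> p) x)"
proof
  fix x
  have c: "r y \<in> carrier A" "s y \<in> carrier A" "p z \<in> carrier P" for y z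
    using r s p by (auto simp: finsupp_closed)
  let ?S = "{y. r y \<noteq> \<zero>\<^bsub>A\<^esub>} \<union> {y. s y \<noteq> \<zero>\<^bsub>A\<^esub>}"
  have S: "finite ?S" "?S \<subseteq> carrier G" using finsuppD(1,4)[OF r] finsuppD(1,4)[OF s] by auto
  show "((\<lambda>x. r x \<oplus>\<^bsub>A\<^esub> s x) \<cdot> p) x = (r \<cdot> p) x \<oplus>\<^bsub>P\<^esub> (s \<cdot> p) x"
  proof (cases "x \<in> carrier G")
    case x: True
    have "((\<lambda>x. r x \<oplus>\<^bsub>A\<^esub> s x) \<cdot> p) x =
        (\<Oplus>\<^bsub>P\<^esub>y\<in>?S. (r y \<oplus>\<^bsub>A\<^esub> s y) \<odot>\<^bsub>P\<^esub> p (inv\<^bsub>G\<^esub> y \<otimes>\<^bsub>G\<^esub> x))"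
      by (rule act_eq[OF A.add_finsupp[OF r s] p x S(1) _ S(2)]) auto
    also have "\<dots> = (\<Oplus>\<^bsub>P\<^esub>y\<in>?S. r y \<odot>\<^bsub>P\<^esub> p (inv\<^bsub>G\<^esub> y \<otimes>\<^bsub>G\<^esub> x) \<oplus>\<^bsub>P\<^esub> s y \<odot>\<^bsub>P\<^esub> p (inv\<^bsub>G\<^esub> y \<otimes>\<^bsub>G\<^esub> x))"
      using c by (simp add: P.smult_l_distr)
    also have "\<dots> = (\<Oplus>\<^bsub>P\<^esub>y\<in>?S. r y \<odot>\<^bsub>P\<^esub> p (inv\<^bsub>G\<^esub> y \<otimes>\<^bsub>G\<^esub> x)) \<oplus>\<^bsub>P\<^esub>
        (\<Oplus>\<^bsub>P\<^esub>y\<in>?S. s y \<odot>\<^bsub>P\<^esub> p (inv\<^bsub>G\<^esub> y \<otimes>\<^bsub>G\<^esub> x))"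
      using c by (intro P.M.finsum_addf) auto
    also have "(\<Oplus>\<^bsub>P\<^esub>y\<in>?S. r y \<odot>\<^bsub>P\<^esub> p (inv\<^bsub>G\<^esub> y \<otimes>\<^bsub>G\<^esub> x)) = (r \<cdot> p) x"
      by (rule act_eq[OF r p x S(1) _ S(2), symmetric]) auto
    also have "(\<Oplus>\<^bsub>P\<^esub>y\<in>?S. s y \<odot>\<^bsub>P\<^esub> p (inv\<^bsub>G\<^esub> y \<otimes>\<^bsub>G\<^esub> x)) = (s \<cdot> p) x"
      by (rule act_eq[OF s p x S(1) _ S(2), symmetric]) auto
    finally show ?thesis .
  qed (simp add: act_outside)
qed

lemma act_add_right:
  assumes r: "r \<in> finsupp (carrier G) A" and p: "p \<in> finsupp (carrier G) P"
    and q: "q \<in> finsupp (carrier G) P"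
  shows "r \<cdot> (\<lambda>x. p x \<oplus>\<^bsub>P\<^esub> q x) = (\<lambda>x. (r \<cdot> p) x \<oplus>\<^bsub>P\<^esub> (r \<cdot> q) x)"
proof
  fix x
  have c: "r y \<in> carrier A" "p y \<in> carrier P" "q y \<in> carrier P" for y
    using r p q by (auto simp: finsupp_closed)
  show "(r \<cdot> (\<lambda>x. p x \<oplus>\<^bsub>P\<^esub> q x)) x = (r \<cdot> p) x \<oplus>\<^bsub>P\<^esub> (r \<cdot> q) x"
    using c by (simp add: group_module_def P.smult_r_distr P.M.finsum_addf Pi_iff)
qed

lemma act_single:
  assumes g: "g \<in> carrier G" and a: "a \<in> carrier A" and p: "p \<in> finsupp (carrier G) P"
  shows "single A g a \<cdot> p = (\<lambda>x. if x \<in> carrier G then a \<odot>\<^bsub>P\<^esub> p (inv\<^bsub>G\<^esub> g \<otimes>\<^bsub>G\<^esub> x) else \<zero>\<^bsub>P\<^esub>)"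
proof
  fix x
  have c: "p z \<in> carrier P" for z using p by (auto simp: finsupp_closed)
  have s: "single A g a \<in> finsupp (carrier G) A" using g a by (simp add: single_finsupp)
  show "(single A g a \<cdot> p) x = (if x \<in> carrier G then a \<odot>\<^bsub>P\<^esub> p (inv\<^bsub>G\<^esub> g \<otimes>\<^bsub>G\<^esub> x) else \<zero>\<^bsub>P\<^esub>)"
  proof (cases "x \<in> carrier G")
    case True
    have "(single A g a \<cdot> p) x = (\<Oplus>\<^bsub>P\<^esub>y\<in>{g}. single A g a y \<odot>\<^bsub>P\<^esub> p (inv\<^bsub>G\<^esub> y \<otimes>\<^bsub>G\<^esub> x))"
      by (rule act_eq[OF s p True]) (use g in \<open>auto simp: single_def split: if_splits\<close>)
    also have "\<dots> = a \<odot>\<^bsub>P\<^esub> p (inv\<^bsub>G\<^esub> g \<otimes>\<^bsub>G\<^esub> x)" using a c by (simp add: single_def)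
    finally show ?thesis using True by simp
  qed (simp add: act_outside)
qed

lemma inv_solve:
  assumes "g \<in> carrier G" "x \<in> carrier G" "y \<in> carrier G"
  shows "inv\<^bsub>G\<^esub> g \<otimes>\<^bsub>G\<^esub> x = y \<longleftrightarrow> x = g \<otimes>\<^bsub>G\<^esub> y"
  using assms by (metis G.inv_solve_left)

lemma act_single_closed:
  assumes g: "g \<in> carrier G" and a: "a \<in> carrier A" and p: "p \<in> finsupp (carrier G) P"
  shows "single A g a \<cdot> p \<in> finsupp (carrier G) P"
proof -
  have c: "p z \<in> carrier P" for z using p by (auto simp: finsupp_closed)
  have "(single A g a \<cdot> p) x = \<zero>\<^bsub>P\<^esub>" if "x \<notin> (\<lambda>y. g \<otimes>\<^bsub>G\<^esub> y) ` {y. p y \<noteq> \<zero>\<^bsub>P\<^esub>}" for x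
  proof (cases "x \<in> carrier G")
    case True
    then have "x = g \<otimes>\<^bsub>G\<^esub> (inv\<^bsub>G\<^esub> g \<otimes>\<^bsub>G\<^esub> x)" using g by (simp add: G.m_assoc[symmetric])
    then have "p (inv\<^bsub>G\<^esub> g \<otimes>\<^bsub>G\<^esub> x) = \<zero>\<^bsub>P\<^esub>" using that by blast
    then show ?thesis using a by (simp add: act_single[OF g a p])
  qed (simp add: act_outside)
  then show ?thesis
    using a c finsuppD(1)[OF p]
    by (intro finsuppI[where A = "(\<lambda>y. g \<otimes>\<^bsub>G\<^esub> y) ` {y. p y \<noteq> \<zero>\<^bsub>P\<^esub>}"]) (auto simp: act_single[OF g a p])
qed

lemma act_closed:
  assumes "r \<in> finsupp (carrier G) A" and p: "p \<in> finsupp (carrier G) P"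
  shows "r \<cdot> p \<in> finsupp (carrier G) P"
  using assms(1)
  by (induction r rule: A.finsupp_induct)
     (simp_all add: act_zero_left p zero_finsupp act_add_left single_finsupp act_single_closed
       P.M.add_finsupp)

lemma act_single_single:
  assumes "g \<in> carrier G" "h \<in> carrier G" "a \<in> carrier A" "b \<in> carrier P"
  shows "single A g a \<cdot> single P h b = single P (g \<otimes>\<^bsub>G\<^esub> h) (a \<odot>\<^bsub>P\<^esub> b)"
proof
  fix x
  show "(single A g a \<cdot> single P h b) x = single P (g \<otimes>\<^bsub>G\<^esub> h) (a \<odot>\<^bsub>P\<^esub> b) x"
    using assms inv_solve[of g x h]
    by (cases "x \<in> carrier G") (auto simp: act_single single_finsupp, auto simp: single_def)
qed

end

context group_algebra
begin

lemma regular: "group_algebra_module A G (regular_module A)"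
  by (intro group_algebra_module.intro group_algebra_axioms regular_module_is_module A.is_cring)

abbreviation "AG \<equiv> group_ring A G"

interpretation reg: group_algebra_module A G "regular_module A" by (rule regular)

lemma group_ring_single_mult:
  assumes "g \<in> carrier G" "h \<in> carrier G" "a \<in> carrier A" "b \<in> carrier A"
  shows "single A g a \<otimes>\<^bsub>AG\<^esub> single A h b = single A (g \<otimes>\<^bsub>G\<^esub> h) (a \<otimes>\<^bsub>A\<^esub> b)"
  using reg.act_single_single[of g h a b] assms by (simp add: group_ring_simps)

lemma single_mult:
  assumes "g \<in> carrier G" "a \<in> carrier A" "r \<in> carrier AG"
  shows "single A g a \<otimes>\<^bsub>AG\<^esub> r =
    (\<lambda>x. if x \<in> carrier G then a \<otimes>\<^bsub>A\<^esub> r (inv\<^bsub>G\<^esub> g \<otimes>\<^bsub>G\<^esub> x) else \<zero>\<^bsub>A\<^esub>)"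
  using reg.act_single[of g a r] assms by (simp add: group_ring_simps cong: if_cong)

text \<open>The product is additive in each factor, which leaves monomials, where commutativity of
  \<open>A\<close> and of \<open>G\<close> applies. The auxiliary fact decomposes the second factor,
  the main induction the first.\<close>

lemma group_ring_comm:
  assumes "r \<in> carrier AG" "s \<in> carrier AG"
  shows "r \<otimes>\<^bsub>AG\<^esub> s = s \<otimes>\<^bsub>AG\<^esub> r"
proof -
  have 1: "single A g a \<otimes>\<^bsub>AG\<^esub> s = s \<otimes>\<^bsub>AG\<^esub> single A g a"
    if "g \<in> carrier G" "a \<in> carrier A" "s \<in> finsupp (carrier G) A" for g a s
    using that(3)
  proof (induction s rule: A.finsupp_induct)
    case zero
    then show ?case using that by (simp add: group_ring_simps reg.act_zero_left[simplified]
        reg.act_zero_right[simplified] single_finsupp)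
  next
    case (add b h s)
    have "single A g a \<otimes>\<^bsub>AG\<^esub> single A h b = single A h b \<otimes>\<^bsub>AG\<^esub> single A g a"
      using add that by (simp add: group_ring_single_mult A.m_comm G.m_comm)
    then show ?case
      using add that by (simp add: group_ring_simps reg.act_add_left[simplified]
        reg.act_add_right[simplified] single_finsupp)
  qed
  have "r \<in> finsupp (carrier G) A" using assms(1) by (simp add: group_ring_simps)
  then show ?thesis
  proof (induction r rule: A.finsupp_induct)
    case zero
    then show ?case using assms(2) by (simp add: group_ring_simps reg.act_zero_left[simplified]
        reg.act_zero_right[simplified])
  next
    case (add a g r)
    have "single A g a \<otimes>\<^bsub>AG\<^esub> s = s \<otimes>\<^bsub>AG\<^esub> single A g a"
      using add assms(2) 1 by (simp add: group_ring_simps)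
    then show ?case
      using add assms(2) by (simp add: group_ring_simps reg.act_add_left[simplified]
        reg.act_add_right[simplified] single_finsupp)
  qed
qed

end

context group_algebra_module
begin

interpretation reg: group_algebra_module A G "regular_module A" by (rule regular)

text \<open>For P = A this becomes associativity of the group ring, so it has to come before
  \<open>AG\<close> is known to be a ring. It rests on additivity of the action in both arguments
  and the explicit formula for monomials.\<close>

lemma act_assoc:
  assumes "r \<in> carrier AG" "s \<in> carrier AG" and p: "p \<in> finsupp (carrier G) P"
  shows "(r \<otimes>\<^bsub>AG\<^esub> s) \<cdot> p = r \<cdot> (s \<cdot> p)"
proof -
  note simps = group_ring_simps single_finsupp act_zero_left act_zero_right act_add_left act_add_right
    act_closed zero_finsupp A.add_finsupp reg.act_zero_left[simplified]
    reg.act_zero_right[simplified] reg.act_add_left[simplified] reg.act_add_right[simplified]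
    reg.act_closed[simplified]
  have 1: "(single A g a \<otimes>\<^bsub>AG\<^esub> s) \<cdot> p = single A g a \<cdot> (s \<cdot> p)"
    if ga: "g \<in> carrier G" "a \<in> carrier A" and s: "s \<in> finsupp (carrier G) A" for g a s
    using s
  proof (induction s rule: A.finsupp_induct)
    case zero
    then show ?case using ga p by (simp add: simps)
  next
    case (add b h s)
    have c: "p z \<in> carrier P" for z using p by (auto simp: finsupp_closed)
    have "single A g a \<cdot> (single A h b \<cdot> p) = (\<lambda>x. if x \<in> carrier G
        then a \<odot>\<^bsub>P\<^esub> (single A h b \<cdot> p) (inv\<^bsub>G\<^esub> g \<otimes>\<^bsub>G\<^esub> x) else \<zero>\<^bsub>P\<^esub>)"
      using ga add p by (intro act_single act_single_closed)
    also have "\<dots> = single A (g \<otimes>\<^bsub>G\<^esub> h) (a \<otimes>\<^bsub>A\<^esub> b) \<cdot> p"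
      using ga add p c by (simp add: act_single P.smult_assoc1 G.inv_mult_group G.m_assoc cong: if_cong)
    finally have "(single A g a \<otimes>\<^bsub>AG\<^esub> single A h b) \<cdot> p = single A g a \<cdot> (single A h b \<cdot> p)"
      using ga add by (simp add: group_ring_single_mult)
    then show ?case
      using add ga p by (simp add: simps)
  qed
  have s: "s \<in> finsupp (carrier G) A" using assms(2) by (simp add: group_ring_simps)
  have "r \<in> finsupp (carrier G) A" using assms(1) by (simp add: group_ring_simps)
  then show ?thesis
  proof (induction r rule: A.finsupp_induct)
    case zero
    then show ?case using s p by (simp add: simps)
  next
    case (add a g r)
    have "(single A g a \<otimes>\<^bsub>AG\<^esub> s) \<cdot> p = single A g a \<cdot> (s \<cdot> p)"
      using add s 1 by simp
    then show ?case
      using add s p by (simp add: simps)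
  qed
qed

end

context group_algebra
begin

interpretation reg: group_algebra_module A G "regular_module A" by (rule regular)

lemma group_ring_cring: "cring AG"
proof (rule cringI)
  note simps = group_ring_simps reg.act_closed[simplified] reg.act_add_left[simplified]
  show "abelian_group AG"
  proof (rule abelian_groupI)
    fix r assume r: "r \<in> carrier AG"
    then have c: "r x \<in> carrier A" for x by (simp add: group_ring_simps finsupp_closed)
    have "(\<lambda>x. \<ominus>\<^bsub>A\<^esub> r x) \<in> finsupp (carrier G) A"
      using r c finsuppD(1,2)[of r "carrier G" A]
      by (intro finsuppI[where A = "{x. r x \<noteq> \<zero>\<^bsub>A\<^esub>}"]) (auto simp: group_ring_simps)
    then show "\<exists>s\<in>carrier AG. s \<oplus>\<^bsub>AG\<^esub> r = \<zero>\<^bsub>AG\<^esub>"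
      using c by (intro bexI[of _ "\<lambda>x. \<ominus>\<^bsub>A\<^esub> r x"]) (auto simp: group_ring_simps A.l_neg)
  qed (auto simp: group_ring_simps A.add_finsupp zero_finsupp finsupp_closed A.a_ac)
  show "comm_monoid AG"
  proof (rule comm_monoidI)
    fix r assume r: "r \<in> carrier AG"
    then have "r x \<in> carrier A" "x \<notin> carrier G \<Longrightarrow> r x = \<zero>\<^bsub>A\<^esub>" for x
      using finsuppD(2)[of r "carrier G" A] by (auto simp: group_ring_simps finsupp_closed)
    then show "\<one>\<^bsub>AG\<^esub> \<otimes>\<^bsub>AG\<^esub> r = r"
      using r single_mult[of "\<one>\<^bsub>G\<^esub>" "\<one>\<^bsub>A\<^esub>" r] by (auto simp: group_ring_simps(3) fun_eq_iff)
  next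
    fix r s t assume "r \<in> carrier AG" "s \<in> carrier AG" "t \<in> carrier AG"
    then show "r \<otimes>\<^bsub>AG\<^esub> s \<otimes>\<^bsub>AG\<^esub> t = r \<otimes>\<^bsub>AG\<^esub> (s \<otimes>\<^bsub>AG\<^esub> t)"
      using reg.act_assoc[of r s t] by (simp add: group_ring_simps)
  qed (simp_all add: group_ring_comm, simp_all add: simps single_finsupp)
  fix r s t assume "r \<in> carrier AG" "s \<in> carrier AG" "t \<in> carrier AG"
  then show "(r \<oplus>\<^bsub>AG\<^esub> s) \<otimes>\<^bsub>AG\<^esub> t = r \<otimes>\<^bsub>AG\<^esub> t \<oplus>\<^bsub>AG\<^esub> s \<otimes>\<^bsub>AG\<^esub> t"
    by (simp add: simps)
qed

text \<open>Monomials generate A[G] additively, so an additive map is linear once it commutes with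
  them. The explicit maps of the following sections, all given by formulas for coefficients, are
  thereby spared convolution sums.\<close>

lemma mod_hom_group_ringI:
  assumes M: "module AG M" and N: "module AG N"
    and closed: "\<And>x. x \<in> carrier M \<Longrightarrow> h x \<in> carrier N"
    and add: "\<And>x y. x \<in> carrier M \<Longrightarrow> y \<in> carrier M \<Longrightarrow> h (x \<oplus>\<^bsub>M\<^esub> y) = h x \<oplus>\<^bsub>N\<^esub> h y"
    and single: "\<And>g a x. g \<in> carrier G \<Longrightarrow> a \<in> carrier A \<Longrightarrow> x \<in> carrier M \<Longrightarrow>
      h (single A g a \<odot>\<^bsub>M\<^esub> x) = single A g a \<odot>\<^bsub>N\<^esub> h x"
  shows "h \<in> mod_hom AG M N"
proof (rule mod_homI)
  interpret M: module AG M by fact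
  interpret N: module AG N by fact
  fix r x assume "r \<in> carrier AG" and x: "x \<in> carrier M"
  then have "r \<in> finsupp (carrier G) A" by (simp add: group_ring_simps)
  then show "h (r \<odot>\<^bsub>M\<^esub> x) = r \<odot>\<^bsub>N\<^esub> h x"
  proof (induction r rule: A.finsupp_induct)
    case zero
    have "h \<zero>\<^bsub>M\<^esub> \<oplus>\<^bsub>N\<^esub> h \<zero>\<^bsub>M\<^esub> = h \<zero>\<^bsub>M\<^esub>" using add[of "\<zero>\<^bsub>M\<^esub>" "\<zero>\<^bsub>M\<^esub>"] by simp
    then have "h \<zero>\<^bsub>M\<^esub> = \<zero>\<^bsub>N\<^esub>" using closed[of "\<zero>\<^bsub>M\<^esub>"] by simp
    then show ?case
      using M.smult_l_null[OF x] N.smult_l_null[OF closed[OF x]] by (simp add: group_ring_simps)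
  next
    case (add a g r)
    let ?s = "single A g a"
    have c: "?s \<in> carrier AG" "r \<in> carrier AG"
      using add by (auto simp: group_ring_simps single_finsupp)
    have "h ((?s \<oplus>\<^bsub>AG\<^esub> r) \<odot>\<^bsub>M\<^esub> x) = (?s \<oplus>\<^bsub>AG\<^esub> r) \<odot>\<^bsub>N\<^esub> h x"
      using add c x by (simp add: M.smult_l_distr N.smult_l_distr assms(4) closed single)
    then show ?case by (simp add: group_ring_simps(4))
  qed
qed (use assms in auto)

end

context group_algebra_module
begin

lemma group_module_is_module: "module AG (group_module A G P)"
proof (rule moduleI[OF group_ring_cring])
  show "abelian_group (group_module A G P)"
  proof (rule abelian_groupI)
    fix p assume p: "p \<in> carrier (group_module A G P)"
    then have c: "p x \<in> carrier P" for x by (simp add: group_module_simps finsupp_closed)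
    have "(\<lambda>x. \<ominus>\<^bsub>P\<^esub> p x) \<in> finsupp (carrier G) P"
      using p c finsuppD(1,2)[of p "carrier G" P]
      by (intro finsuppI[where A = "{x. p x \<noteq> \<zero>\<^bsub>P\<^esub>}"]) (auto simp: group_module_simps)
    then show "\<exists>q\<in>carrier (group_module A G P). q \<oplus>\<^bsub>group_module A G P\<^esub> p = \<zero>\<^bsub>group_module A G P\<^esub>"
      using c by (intro bexI[of _ "\<lambda>x. \<ominus>\<^bsub>P\<^esub> p x"]) (auto simp: group_module_simps P.M.l_neg)
  qed (auto simp: group_module_simps P.M.add_finsupp zero_finsupp finsupp_closed P.M.a_ac)
  fix p assume p: "p \<in> carrier (group_module A G P)"
  then have "p x \<in> carrier P" "x \<notin> carrier G \<Longrightarrow> p x = \<zero>\<^bsub>P\<^esub>" for x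
    using finsuppD(2)[of p "carrier G" P] by (auto simp: group_module_simps finsupp_closed)
  then show "\<one>\<^bsub>AG\<^esub> \<cdot> p = p"
    using p act_single[of "\<one>\<^bsub>G\<^esub>" "\<one>\<^bsub>A\<^esub>" p]
    by (auto simp: group_ring_simps(3) group_module_simps fun_eq_iff)
qed (simp_all add: act_assoc group_module_simps, simp_all add: group_ring_simps act_closed
    act_add_left act_add_right)

end


section \<open>Restriction to a subgroup\<close>

locale coarse_graining = G: group_algebra A G + H: group_algebra A H
  for A :: "('a, 'c) ring_scheme" and G :: "('g, 'd) monoid_scheme" and H :: "('h, 'e) monoid_scheme" +
  fixes \<iota> :: "'h \<Rightarrow> 'g"
  assumes hom: "\<iota> \<in> hom H G" and inj: "inj_on \<iota> (carrier H)"
begin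

abbreviation "AG \<equiv> group_ring A G"
abbreviation "AH \<equiv> group_ring A H"
abbreviation "\<phi> \<equiv> group_ring_map A H \<iota>"

section \<open>The ring homomorphism induced by an embedding of groups\<close>

lemma \<iota>_closed [simp]: "y \<in> carrier H \<Longrightarrow> \<iota> y \<in> carrier G"
  using hom by (auto simp: hom_def)

lemma \<iota>_mult: "x \<in> carrier H \<Longrightarrow> y \<in> carrier H \<Longrightarrow> \<iota> (x \<otimes>\<^bsub>H\<^esub> y) = \<iota> x \<otimes>\<^bsub>G\<^esub> \<iota> y"
  using hom by (auto simp: hom_def)

lemma \<iota>_hom: "group_hom H G \<iota>"
  by (intro group_hom.intro group_hom_axioms.intro hom) unfold_locales

lemmas \<iota>_one = group_hom.hom_one[OF \<iota>_hom]
lemmas \<iota>_inv = group_hom.hom_inv[OF \<iota>_hom]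

lemma \<iota>_eq_iff: "x \<in> carrier H \<Longrightarrow> y \<in> carrier H \<Longrightarrow> \<iota> x = \<iota> y \<longleftrightarrow> x = y"
  using inj by (auto simp: inj_on_def)

text \<open>By injectivity the fibre over \<open>\<iota> y\<close> is the point \<open>y\<close>, so
  the defining sum has at most one term.\<close>

lemma group_ring_map_image:
  assumes r: "r \<in> finsupp (carrier H) A" and y: "y \<in> carrier H"
  shows "\<phi> r (\<iota> y) = r y"
proof -
  have "{z \<in> carrier H. \<iota> z = \<iota> y \<and> r z \<noteq> \<zero>\<^bsub>A\<^esub>} = (if r y = \<zero>\<^bsub>A\<^esub> then {} else {y})"
    using y by (auto simp: \<iota>_eq_iff)
  moreover have "r y \<in> carrier A" using r by (simp add: finsupp_closed)
  ultimately show ?thesis by (simp add: group_ring_map_def)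
qed

lemma group_ring_map_outside:
  assumes "x \<notin> \<iota> ` carrier H"
  shows "\<phi> r x = \<zero>\<^bsub>A\<^esub>"
proof -
  have "{y \<in> carrier H. \<iota> y = x \<and> r y \<noteq> \<zero>\<^bsub>A\<^esub>} = {}" using assms by auto
  then show ?thesis by (simp only: group_ring_map_def G.A.finsum_empty)
qed

lemma group_ring_map_eqI:
  assumes "r \<in> finsupp (carrier H) A" and "\<And>y. y \<in> carrier H \<Longrightarrow> s (\<iota> y) = r y"
    and "\<And>x. x \<notin> \<iota> ` carrier H \<Longrightarrow> s x = \<zero>\<^bsub>A\<^esub>"
  shows "\<phi> r = s"
proof
  show "\<phi> r x = s x" for x
    using assms group_ring_map_image[OF assms(1)] group_ring_map_outside[of x r]
    by (cases "x \<in> \<iota> ` carrier H") auto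
qed

lemma group_ring_map_single:
  assumes "y \<in> carrier H" "a \<in> carrier A"
  shows "\<phi> (single A y a) = single A (\<iota> y) a"
  using assms by (intro group_ring_map_eqI single_finsupp) (auto simp: single_def \<iota>_eq_iff)

lemma group_ring_map_zero: "\<phi> (\<lambda>_. \<zero>\<^bsub>A\<^esub>) = (\<lambda>_. \<zero>\<^bsub>A\<^esub>)"
  by (intro group_ring_map_eqI zero_finsupp) auto

lemma group_ring_map_add:
  assumes "r \<in> finsupp (carrier H) A" "s \<in> finsupp (carrier H) A"
  shows "\<phi> (\<lambda>x. r x \<oplus>\<^bsub>A\<^esub> s x) = (\<lambda>x. \<phi> r x \<oplus>\<^bsub>A\<^esub> \<phi> s x)"
  using assms
  by (intro group_ring_map_eqI G.A.add_finsupp)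
     (auto simp: group_ring_map_image group_ring_map_outside)

lemma group_ring_map_closed:
  assumes "r \<in> finsupp (carrier H) A"
  shows "\<phi> r \<in> finsupp (carrier G) A"
  using assms
  by (induction r rule: G.A.finsupp_induct)
     (simp_all add: group_ring_map_zero zero_finsupp group_ring_map_add group_ring_map_single
       single_finsupp G.A.add_finsupp)

lemma group_ring_map_single_mult:
  assumes y: "y \<in> carrier H" "a \<in> carrier A" and r: "r \<in> carrier AH"
  shows "\<phi> (single A y a \<otimes>\<^bsub>AH\<^esub> r) = single A (\<iota> y) a \<otimes>\<^bsub>AG\<^esub> \<phi> r"
proof (rule group_ring_map_eqI)
  interpret AH: cring AH by (rule H.group_ring_cring)
  have s: "single A y a \<in> carrier AH" using y by (simp add: group_ring_simps single_finsupp)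
  have rf: "r \<in> finsupp (carrier H) A" using r by (simp add: group_ring_simps)
  have \<phi>r: "\<phi> r \<in> carrier AG" using group_ring_map_closed[OF rf] by (simp add: group_ring_simps)
  show "single A y a \<otimes>\<^bsub>AH\<^esub> r \<in> finsupp (carrier H) A"
    using AH.m_closed[OF s r] by (simp add: group_ring_simps)
  note G.single_mult[OF \<iota>_closed[OF y(1)] y(2) \<phi>r, simp]
  show "(single A (\<iota> y) a \<otimes>\<^bsub>AG\<^esub> \<phi> r) (\<iota> z) = (single A y a \<otimes>\<^bsub>AH\<^esub> r) z" if "z \<in> carrier H" for z
    using that y group_ring_map_image[OF rf, of "inv\<^bsub>H\<^esub> y \<otimes>\<^bsub>H\<^esub> z"]
    by (simp add: H.single_mult[OF y r] \<iota>_mult \<iota>_inv)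
  fix x assume x: "x \<notin> \<iota> ` carrier H"
  show "(single A (\<iota> y) a \<otimes>\<^bsub>AG\<^esub> \<phi> r) x = \<zero>\<^bsub>A\<^esub>"
  proof (cases "x \<in> carrier G")
    case True
    \<comment> \<open>Translation by an element of the image subgroup preserves the complement of
      that subgroup.\<close>
    have "inv\<^bsub>G\<^esub> (\<iota> y) \<otimes>\<^bsub>G\<^esub> x \<notin> \<iota> ` carrier H"
    proof
      assume "inv\<^bsub>G\<^esub> (\<iota> y) \<otimes>\<^bsub>G\<^esub> x \<in> \<iota> ` carrier H"
      then obtain z where z: "z \<in> carrier H" "inv\<^bsub>G\<^esub> (\<iota> y) \<otimes>\<^bsub>G\<^esub> x = \<iota> z" by auto
      then have "x = \<iota> (y \<otimes>\<^bsub>H\<^esub> z)"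
        using y True by (metis G.G.inv_solve_left \<iota>_closed \<iota>_mult)
      then show False using x y z by simp
    qed
    then show ?thesis using y by (simp add: group_ring_map_outside)
  qed simp
qed

lemma group_ring_map_ring_hom: "\<phi> \<in> ring_hom AH AG"
proof (rule ring_hom_memI)
  interpret AH: cring AH by (rule H.group_ring_cring)
  interpret AG: cring AG by (rule G.group_ring_cring)
  show "\<phi> r \<in> carrier AG" if "r \<in> carrier AH" for r
    using that group_ring_map_closed by (simp add: group_ring_simps)
  show "\<phi> (r \<oplus>\<^bsub>AH\<^esub> s) = \<phi> r \<oplus>\<^bsub>AG\<^esub> \<phi> s" if "r \<in> carrier AH" "s \<in> carrier AH" for r s
    using that group_ring_map_add by (simp add: group_ring_simps)
  show "\<phi> \<one>\<^bsub>AH\<^esub> = \<one>\<^bsub>AG\<^esub>"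
    by (simp add: group_ring_simps(3) group_ring_map_single \<iota>_one)
  fix r s assume r: "r \<in> carrier AH" and s: "s \<in> carrier AH"
  have \<phi>: "\<phi> s \<in> carrier AG" using s group_ring_map_closed by (simp add: group_ring_simps)
  from r have "r \<in> finsupp (carrier H) A" by (simp add: group_ring_simps)
  then show "\<phi> (r \<otimes>\<^bsub>AH\<^esub> s) = \<phi> r \<otimes>\<^bsub>AG\<^esub> \<phi> s"
  proof (induction r rule: G.A.finsupp_induct)
    case zero
    show ?case
      using AH.l_null[OF s] AG.l_null[OF \<phi>]
      by (simp add: group_ring_simps(2) group_ring_map_zero)
  next
    case (add a y r)
    let ?s = "single A y a"
    have c: "?s \<in> carrier AH" "r \<in> carrier AH" using add by (auto simp: group_ring_simps single_finsupp)
    have \<phi>c: "\<phi> ?s \<in> carrier AG" "\<phi> r \<in> carrier AG"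
      using add by (auto simp: group_ring_simps single_finsupp group_ring_map_closed)
    have hom_add: "\<phi> (u \<oplus>\<^bsub>AH\<^esub> v) = \<phi> u \<oplus>\<^bsub>AG\<^esub> \<phi> v" if "u \<in> carrier AH" "v \<in> carrier AH" for u v
      using that group_ring_map_add by (simp add: group_ring_simps)
    have "\<phi> ((?s \<oplus>\<^bsub>AH\<^esub> r) \<otimes>\<^bsub>AH\<^esub> s) = \<phi> (?s \<oplus>\<^bsub>AH\<^esub> r) \<otimes>\<^bsub>AG\<^esub> \<phi> s"
      using add c s \<phi> \<phi>c
      by (simp add: AH.l_distr AG.l_distr hom_add group_ring_map_single_mult group_ring_map_single)
    then show ?case by (simp add: group_ring_simps(4))
  qed
qed

lemma restricted_module: "module AG M \<Longrightarrow> module AH (restrict_scalars \<phi> M)"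
  by (rule restrict_scalars_module[OF H.group_ring_cring _ group_ring_map_ring_hom])

text \<open>Exactness speaks of images and zeros only, and restriction of scalars changes
  neither.\<close>

lemma restricted_resolution:
  assumes "resolution AG M F d \<epsilon>"
  shows "resolution AH (restrict_scalars \<phi> M) (\<lambda>k. restrict_scalars \<phi> (F k)) d \<epsilon>"
  using assms unfolding resolution_def mod_ker_def
  by (auto intro: restricted_module restrict_scalars_mod_hom[OF group_ring_map_ring_hom])


section \<open>Restricted free modules are free\<close>

text \<open>The choice is made from the coset as a set, and so is automatically the same for all of
  its elements.\<close>

definition representative :: "'g \<Rightarrow> 'g" where
  "representative x = (SOME y. y \<in> \<iota> ` carrier H #>\<^bsub>G\<^esub> x)"

abbreviation "transversal \<equiv> representative ` carrier G"

lemma image_subgroup: "subgroup (\<iota> ` carrier H) G"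
  using group_hom.img_is_subgroup[OF \<iota>_hom] .

lemma representative_in_coset: "x \<in> carrier G \<Longrightarrow> representative x \<in> \<iota> ` carrier H #>\<^bsub>G\<^esub> x"
  unfolding representative_def using G.G.rcos_self[OF _ image_subgroup] by (rule someI)

lemma representative_closed [simp]: "x \<in> carrier G \<Longrightarrow> representative x \<in> carrier G"
  using representative_in_coset[of x] by (auto simp: r_coset_def)

lemma representative_cong:
  assumes "y \<in> carrier H" "x \<in> carrier G"
  shows "representative (\<iota> y \<otimes>\<^bsub>G\<^esub> x) = representative x"
proof -
  have "\<iota> y \<otimes>\<^bsub>G\<^esub> x \<in> \<iota> ` carrier H #>\<^bsub>G\<^esub> x" using assms by (auto simp: r_coset_def)
  from G.G.repr_independence[OF this assms(2) image_subgroup] show ?thesis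
    by (simp add: representative_def)
qed

text \<open>Together with \<open>representative\<close> this is the factorisation g = \<iota>(y) t
  of a group element along the transversal.\<close>

definition coordinate :: "'g \<Rightarrow> 'h" where
  "coordinate x = inv_into (carrier H) \<iota> (x \<otimes>\<^bsub>G\<^esub> inv\<^bsub>G\<^esub> representative x)"

lemma coordinate:
  assumes "x \<in> carrier G"
  shows "coordinate x \<in> carrier H" and "\<iota> (coordinate x) \<otimes>\<^bsub>G\<^esub> representative x = x"
proof -
  obtain y where y: "y \<in> carrier H" "representative x = \<iota> y \<otimes>\<^bsub>G\<^esub> x"
    using representative_in_coset[OF assms] by (auto simp: r_coset_def)
  have "x \<otimes>\<^bsub>G\<^esub> inv\<^bsub>G\<^esub> representative x = \<iota> (inv\<^bsub>H\<^esub> y)"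
    using y assms by (simp add: \<iota>_inv G.G.inv_mult_group G.G.m_assoc[symmetric])
  then have im: "x \<otimes>\<^bsub>G\<^esub> inv\<^bsub>G\<^esub> representative x \<in> \<iota> ` carrier H" using y by auto
  show "coordinate x \<in> carrier H" unfolding coordinate_def by (rule inv_into_into[OF im])
  show "\<iota> (coordinate x) \<otimes>\<^bsub>G\<^esub> representative x = x"
    using assms by (simp add: coordinate_def f_inv_into_f[OF im] G.G.m_assoc)
qed

lemma transversal_unique:
  assumes "y \<in> carrier H" "t \<in> transversal"
  shows "representative (\<iota> y \<otimes>\<^bsub>G\<^esub> t) = t" and "coordinate (\<iota> y \<otimes>\<^bsub>G\<^esub> t) = y"
proof -
  obtain x where x: "x \<in> carrier G" "t = representative x" using assms(2) by auto
  then obtain z where "z \<in> carrier H" "t = \<iota> z \<otimes>\<^bsub>G\<^esub> x"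
    using representative_in_coset[of x] by (auto simp: r_coset_def)
  \<comment> \<open>A representative lies in the coset it represents, so it represents
    itself.\<close>
  then have t: "t \<in> carrier G" "representative t = t" using x representative_cong by auto
  then show r: "representative (\<iota> y \<otimes>\<^bsub>G\<^esub> t) = t" using assms(1) representative_cong by simp
  have "\<iota> (coordinate (\<iota> y \<otimes>\<^bsub>G\<^esub> t)) \<otimes>\<^bsub>G\<^esub> t = \<iota> y \<otimes>\<^bsub>G\<^esub> t"
    using coordinate(2)[of "\<iota> y \<otimes>\<^bsub>G\<^esub> t"] assms(1) t r by simp
  then show "coordinate (\<iota> y \<otimes>\<^bsub>G\<^esub> t) = y"
    using coordinate(1)[of "\<iota> y \<otimes>\<^bsub>G\<^esub> t"] assms(1) t by (simp add: \<iota>_eq_iff)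
qed

lemma transversal_carrier: "t \<in> transversal \<Longrightarrow> t \<in> carrier G"
  by auto

lemma finite_transversal:
  assumes "finite (rcosets\<^bsub>G\<^esub> (\<iota> ` carrier H))"
  shows "finite transversal"
proof -
  have "transversal = (\<lambda>c. SOME y. y \<in> c) ` (rcosets\<^bsub>G\<^esub> (\<iota> ` carrier H))"
    by (auto simp: RCOSETS_def representative_def)
  then show ?thesis using assms by simp
qed

text \<open>A vector over A[G] is a function of a basis index x and a group element g. Writing g =
  \<iota>(y) t and regrouping makes it a function of the basis index (x, t) and of y.
  \<open>\<psi>\<close> and \<open>\<chi>\<close> are this reindexing and its inverse; what needs
  work is that finite supports correspond.\<close>

lemma restricted_free_module:
  fixes X :: "'x set"
  shows "mod_iso AH (restrict_scalars \<phi> (free_module AG X)) (free_module AH (X \<times> transversal))"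
proof -
  define \<psi> where "\<psi> v = (\<lambda>(x, t) y. if t \<in> transversal \<and> y \<in> carrier H
      then v x (\<iota> y \<otimes>\<^bsub>G\<^esub> t) else \<zero>\<^bsub>A\<^esub>)" for v :: "'x \<Rightarrow> 'g \<Rightarrow> 'a"
  define \<chi> where "\<chi> w = (\<lambda>x g. if g \<in> carrier G then w (x, representative g) (coordinate g)
      else \<zero>\<^bsub>A\<^esub>)" for w :: "'x \<times> 'g \<Rightarrow> 'h \<Rightarrow> 'a"
  have vD: "v x \<in> finsupp (carrier G) A" "x \<notin> X \<Longrightarrow> v x = (\<lambda>_. \<zero>\<^bsub>A\<^esub>)"
    "finite {x. v x \<noteq> (\<lambda>_. \<zero>\<^bsub>A\<^esub>)}" if v: "v \<in> finsupp X AG" for v x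
    using finsupp_closed[OF v, of x] finsuppD(1,2)[OF v]
    by (auto simp: group_ring_simps zero_finsupp)
  have wD: "w q \<in> finsupp (carrier H) A" "q \<notin> X \<times> transversal \<Longrightarrow> w q = (\<lambda>_. \<zero>\<^bsub>A\<^esub>)"
    "finite {q. w q \<noteq> (\<lambda>_. \<zero>\<^bsub>A\<^esub>)}" if w: "w \<in> finsupp (X \<times> transversal) AH" for w q
    using finsupp_closed[OF w, of q] finsuppD(1,2)[OF w]
    by (auto simp: group_ring_simps zero_finsupp)
  have \<psi>_closed: "\<psi> v \<in> finsupp (X \<times> transversal) AH" if v: "v \<in> finsupp X AG" for v
  proof (rule finsuppI)
    show "\<psi> v q \<in> carrier AH" for q
    proof (cases q)
      case (Pair x t)
      have "\<psi> v q y = \<zero>\<^bsub>A\<^esub>" if "y \<notin> coordinate ` {g. v x g \<noteq> \<zero>\<^bsub>A\<^esub>}" for y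
        using that Pair transversal_unique(2)[of y t] by (force simp: \<psi>_def image_iff)
      moreover have "\<psi> v q y \<in> carrier A" for y
        using vD(1)[OF v, of x] Pair by (auto simp: \<psi>_def finsupp_closed)
      moreover have "\<psi> v q y = \<zero>\<^bsub>A\<^esub>" if "y \<notin> carrier H" for y using that Pair by (simp add: \<psi>_def)
      ultimately show ?thesis
        using finsuppD(1)[OF vD(1)[OF v, of x]] unfolding group_ring_simps
        by (intro finsuppI[where A = "coordinate ` {g. v x g \<noteq> \<zero>\<^bsub>A\<^esub>}"]) auto
    qed
    show "\<psi> v q = \<zero>\<^bsub>AH\<^esub>" if "q \<notin> X \<times> transversal" for q
      using that vD(2)[OF v] by (auto simp: \<psi>_def group_ring_simps split: prod.splits)
    \<comment> \<open>All (x, t) for which some group element in the support of \<open>v x\<close>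
      lies in the coset of t: finitely many x, and finitely many group elements for each.\<close>
    let ?S = "\<Union>x\<in>{x. v x \<noteq> (\<lambda>_. \<zero>\<^bsub>A\<^esub>)}. {x} \<times> representative ` {g. v x g \<noteq> \<zero>\<^bsub>A\<^esub>}"
    show "finite ?S" using vD(3)[OF v] finsuppD(1)[OF vD(1)[OF v]] by auto
    show "\<psi> v q = \<zero>\<^bsub>AH\<^esub>" if q: "q \<notin> ?S" for q
    proof (cases q)
      case (Pair x t)
      have "v x (\<iota> y \<otimes>\<^bsub>G\<^esub> t) = \<zero>\<^bsub>A\<^esub>" if yt: "y \<in> carrier H" "t \<in> transversal" for y
      proof (rule ccontr)
        assume *: "v x (\<iota> y \<otimes>\<^bsub>G\<^esub> t) \<noteq> \<zero>\<^bsub>A\<^esub>"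
        then have "v x \<noteq> (\<lambda>_. \<zero>\<^bsub>A\<^esub>)" by auto
        moreover have "t \<in> representative ` {g. v x g \<noteq> \<zero>\<^bsub>A\<^esub>}"
          using * transversal_unique(1)[OF yt] by (metis (mono_tags) image_eqI mem_Collect_eq)
        ultimately show False using q Pair by blast
      qed
      then show ?thesis using Pair by (auto simp: \<psi>_def group_ring_simps)
    qed
  qed
  have \<chi>_closed: "\<chi> w \<in> finsupp X AG" if w: "w \<in> finsupp (X \<times> transversal) AH" for w
  proof (rule finsuppI)
    show "\<chi> w x \<in> carrier AG" for x
    proof -
      \<comment> \<open>The products \<iota>(y) t coming from all nonzero components of
        \<open>w\<close>. Not fixing the first index still leaves a finite set.\<close>
      let ?S = "\<Union>q\<in>{q. w q \<noteq> (\<lambda>_. \<zero>\<^bsub>A\<^esub>)}. (\<lambda>y. \<iota> y \<otimes>\<^bsub>G\<^esub> snd q) ` {y. w q y \<noteq> \<zero>\<^bsub>A\<^esub>}"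
      have "\<chi> w x g = \<zero>\<^bsub>A\<^esub>" if g: "g \<notin> ?S" for g
      proof (rule ccontr)
        assume *: "\<chi> w x g \<noteq> \<zero>\<^bsub>A\<^esub>"
        let ?q = "(x, representative g)"
        from * have gc: "g \<in> carrier G" and wq: "w ?q (coordinate g) \<noteq> \<zero>\<^bsub>A\<^esub>"
          by (auto simp: \<chi>_def split: if_splits)
        then have "g \<in> (\<lambda>y. \<iota> y \<otimes>\<^bsub>G\<^esub> snd ?q) ` {y. w ?q y \<noteq> \<zero>\<^bsub>A\<^esub>}"
          using coordinate(2)[OF gc] by (intro image_eqI[of _ _ "coordinate g"]) auto
        moreover have "w ?q \<noteq> (\<lambda>_. \<zero>\<^bsub>A\<^esub>)" using wq by auto
        ultimately show False using g by blast
      qed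
      moreover have "finite ?S" using wD(3)[OF w] finsuppD(1)[OF wD(1)[OF w]] by auto
      moreover have "\<chi> w x g \<in> carrier A" for g
        using finsupp_closed[OF wD(1)[OF w]] by (simp add: \<chi>_def)
      moreover have "\<chi> w x g = \<zero>\<^bsub>A\<^esub>" if "g \<notin> carrier G" for g using that by (simp add: \<chi>_def)
      ultimately show ?thesis
        unfolding group_ring_simps by (intro finsuppI[where A = ?S])
    qed
    show "\<chi> w x = \<zero>\<^bsub>AG\<^esub>" if "x \<notin> X" for x
      using that wD(2)[OF w] by (auto simp: \<chi>_def group_ring_simps)
    show "finite (fst ` {q. w q \<noteq> (\<lambda>_. \<zero>\<^bsub>A\<^esub>)})" using wD(3)[OF w] by simp
    show "\<chi> w x = \<zero>\<^bsub>AG\<^esub>" if "x \<notin> fst ` {q. w q \<noteq> (\<lambda>_. \<zero>\<^bsub>A\<^esub>)}" for x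
      using that by (force simp: \<chi>_def group_ring_simps image_iff)
  qed
  have mods: "module AG (free_module AG X)" "module AH (free_module AH (X \<times> transversal))"
    by (intro free_module_is_module G.group_ring_cring H.group_ring_cring)+
  have "\<psi> \<in> mod_hom AH (restrict_scalars \<phi> (free_module AG X)) (free_module AH (X \<times> transversal))"
  proof (rule H.mod_hom_group_ringI[OF restricted_module[OF mods(1)] mods(2)])
    show "\<psi> v \<in> carrier (free_module AH (X \<times> transversal))"
      if "v \<in> carrier (restrict_scalars \<phi> (free_module AG X))" for v
      using that \<psi>_closed by simp
    show "\<psi> (u \<oplus>\<^bsub>restrict_scalars \<phi> (free_module AG X)\<^esub> v) =
        \<psi> u \<oplus>\<^bsub>free_module AH (X \<times> transversal)\<^esub> \<psi> v" for u v
      by (auto simp: \<psi>_def group_ring_simps fun_eq_iff)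
    fix y a v assume y: "y \<in> carrier H" and a: "a \<in> carrier A"
      and "v \<in> carrier (restrict_scalars \<phi> (free_module AG X))"
    then have v: "v \<in> finsupp X AG" by simp
    note vc = vD(1)[OF v, folded group_ring_simps(1)[of A G]]
    have \<psi>c: "\<psi> v q \<in> carrier AH" for q
      using finsupp_closed[OF \<psi>_closed[OF v]] by (auto simp: group_ring_simps zero_finsupp)
    have "\<psi> (\<lambda>x. single A (\<iota> y) a \<otimes>\<^bsub>AG\<^esub> v x) (x, t) z = (single A y a \<otimes>\<^bsub>AH\<^esub> \<psi> v (x, t)) z" for x t z
      using y a transversal_carrier[of t]
      by (auto simp: \<psi>_def[of "\<lambda>x. single A (\<iota> y) a \<otimes>\<^bsub>AG\<^esub> v x"] G.single_mult[OF _ a vc]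
          H.single_mult[OF y a \<psi>c])
         (auto simp: \<psi>_def \<iota>_mult \<iota>_inv G.G.m_assoc)
    then show "\<psi> (single A y a \<odot>\<^bsub>restrict_scalars \<phi> (free_module AG X)\<^esub> v) =
        single A y a \<odot>\<^bsub>free_module AH (X \<times> transversal)\<^esub> \<psi> v"
      using y a by (auto simp: group_ring_map_single fun_eq_iff)
  qed
  moreover have "bij_betw \<psi> (finsupp X AG) (finsupp (X \<times> transversal) AH)"
  proof (rule bij_betw_byWitness[where f' = \<chi>])
    show "\<forall>v\<in>finsupp X AG. \<chi> (\<psi> v) = v"
    proof (intro ballI ext)
      fix v x g assume v: "v \<in> finsupp X AG"
      show "\<chi> (\<psi> v) x g = v x g"
        using coordinate[of g] finsuppD(2)[OF vD(1)[OF v, of x], of g]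
        by (cases "g \<in> carrier G") (auto simp: \<chi>_def \<psi>_def)
    qed
    show "\<forall>w\<in>finsupp (X \<times> transversal) AH. \<psi> (\<chi> w) = w"
    proof (intro ballI ext)
      fix w :: "'x \<times> 'g \<Rightarrow> 'h \<Rightarrow> 'a" and q y assume w: "w \<in> finsupp (X \<times> transversal) AH"
      obtain x :: 'x and t :: 'g where q: "q = (x, t)" by (cases q)
      show "\<psi> (\<chi> w) q y = w q y"
      proof (cases "t \<in> transversal \<and> y \<in> carrier H")
        case True
        then show ?thesis
          using transversal_unique[of y t] transversal_carrier[of t] by (simp add: \<psi>_def \<chi>_def q)
      next
        case False
        have "w q y = \<zero>\<^bsub>A\<^esub>"
        proof (cases "t \<in> transversal")
          case True
          then show ?thesis using False finsuppD(2)[OF wD(1)[OF w]] by blast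
        next
          case False
          then show ?thesis using wD(2)[OF w, of q] q by auto
        qed
        then show ?thesis using False by (auto simp: \<psi>_def q)
      qed
    qed
  qed (use \<psi>_closed \<chi>_closed in auto)
  ultimately show ?thesis by (auto simp: mod_iso_def)
qed


section \<open>Frobenius reciprocity\<close>

text \<open>The A[H]-linear retraction of \<open>\<phi>\<close>. The form of a coarse-grained code
  is this projection applied to the original form.\<close>

definition projection :: "('g \<Rightarrow> 'a) \<Rightarrow> 'h \<Rightarrow> 'a" where
  "projection r = (\<lambda>y. if y \<in> carrier H then r (\<iota> y) else \<zero>\<^bsub>A\<^esub>)"

abbreviation "RG \<equiv> regular_module AG"
abbreviation "RH \<equiv> regular_module AH"

lemma regular_modules: "module AG RG" "module AH RH"
  by (intro regular_module_is_module G.group_ring_cring H.group_ring_cring)+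

lemma projection_mod_hom: "projection \<in> mod_hom AH (restrict_scalars \<phi> RG) RH"
proof (rule H.mod_hom_group_ringI[OF restricted_module[OF regular_modules(1)] regular_modules(2)])
  have closed: "projection r \<in> carrier AH" if r: "r \<in> carrier AG" for r
  proof -
    have rf: "r \<in> finsupp (carrier G) A" using r by (simp add: group_ring_simps)
    have "\<iota> ` {y \<in> carrier H. r (\<iota> y) \<noteq> \<zero>\<^bsub>A\<^esub>} \<subseteq> {g. r g \<noteq> \<zero>\<^bsub>A\<^esub>}" by auto
    then have "finite (\<iota> ` {y \<in> carrier H. r (\<iota> y) \<noteq> \<zero>\<^bsub>A\<^esub>})"
      using finsuppD(1)[OF rf] by (rule finite_subset)
    then have "finite {y \<in> carrier H. r (\<iota> y) \<noteq> \<zero>\<^bsub>A\<^esub>}"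
      by (rule finite_imageD) (rule inj_on_subset[OF inj], auto)
    then show ?thesis
      using finsupp_closed[OF rf] unfolding group_ring_simps
      by (intro finsuppI[where A = "{y \<in> carrier H. r (\<iota> y) \<noteq> \<zero>\<^bsub>A\<^esub>}"]) (auto simp: projection_def)
  qed
  then show "projection r \<in> carrier RH" if "r \<in> carrier (restrict_scalars \<phi> RG)" for r
    using that by simp
  show "projection (r \<oplus>\<^bsub>restrict_scalars \<phi> RG\<^esub> s) = projection r \<oplus>\<^bsub>RH\<^esub> projection s" for r s
    by (auto simp: projection_def group_ring_simps fun_eq_iff)
  fix y a r assume y: "y \<in> carrier H" and a: "a \<in> carrier A" and "r \<in> carrier (restrict_scalars \<phi> RG)"
  then have r: "r \<in> carrier AG" by simp
  have "projection (single A (\<iota> y) a \<otimes>\<^bsub>AG\<^esub> r) z = (single A y a \<otimes>\<^bsub>AH\<^esub> projection r) z" for z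
    using y unfolding H.single_mult[OF y a closed[OF r]]
    by (auto simp: G.single_mult[OF _ a r] projection_def \<iota>_mult \<iota>_inv)
  then show "projection (single A y a \<odot>\<^bsub>restrict_scalars \<phi> RG\<^esub> r) = single A y a \<odot>\<^bsub>RH\<^esub> projection r"
    using y a by (auto simp: group_ring_map_single)
qed

text \<open>The inverse of \<open>f \<mapsto> projection \<circ> f\<close>: the coefficient at \<open>g\<close> of the lift of \<open>h\<close> at \<open>v\<close> is the
  coefficient of \<open>h (g\<^sup>-\<^sup>1 v)\<close> at the unit.\<close>

definition frobenius_lift :: "('g \<Rightarrow> 'a, 'v) module \<Rightarrow> ('v \<Rightarrow> 'h \<Rightarrow> 'a) \<Rightarrow> 'v \<Rightarrow> 'g \<Rightarrow> 'a" where
  "frobenius_lift F h v = (\<lambda>g. if g \<in> carrier G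
    then h (single A (inv\<^bsub>G\<^esub> g) \<one>\<^bsub>A\<^esub> \<odot>\<^bsub>F\<^esub> v) \<one>\<^bsub>H\<^esub> else \<zero>\<^bsub>A\<^esub>)"

text \<open>Linearity of \<open>h\<close> over A[H] turns translation of its argument by \<iota>(y)
  into a shift of coefficients. On the coset of \<open>t\<close> the lift therefore spells out all
  coefficients of a single element of A[H].\<close>

lemma frobenius_lift_translate:
  assumes F: "module AG F" and h: "h \<in> mod_hom AH (restrict_scalars \<phi> F) RH"
    and v: "v \<in> carrier F" and y: "y \<in> carrier H" and t: "t \<in> carrier G"
  shows "frobenius_lift F h v (\<iota> y \<otimes>\<^bsub>G\<^esub> t) = h (single A (inv\<^bsub>G\<^esub> t) \<one>\<^bsub>A\<^esub> \<odot>\<^bsub>F\<^esub> v) y"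
proof -
  interpret F: module AG F by fact
  let ?s = "single A (inv\<^bsub>H\<^esub> y) \<one>\<^bsub>A\<^esub>" and ?w = "single A (inv\<^bsub>G\<^esub> t) \<one>\<^bsub>A\<^esub> \<odot>\<^bsub>F\<^esub> v"
  have c: "single A g \<one>\<^bsub>A\<^esub> \<in> carrier AG" if "g \<in> carrier G" for g
    using that by (simp add: group_ring_simps single_finsupp)
  have sc: "?s \<in> carrier AH" using y by (simp add: group_ring_simps single_finsupp)
  have w: "?w \<in> carrier F" using t v c by simp
  have hw: "h ?w \<in> carrier AH" using mod_homD(1)[OF h, of ?w] w by simp
  then have hwy: "h ?w y \<in> carrier A" by (simp add: group_ring_simps finsupp_closed)
  have "single A (inv\<^bsub>G\<^esub> (\<iota> y \<otimes>\<^bsub>G\<^esub> t)) \<one>\<^bsub>A\<^esub> =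
      single A (inv\<^bsub>G\<^esub> \<iota> y) \<one>\<^bsub>A\<^esub> \<otimes>\<^bsub>AG\<^esub> single A (inv\<^bsub>G\<^esub> t) \<one>\<^bsub>A\<^esub>"
    using y t by (simp add: G.group_ring_single_mult G.G.inv_mult)
  then have "single A (inv\<^bsub>G\<^esub> (\<iota> y \<otimes>\<^bsub>G\<^esub> t)) \<one>\<^bsub>A\<^esub> \<odot>\<^bsub>F\<^esub> v = \<phi> ?s \<odot>\<^bsub>F\<^esub> ?w"
    using y t v c by (simp add: group_ring_map_single \<iota>_inv F.smult_assoc1)
  then have "h (single A (inv\<^bsub>G\<^esub> (\<iota> y \<otimes>\<^bsub>G\<^esub> t)) \<one>\<^bsub>A\<^esub> \<odot>\<^bsub>F\<^esub> v) = ?s \<otimes>\<^bsub>AH\<^esub> h ?w"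
    using mod_homD(3)[OF h sc, of ?w] w by simp
  then show ?thesis
    using y t hwy by (simp add: frobenius_lift_def H.single_mult[OF _ _ hw])
qed

text \<open>The point is finite support of the values: each coset contributes the finite support of
  one element of A[H], and finite index bounds the number of cosets.\<close>

lemma frobenius_lift_mod_hom:
  assumes fin: "finite (rcosets\<^bsub>G\<^esub> (\<iota> ` carrier H))"
    and F: "module AG F" and h: "h \<in> mod_hom AH (restrict_scalars \<phi> F) RH"
  shows "frobenius_lift F h \<in> mod_hom AG F RG"
proof (rule G.mod_hom_group_ringI[OF F regular_modules(1)])
  interpret F: module AG F by fact
  have s: "single A g a \<in> carrier AG" if "g \<in> carrier G" "a \<in> carrier A" for g a
    using that by (simp add: group_ring_simps single_finsupp)
  have hc: "h w \<in> finsupp (carrier H) A" if "w \<in> carrier F" for w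
    using mod_homD(1)[OF h, of w] that by (simp add: group_ring_simps)
  have closed: "frobenius_lift F h v \<in> carrier AG" if v: "v \<in> carrier F" for v
  proof -
    let ?w = "\<lambda>g. single A (inv\<^bsub>G\<^esub> g) \<one>\<^bsub>A\<^esub> \<odot>\<^bsub>F\<^esub> v"
    let ?S = "\<Union>t\<in>transversal. (\<lambda>y. \<iota> y \<otimes>\<^bsub>G\<^esub> t) ` {y. h (?w t) y \<noteq> \<zero>\<^bsub>A\<^esub>}"
    have w: "?w g \<in> carrier F" if "g \<in> carrier G" for g using that s v by simp
    have "finite ?S"
      using finite_transversal[OF fin] finsuppD(1)[OF hc[OF w]] transversal_carrier by blast
    moreover have "frobenius_lift F h v g = \<zero>\<^bsub>A\<^esub>" if g: "g \<notin> ?S" for g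
    proof (rule ccontr)
      assume *: "frobenius_lift F h v g \<noteq> \<zero>\<^bsub>A\<^esub>"
      then have gc: "g \<in> carrier G" by (auto simp: frobenius_lift_def split: if_splits)
      let ?t = "representative g" and ?y = "coordinate g"
      have "h (?w ?t) ?y \<noteq> \<zero>\<^bsub>A\<^esub>"
        using * frobenius_lift_translate[OF F h v, of ?y ?t] coordinate[OF gc] gc by simp
      then have "g \<in> (\<lambda>y. \<iota> y \<otimes>\<^bsub>G\<^esub> ?t) ` {y. h (?w ?t) y \<noteq> \<zero>\<^bsub>A\<^esub>}"
        using coordinate(2)[OF gc] by (intro image_eqI[of _ _ ?y]) auto
      then show False using g gc by blast
    qed
    moreover have "frobenius_lift F h v g \<in> carrier A" for g
      using finsupp_closed[OF hc[OF w]] by (simp add: frobenius_lift_def)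
    moreover have "frobenius_lift F h v g = \<zero>\<^bsub>A\<^esub>" if "g \<notin> carrier G" for g
      using that by (simp add: frobenius_lift_def)
    ultimately show ?thesis unfolding group_ring_simps by (intro finsuppI[where A = ?S])
  qed
  then show "frobenius_lift F h v \<in> carrier RG" if "v \<in> carrier F" for v using that by simp
  show "frobenius_lift F h (u \<oplus>\<^bsub>F\<^esub> v) = frobenius_lift F h u \<oplus>\<^bsub>RG\<^esub> frobenius_lift F h v"
    if "u \<in> carrier F" "v \<in> carrier F" for u v
    using that s mod_homD(2)[OF h] by (auto simp: frobenius_lift_def F.smult_r_distr group_ring_simps)
  fix g a v assume g: "g \<in> carrier G" and a: "a \<in> carrier A" and v: "v \<in> carrier F"
  have "frobenius_lift F h (single A g a \<odot>\<^bsub>F\<^esub> v) x = (single A g a \<otimes>\<^bsub>AG\<^esub> frobenius_lift F h v) x"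
    if x: "x \<in> carrier G" for x
  proof -
    let ?w = "single A (inv\<^bsub>G\<^esub> x \<otimes>\<^bsub>G\<^esub> g) \<one>\<^bsub>A\<^esub> \<odot>\<^bsub>F\<^esub> v"
    have w: "?w \<in> carrier F" using x g s v by simp
    have sa: "single A \<one>\<^bsub>H\<^esub> a \<in> carrier AH" using a by (simp add: group_ring_simps single_finsupp)
    have hw: "h ?w \<in> carrier AH" using hc[OF w] by (simp add: group_ring_simps)
    \<comment> \<open>The translation is absorbed into the argument, while the scalar
      \<open>a\<close> is kept in a monomial at the unit. That monomial comes from A[H], so
      \<open>h\<close> commutes with it.\<close>
    have "single A (inv\<^bsub>G\<^esub> x) \<one>\<^bsub>A\<^esub> \<otimes>\<^bsub>AG\<^esub> single A g a =
        single A \<one>\<^bsub>G\<^esub> a \<otimes>\<^bsub>AG\<^esub> single A (inv\<^bsub>G\<^esub> x \<otimes>\<^bsub>G\<^esub> g) \<one>\<^bsub>A\<^esub>"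
      using x g a by (simp add: G.group_ring_single_mult)
    then have "single A (inv\<^bsub>G\<^esub> x) \<one>\<^bsub>A\<^esub> \<odot>\<^bsub>F\<^esub> (single A g a \<odot>\<^bsub>F\<^esub> v) = \<phi> (single A \<one>\<^bsub>H\<^esub> a) \<odot>\<^bsub>F\<^esub> ?w"
      using x g a v s by (simp add: F.smult_assoc1[symmetric] group_ring_map_single \<iota>_one)
    then have "h (single A (inv\<^bsub>G\<^esub> x) \<one>\<^bsub>A\<^esub> \<odot>\<^bsub>F\<^esub> (single A g a \<odot>\<^bsub>F\<^esub> v)) = single A \<one>\<^bsub>H\<^esub> a \<otimes>\<^bsub>AH\<^esub> h ?w"
      using mod_homD(3)[OF h sa, of ?w] w by simp
    then show ?thesis
      using x g a finsupp_closed[OF hc[OF w]] unfolding G.single_mult[OF g a closed[OF v]]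
      by (simp add: frobenius_lift_def H.single_mult[OF _ a hw] G.G.inv_mult_group)
  qed
  moreover have "(single A g a \<otimes>\<^bsub>AG\<^esub> frobenius_lift F h v) x = \<zero>\<^bsub>A\<^esub>" if "x \<notin> carrier G" for x
    using that by (simp add: G.single_mult[OF g a closed[OF v]])
  ultimately show "frobenius_lift F h (single A g a \<odot>\<^bsub>F\<^esub> v) = single A g a \<odot>\<^bsub>RG\<^esub> frobenius_lift F h v"
    by (auto simp: fun_eq_iff frobenius_lift_def)
qed

text \<open>For finite index, induction and coinduction agree, so A[G] is the coinduction of A[H]
  and represents Hom over the smaller ring into A[H]. The two inverse maps make this identification
  explicit.\<close>

lemma frobenius_reciprocity:
  assumes fin: "finite (rcosets\<^bsub>G\<^esub> (\<iota> ` carrier H))" and F: "module AG F"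
  defines "\<Theta> \<equiv> compose (carrier F) projection"
  shows "\<Theta> \<in> mod_hom AH (restrict_scalars \<phi> (Hom_module AG F RG)) (Hom_module AH (restrict_scalars \<phi> F) RH)"
    and "bij_betw \<Theta> (carrier (Hom_module AG F RG)) (carrier (Hom_module AH (restrict_scalars \<phi> F) RH))"
proof -
  interpret F: module AG F by fact
  note F' = restricted_module[OF F]
  note p = mod_homD[OF projection_mod_hom]
  have Pi: "\<Theta> f \<in> carrier (Hom_module AH (restrict_scalars \<phi> F) RH)"
    if "f \<in> carrier (Hom_module AG F RG)" for f
  proof -
    have "f \<in> mod_hom AH (restrict_scalars \<phi> F) (restrict_scalars \<phi> RG)"
      using that restrict_scalars_mod_hom[OF group_ring_map_ring_hom, of f F RG] by simp
    from mod_hom_comp[OF this projection_mod_hom] show ?thesis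
      using mod_hom_restrict[OF F', of "\<lambda>v. projection (f v)" RH] by (simp add: \<Theta>_def compose_def)
  qed
  show "\<Theta> \<in> mod_hom AH (restrict_scalars \<phi> (Hom_module AG F RG)) (Hom_module AH (restrict_scalars \<phi> F) RH)"
  proof (rule mod_homI)
    fix f g assume "f \<in> carrier (restrict_scalars \<phi> (Hom_module AG F RG))"
      "g \<in> carrier (restrict_scalars \<phi> (Hom_module AG F RG))"
    then have "f v \<in> carrier AG" "g v \<in> carrier AG" if "v \<in> carrier F" for v
      using that mod_homD(1)[of f AG F RG] mod_homD(1)[of g AG F RG] by auto
    then show "\<Theta> (f \<oplus>\<^bsub>restrict_scalars \<phi> (Hom_module AG F RG)\<^esub> g) =
        \<Theta> f \<oplus>\<^bsub>Hom_module AH (restrict_scalars \<phi> F) RH\<^esub> \<Theta> g"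
      using p(2) by (auto simp: \<Theta>_def compose_def fun_eq_iff)
  next
    fix r f assume r: "r \<in> carrier AH" and "f \<in> carrier (restrict_scalars \<phi> (Hom_module AG F RG))"
    then have "f v \<in> carrier AG" if "v \<in> carrier F" for v
      using that mod_homD(1)[of f AG F RG] by auto
    then show "\<Theta> (r \<odot>\<^bsub>restrict_scalars \<phi> (Hom_module AG F RG)\<^esub> f) =
        r \<odot>\<^bsub>Hom_module AH (restrict_scalars \<phi> F) RH\<^esub> \<Theta> f"
      using p(3)[OF r] by (auto simp: \<Theta>_def compose_def fun_eq_iff)
  qed (use Pi in simp)
  show "bij_betw \<Theta> (carrier (Hom_module AG F RG)) (carrier (Hom_module AH (restrict_scalars \<phi> F) RH))"
  proof (rule bij_betw_byWitness[where f' = "\<lambda>h. restrict (frobenius_lift F h) (carrier F)"])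
    show "\<forall>f\<in>carrier (Hom_module AG F RG). restrict (frobenius_lift F (\<Theta> f)) (carrier F) = f"
    proof
      fix f assume "f \<in> carrier (Hom_module AG F RG)"
      then have f: "f \<in> mod_hom AG F RG" "f \<in> extensional (carrier F)" by auto
      show "restrict (frobenius_lift F (\<Theta> f)) (carrier F) = f"
      proof (rule extensionalityI[OF _ f(2)])
        fix v assume v: "v \<in> carrier F"
        have fv: "f v \<in> carrier AG" using mod_homD(1)[OF f(1) v] by simp
        have "frobenius_lift F (\<Theta> f) v g = f v g" for g
        proof (cases "g \<in> carrier G")
          case True
          let ?s = "single A (inv\<^bsub>G\<^esub> g) \<one>\<^bsub>A\<^esub>"
          have s: "?s \<in> carrier AG" using True by (simp add: group_ring_simps single_finsupp)
          have "f v g \<in> carrier A" using fv by (simp add: group_ring_simps finsupp_closed)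
          then show ?thesis
            using True s v mod_homD(3)[OF f(1) s v]
            by (simp add: frobenius_lift_def \<Theta>_def compose_def projection_def \<iota>_one G.single_mult[OF _ _ fv])
        next
          case False
          then show ?thesis
            using fv finsuppD(2)[of "f v" "carrier G" A] by (simp add: frobenius_lift_def group_ring_simps)
        qed
        then show "restrict (frobenius_lift F (\<Theta> f)) (carrier F) v = f v" using v by auto
      qed simp
    qed
    show "\<forall>h\<in>carrier (Hom_module AH (restrict_scalars \<phi> F) RH).
        \<Theta> (restrict (frobenius_lift F h) (carrier F)) = h"
    proof
      fix h assume "h \<in> carrier (Hom_module AH (restrict_scalars \<phi> F) RH)"
      then have h: "h \<in> mod_hom AH (restrict_scalars \<phi> F) RH" "h \<in> extensional (carrier F)" by auto
      show "\<Theta> (restrict (frobenius_lift F h) (carrier F)) = h"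
      proof (rule extensionalityI[OF _ h(2)])
        fix v assume v: "v \<in> carrier F"
        have hv: "h v \<in> finsupp (carrier H) A" using mod_homD(1)[OF h(1), of v] v by (simp add: group_ring_simps)
        \<comment> \<open>The monomial at the unit is the unit of the ring, so
          \<open>frobenius_lift_translate\<close> at the trivial coset returns the coefficients of
          \<open>h v\<close> itself.\<close>
        have "single A \<one>\<^bsub>G\<^esub> \<one>\<^bsub>A\<^esub> \<odot>\<^bsub>F\<^esub> v = v" using F.smult_one[OF v] by (simp add: group_ring_simps)
        then have "projection (frobenius_lift F h v) y = h v y" for y
          using frobenius_lift_translate[OF F h(1) v, of y "\<one>\<^bsub>G\<^esub>"] finsuppD(2)[OF hv, of y]
          by (auto simp: projection_def)
        then show "\<Theta> (restrict (frobenius_lift F h) (carrier F)) v = h v"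
          using v by (auto simp: \<Theta>_def compose_def)
      qed (simp add: \<Theta>_def)
    qed
    show "\<Theta> ` carrier (Hom_module AG F RG) \<subseteq> carrier (Hom_module AH (restrict_scalars \<phi> F) RH)"
      using Pi by blast
    show "(\<lambda>h. restrict (frobenius_lift F h) (carrier F)) ` carrier (Hom_module AH (restrict_scalars \<phi> F) RH)
        \<subseteq> carrier (Hom_module AG F RG)"
      using frobenius_lift_mod_hom[OF fin F] by (auto simp: mod_hom_restrict[OF F])
  qed
qed

text \<open>\<open>?\<Theta>\<close> composes on the left and the differentials on the right, so
  they commute. A bijection in every degree that commutes with the differentials matches cocycles
  with cocycles and coboundaries with coboundaries.\<close>

lemma restricted_cohomology:
  assumes fin: "finite (rcosets\<^bsub>G\<^esub> (\<iota> ` carrier H))"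
    and F: "\<And>k. module AG (F k)" "\<And>k. d k \<in> mod_hom AG (F (Suc k)) (F k)"
    and dd: "\<And>k v. v \<in> carrier (F (Suc (Suc k))) \<Longrightarrow> d k (d (Suc k) v) = \<zero>\<^bsub>F k\<^esub>"
  shows "mod_iso AH (restrict_scalars \<phi> (hom_cohomology AG F d RG k))
    (hom_cohomology AH (\<lambda>k. restrict_scalars \<phi> (F k)) d RH k)"
proof -
  let ?C = "\<lambda>k. restrict_scalars \<phi> (Hom_module AG (F k) RG)"
  let ?D = "\<lambda>k. Hom_module AH (restrict_scalars \<phi> (F k)) RH"
  let ?c = "\<lambda>k f. compose (carrier (F (Suc k))) f (d k)"
  let ?\<Theta> = "\<lambda>k. compose (carrier (F k)) projection"
  note F' = restricted_module[OF F(1)]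
  note d' = restrict_scalars_mod_hom[OF group_ring_map_ring_hom F(2)]
  note dc = mod_homD(1)[OF F(2)]
  have C: "module AH (?C k)" for k by (intro restricted_module Hom_module_is_module F regular_modules)
  have D: "module AH (?D k)" for k by (intro Hom_module_is_module F' regular_modules)
  have c: "?c k \<in> mod_hom AH (?C k) (?C (Suc k))" for k
    by (rule restrict_scalars_mod_hom[OF group_ring_map_ring_hom mod_hom_precompose[OF F(1) F(1) F(2)]])
  have e: "?c k \<in> mod_hom AH (?D k) (?D (Suc k))" for k
    using mod_hom_precompose[OF F' F' d', where N = RH] by simp
  have comm: "?\<Theta> (Suc k) (?c k u) = ?c k (?\<Theta> k u)" for k u
    using dc by (auto simp: compose_def fun_eq_iff)
  have \<Theta>: "?\<Theta> k \<in> mod_hom AH (?C k) (?D k)" and b: "bij_betw (?\<Theta> k) (carrier (?C k)) (carrier (?D k))" for k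
    using frobenius_reciprocity[OF fin F(1)] by simp_all
  have inj: "u = v" if "u \<in> carrier (?C k)" "v \<in> carrier (?C k)" "?\<Theta> k u = ?\<Theta> k v" for k u v
    using b[of k] that by (metis bij_betw_inv_into_left)
  have surj: "\<exists>v\<in>carrier (?C k). ?\<Theta> k v = u" if "u \<in> carrier (?D k)" for k u
  proof -
    have "u \<in> ?\<Theta> k ` carrier (?C k)" unfolding bij_betw_imp_surj_on[OF b] by (rule that)
    then show ?thesis by blast
  qed
  have cc: "?c (Suc k) (?c k u) = \<zero>\<^bsub>?C (Suc (Suc k))\<^esub>" if "u \<in> carrier (?C k)" for k u
    using that mod_hom_zero[OF F(1) regular_modules(1), of u k] dc
    by (auto simp: compose_eq_const_iff compose_def dd)
  have ee: "?c (Suc k) (?c k u) = \<zero>\<^bsub>?D (Suc (Suc k))\<^esub>" if "u \<in> carrier (?D k)" for k u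
    using that mod_hom_zero[OF F' regular_modules(2), of u k] dc
    by (auto simp: compose_eq_const_iff compose_def dd)
  note \<Theta>0 = mod_hom_zero[OF C D \<Theta>] and cz = mod_homD(1)[OF c]
  have "mod_iso AH
    (quotient_module ((?C (Suc k))\<lparr>carrier := mod_ker (?C (Suc k)) (?C (Suc (Suc k))) (?c (Suc k))\<rparr>)
      (?c k ` carrier (?C k)))
    (quotient_module ((?D (Suc k))\<lparr>carrier := mod_ker (?D (Suc k)) (?D (Suc (Suc k))) (?c (Suc k))\<rparr>)
      (?c k ` carrier (?D k)))"
  proof (rule mod_iso_cohomologyI[where \<alpha> = "?\<Theta> (Suc k)", OF C C C D D D c c cc e e ee \<Theta>])
    fix a assume "a \<in> mod_ker (?C (Suc k)) (?C (Suc (Suc k))) (?c (Suc k))"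
    then have a: "a \<in> carrier (?C (Suc k))" "?c (Suc k) a = \<zero>\<^bsub>?C (Suc (Suc k))\<^esub>" by (auto simp: mod_ker_def)
    show "?c (Suc k) (?\<Theta> (Suc k) a) = \<zero>\<^bsub>?D (Suc (Suc k))\<^esub>"
      unfolding comm[symmetric] a(2) by (rule \<Theta>0)
    assume "?\<Theta> (Suc k) a \<in> ?c k ` carrier (?D k)"
    then obtain w where "w \<in> carrier (?D k)" "?\<Theta> (Suc k) a = ?c k w" by blast
    with surj obtain u where u: "u \<in> carrier (?C k)" "?\<Theta> (Suc k) a = ?c k (?\<Theta> k u)" by metis
    then have "a = ?c k u" using inj[OF a(1) cz[OF u(1)]] comm by metis
    then show "a \<in> ?c k ` carrier (?C k)" using u(1) by blast
  next
    fix u assume "u \<in> carrier (?C k)"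
    then show "?\<Theta> (Suc k) (?c k u) \<in> ?c k ` carrier (?D k)"
      unfolding comm using mod_homD(1)[OF \<Theta>] by blast
  next
    fix b assume "b \<in> mod_ker (?D (Suc k)) (?D (Suc (Suc k))) (?c (Suc k))"
    then have b: "b \<in> carrier (?D (Suc k))" "?c (Suc k) b = \<zero>\<^bsub>?D (Suc (Suc k))\<^esub>" by (auto simp: mod_ker_def)
    then obtain a where a: "a \<in> carrier (?C (Suc k))" "b = ?\<Theta> (Suc k) a" using surj by metis
    interpret C2: module AH "?C (Suc (Suc k))" by (rule C)
    \<comment> \<open>The preimage \<open>a\<close> is a cocycle because \<open>?\<Theta>\<close> is
      injective one degree higher.\<close>
    have "?\<Theta> (Suc (Suc k)) (?c (Suc k) a) = ?\<Theta> (Suc (Suc k)) \<zero>\<^bsub>?C (Suc (Suc k))\<^esub>"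
      using b(2) unfolding a(2) comm[symmetric] \<Theta>0 .
    then have "?c (Suc k) a = \<zero>\<^bsub>?C (Suc (Suc k))\<^esub>" using inj[OF cz[OF a(1)] C2.M.zero_closed] by blast
    then have "a \<in> mod_ker (?C (Suc k)) (?C (Suc (Suc k))) (?c (Suc k))" using a(1) by (simp add: mod_ker_def)
    \<comment> \<open>\<open>?\<Theta>\<close> is onto already on cochains, so the correcting
      coboundary is zero.\<close>
    moreover have "\<zero>\<^bsub>?D (Suc k)\<^esub> \<in> ?c k ` carrier (?D k)"
      by (rule submodule_zero_closed[OF submodule_image[OF D D e]])
    moreover have "b = \<zero>\<^bsub>?D (Suc k)\<^esub> \<oplus>\<^bsub>?D (Suc k)\<^esub> ?\<Theta> (Suc k) a"
    proof -
      interpret D1: module AH "?D (Suc k)" by (rule D)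
      show ?thesis using b(1) unfolding a(2) by (rule D1.M.l_zero[symmetric])
    qed
    ultimately show "\<exists>a\<in>mod_ker (?C (Suc k)) (?C (Suc (Suc k))) (?c (Suc k)).
        \<exists>n\<in>?c k ` carrier (?D k). b = n \<oplus>\<^bsub>?D (Suc k)\<^esub> ?\<Theta> (Suc k) a"
      by blast
  qed
  then show ?thesis
    by (simp add: hom_cohomology_def restrict_scalars_quotient mod_ker_def del: Hom_module_simps)
qed

end


section \<open>Ext and coarse graining\<close>

text \<open>The choice in \<open>chosen_resolution\<close> says something only because a resolution
  with bases in the tree type exists, which \<open>free_resolution_exists\<close> ensures.\<close>

lemma Ext_eq_cohomology:
  fixes R :: "('r, 'a) ring_scheme" and M :: "('r, 'm) module" and N :: "('r, 'n) module"
  assumes M: "module R M"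
  obtains X :: "nat \<Rightarrow> ('m + 'r) tree set" and d \<epsilon> where
    "free_resolution R M X d \<epsilon>" and "\<And>k. Ext R k M N = cohomology R X d N k"
proof -
  obtain X :: "nat \<Rightarrow> ('m + 'r) tree set" and d where Xd: "chosen_resolution R M = (X, d)"
    by (cases "chosen_resolution R M")
  have "\<exists>Xd :: (nat \<Rightarrow> ('m + 'r) tree set) \<times> _. case Xd of (X, d) \<Rightarrow> \<exists>\<epsilon>. free_resolution R M X d \<epsilon>"
    using free_resolution_exists[OF M] by auto
  from someI_ex[OF this] have "\<exists>\<epsilon>. free_resolution R M X d \<epsilon>"
    using Xd by (simp add: chosen_resolution_def)
  with that Xd show ?thesis by (auto simp: Ext_def)
qed

text \<open>Agreement of the actions on scalars from the carrier is enough. This absorbs the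
  difference between conjugating before and after restriction.\<close>

lemma resolution_cong:
  assumes "resolution R M F d \<epsilon>" and "carrier M' = carrier M" "add M' = add M" "\<zero>\<^bsub>M'\<^esub> = \<zero>\<^bsub>M\<^esub>"
    and "\<And>r x. r \<in> carrier R \<Longrightarrow> x \<in> carrier M \<Longrightarrow> r \<odot>\<^bsub>M'\<^esub> x = r \<odot>\<^bsub>M\<^esub> x"
  shows "resolution R M' F d \<epsilon>"
  using assms by (auto simp: resolution_def mod_hom_def mod_ker_def Pi_iff)

text \<open>\<open>M'\<close> stands for the restriction of \<open>M\<close>, described by its
  operations so that a differently built record can be inserted. The isomorphism passes through the
  restricted resolution: comparison of resolutions leads to its cohomology over A[H], and Frobenius
  reciprocity leads back to A[G].\<close>

lemma (in coarse_graining) restricted_Ext: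
  fixes M :: "('g \<Rightarrow> 'a, 'm) module"
  assumes fin: "finite (rcosets\<^bsub>G\<^esub> (\<iota> ` carrier H))"
    and M: "module AG M" and M': "module AH M'"
    and eq: "carrier M' = carrier M" "add M' = add M" "\<zero>\<^bsub>M'\<^esub> = \<zero>\<^bsub>M\<^esub>"
      "\<And>r x. r \<in> carrier AH \<Longrightarrow> x \<in> carrier M \<Longrightarrow> r \<odot>\<^bsub>M'\<^esub> x = \<phi> r \<odot>\<^bsub>M\<^esub> x"
  shows "mod_iso AH (Ext AH (Suc i) M' RH) (restrict_scalars \<phi> (Ext AG (Suc i) M RG))"
proof -
  obtain X :: "nat \<Rightarrow> ('m + ('g \<Rightarrow> 'a)) tree set" and d \<epsilon> where
    "free_resolution AG M X d \<epsilon>" and EG: "\<And>k. Ext AG k M RG = cohomology AG X d RG k"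
    using Ext_eq_cohomology[OF M] by blast
  then have F: "resolution AG M (\<lambda>k. free_module AG (X k)) d \<epsilon>" (is "resolution _ _ ?F _ _")
    by (simp add: resolution_free G.group_ring_cring)
  obtain Y :: "nat \<Rightarrow> ('m + ('h \<Rightarrow> 'a)) tree set" and e \<eta> where
    "free_resolution AH M' Y e \<eta>" and EH: "\<And>k. Ext AH k M' RH = cohomology AH Y e RH k"
    using Ext_eq_cohomology[OF M'] by blast
  then have "resolution AH M' (\<lambda>k. free_module AH (Y k)) e \<eta>" (is "resolution _ _ ?E _ _")
    by (simp add: resolution_free H.group_ring_cring)
  then have E: "resolution AH (restrict_scalars \<phi> M) ?E e \<eta>"
    by (rule resolution_cong) (simp_all add: eq)
  have "mod_iso AH (hom_cohomology AH ?E e RH i) (hom_cohomology AH (\<lambda>k. restrict_scalars \<phi> (?F k)) d RH i)"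
    by (rule hom_cohomology_mod_iso[where F = "\<lambda>k. restrict_scalars \<phi> (?F k)" and E = ?E,
          OF restricted_module[OF M] regular_modules(2)
          restricted_resolution[OF F] E restricted_free_module mod_iso_refl])
  moreover have "mod_iso AH (hom_cohomology AH (\<lambda>k. restrict_scalars \<phi> (?F k)) d RH i)
      (restrict_scalars \<phi> (hom_cohomology AG ?F d RG i))"
  proof (rule mod_iso_sym)
    note FD = resolutionD(1,4)[OF F] and dd = resolution_dd(1)[OF F]
    show "module AH (restrict_scalars \<phi> (hom_cohomology AG ?F d RG i))"
      by (rule restricted_module[OF hom_cohomology_is_module[where F = ?F and d = d, OF regular_modules(1) FD dd]])
    show "mod_iso AH (restrict_scalars \<phi> (hom_cohomology AG ?F d RG i))
        (hom_cohomology AH (\<lambda>k. restrict_scalars \<phi> (?F k)) d RH i)"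
      by (rule restricted_cohomology[where F = ?F and d = d, OF fin FD dd])
  qed
  ultimately show ?thesis
    unfolding EG EH cohomology_Suc by (rule mod_iso_trans)
qed

text \<open>On an abelian group inversion is an injective endomorphism. Taken for \<iota>, it
  exhibits the antipode as a \<open>group_ring_map\<close>, from which its ring homomorphism laws
  are inherited.\<close>

lemma (in group_algebra) coarse_graining_inv: "coarse_graining A G G (m_inv G)"
proof
  show "m_inv G \<in> hom G G" by (rule homI) (simp_all add: G.inv_mult)
  show "inj_on (m_inv G) (carrier G)" by (rule G.inv_inj)
qed

lemma (in group_algebra) antipode_eq:
  assumes "r \<in> carrier AG"
  shows "antipode A G r = group_ring_map A G (m_inv G) r"
proof -
  interpret inv: coarse_graining A G G "m_inv G" by (rule coarse_graining_inv)
  have "x \<in> m_inv G ` carrier G" if "x \<in> carrier G" for x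
    using that by (intro image_eqI[of _ _ "inv\<^bsub>G\<^esub> x"]) auto
  then show ?thesis
    using assms by (intro inv.group_ring_map_eqI[symmetric]) (auto simp: group_ring_simps antipode_def)
qed

lemma (in group_algebra) antipode_ring_hom: "antipode A G \<in> ring_hom AG AG"
proof -
  interpret inv: coarse_graining A G G "m_inv G" by (rule coarse_graining_inv)
  interpret AG: cring AG by (rule group_ring_cring)
  note h = inv.group_ring_map_ring_hom
  show ?thesis
    using ring_hom_memE[OF h] by (intro ring_hom_memI) (simp_all add: antipode_eq)
qed

text \<open>A homomorphism commutes with inversion, and inversion preserves the complement of the
  image subgroup. The result lets conjugation of modules be exchanged with coarse graining.\<close>

lemma (in coarse_graining) group_ring_map_antipode:
  assumes "r \<in> carrier AH"
  shows "\<phi> (antipode A H r) = antipode A G (\<phi> r)"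
proof (rule group_ring_map_eqI)
  have r: "r \<in> finsupp (carrier H) A" using assms by (simp add: group_ring_simps)
  show "antipode A H r \<in> finsupp (carrier H) A"
    using ring_hom_closed[OF H.antipode_ring_hom assms] by (simp add: group_ring_simps)
  show "antipode A G (\<phi> r) (\<iota> y) = antipode A H r y" if "y \<in> carrier H" for y
    using that group_ring_map_image[OF r, of "inv\<^bsub>H\<^esub> y"] by (simp add: antipode_def \<iota>_inv)
  fix x assume x: "x \<notin> \<iota> ` carrier H"
  have "inv\<^bsub>G\<^esub> x \<notin> \<iota> ` carrier H" if "x \<in> carrier G"
  proof
    assume "inv\<^bsub>G\<^esub> x \<in> \<iota> ` carrier H"
    then obtain y where y: "y \<in> carrier H" "inv\<^bsub>G\<^esub> x = \<iota> y" by auto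
    then have "x = \<iota> (inv\<^bsub>H\<^esub> y)" using that by (metis G.G.inv_inv \<iota>_inv)
    then show False using x y by simp
  qed
  then show "antipode A G (\<phi> r) x = \<zero>\<^bsub>A\<^esub>" by (simp add: antipode_def group_ring_map_outside)
qed


section \<open>Translation of the symplectic form\<close>

context group_algebra_module
begin

text \<open>The identity \<omega>(x^g m, p) = x^(-g) \<omega>(m, p), read coefficient by coefficient
  and proved by shifting the summation index by g. At the unit it turns an arbitrary coefficient
  into a unit coefficient for a translate of \<open>m\<close>.\<close>

lemma group_form_translate_left:
  assumes w: "bilinear_form A P w" and m: "m \<in> finsupp (carrier G) P" and p: "p \<in> finsupp (carrier G) P"
    and g: "g \<in> carrier G" and x: "x \<in> carrier G"
  shows "group_form A G P w (single A g \<one>\<^bsub>A\<^esub> \<cdot> m) p x = group_form A G P w m p (g \<otimes>\<^bsub>G\<^esub> x)"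
proof -
  have c: "m y \<in> carrier P" "p y \<in> carrier P" for y using m p by (auto simp: finsupp_closed)
  have wc: "w a b \<in> carrier A" if "a \<in> carrier P" "b \<in> carrier P" for a b
    using w that mod_homD(1)[of "w a" A P "regular_module A"] by (auto simp: bilinear_form_def)
  have mG: "z \<in> carrier G" if "m z \<noteq> \<zero>\<^bsub>P\<^esub>" for z using finsuppD(3)[OF m that] .
  let ?gm = "single A g \<one>\<^bsub>A\<^esub> \<cdot> m"
  have gm: "?gm y = (if y \<in> carrier G then m (inv\<^bsub>G\<^esub> g \<otimes>\<^bsub>G\<^esub> y) else \<zero>\<^bsub>P\<^esub>)" for y
    using g c by (simp add: act_single[OF _ _ m])
  have gmz: "?gm (g \<otimes>\<^bsub>G\<^esub> z) = m z" if "z \<in> carrier G" for z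
    using g that by (simp add: gm G.m_assoc[symmetric])
  have S: "{y. ?gm y \<noteq> \<zero>\<^bsub>P\<^esub>} = (\<lambda>z. g \<otimes>\<^bsub>G\<^esub> z) ` {z. m z \<noteq> \<zero>\<^bsub>P\<^esub>}"
  proof (intro equalityI subsetI)
    fix y assume "y \<in> {y. ?gm y \<noteq> \<zero>\<^bsub>P\<^esub>}"
    then have y: "y \<in> carrier G" "m (inv\<^bsub>G\<^esub> g \<otimes>\<^bsub>G\<^esub> y) \<noteq> \<zero>\<^bsub>P\<^esub>" by (auto simp: gm split: if_splits)
    then show "y \<in> (\<lambda>z. g \<otimes>\<^bsub>G\<^esub> z) ` {z. m z \<noteq> \<zero>\<^bsub>P\<^esub>}"
      using g by (intro image_eqI[of _ _ "inv\<^bsub>G\<^esub> g \<otimes>\<^bsub>G\<^esub> y"]) (auto simp: G.m_assoc[symmetric])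
  qed (auto simp: gmz mG)
  have "inj_on (\<lambda>z. g \<otimes>\<^bsub>G\<^esub> z) {z. m z \<noteq> \<zero>\<^bsub>P\<^esub>}" using g mG by (auto simp: inj_on_def)
  then have "(\<Oplus>\<^bsub>A\<^esub>y\<in>{y. ?gm y \<noteq> \<zero>\<^bsub>P\<^esub>}. w (?gm y) (p (y \<otimes>\<^bsub>G\<^esub> x))) =
      (\<Oplus>\<^bsub>A\<^esub>z\<in>{z. m z \<noteq> \<zero>\<^bsub>P\<^esub>}. w (?gm (g \<otimes>\<^bsub>G\<^esub> z)) (p (g \<otimes>\<^bsub>G\<^esub> z \<otimes>\<^bsub>G\<^esub> x)))"
    unfolding S by (intro A.finsum_reindex) (auto simp: gm intro!: wc c)
  also have "\<dots> = (\<Oplus>\<^bsub>A\<^esub>z\<in>{z. m z \<noteq> \<zero>\<^bsub>P\<^esub>}. w (m z) (p (z \<otimes>\<^bsub>G\<^esub> (g \<otimes>\<^bsub>G\<^esub> x))))"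
  proof (intro A.finsum_cong')
    fix z assume "z \<in> {z. m z \<noteq> \<zero>\<^bsub>P\<^esub>}"
    then have z: "z \<in> carrier G" using mG by blast
    then have "g \<otimes>\<^bsub>G\<^esub> z \<otimes>\<^bsub>G\<^esub> x = z \<otimes>\<^bsub>G\<^esub> (g \<otimes>\<^bsub>G\<^esub> x)" using g x by (simp add: G.m_ac)
    with z show "w (?gm (g \<otimes>\<^bsub>G\<^esub> z)) (p (g \<otimes>\<^bsub>G\<^esub> z \<otimes>\<^bsub>G\<^esub> x)) = w (m z) (p (z \<otimes>\<^bsub>G\<^esub> (g \<otimes>\<^bsub>G\<^esub> x)))"
      by (simp add: gmz)
  qed (auto intro!: wc c)
  finally show ?thesis using g x by (simp add: group_form_def)
qed

text \<open>The identity \<omega>(m, x^g p) = x^g \<omega>(m, p). It makes orthogonal complements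
  translation invariant, so that the comparison of complements can be repeated for the double
  complement.\<close>

lemma group_form_translate_right:
  assumes w: "bilinear_form A P w" and m: "m \<in> finsupp (carrier G) P" and p: "p \<in> finsupp (carrier G) P"
    and g: "g \<in> carrier G" and x: "x \<in> carrier G"
  shows "group_form A G P w m (single A g \<one>\<^bsub>A\<^esub> \<cdot> p) x = group_form A G P w m p (inv\<^bsub>G\<^esub> g \<otimes>\<^bsub>G\<^esub> x)"
proof -
  have c: "m y \<in> carrier P" "p y \<in> carrier P" for y using m p by (auto simp: finsupp_closed)
  have wc: "w a b \<in> carrier A" if "a \<in> carrier P" "b \<in> carrier P" for a b
    using w that mod_homD(1)[of "w a" A P "regular_module A"] by (auto simp: bilinear_form_def)
  have mG: "z \<in> carrier G" if "m z \<noteq> \<zero>\<^bsub>P\<^esub>" for z using finsuppD(3)[OF m that] .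
  have "(\<Oplus>\<^bsub>A\<^esub>y\<in>{y. m y \<noteq> \<zero>\<^bsub>P\<^esub>}. w (m y) ((single A g \<one>\<^bsub>A\<^esub> \<cdot> p) (y \<otimes>\<^bsub>G\<^esub> x))) =
      (\<Oplus>\<^bsub>A\<^esub>y\<in>{y. m y \<noteq> \<zero>\<^bsub>P\<^esub>}. w (m y) (p (y \<otimes>\<^bsub>G\<^esub> (inv\<^bsub>G\<^esub> g \<otimes>\<^bsub>G\<^esub> x))))"
    using g x c by (intro A.finsum_cong') (auto simp: act_single[OF _ _ p] mG G.m_lcomm intro!: wc)
  then show ?thesis using g x by (simp add: group_form_def)
qed

end


section \<open>Coarse-grained codes\<close>

lemma coarse_code_simps [simp]:
  "modulus (coarse_code \<Gamma> \<iota> C) = modulus C"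
  "translation_group (coarse_code \<Gamma> \<iota> C) = \<Gamma>"
  "stabilizers (coarse_code \<Gamma> \<iota> C) = stabilizers C"
  "paulis (coarse_code \<Gamma> \<iota> C) = coarse_module \<Gamma> \<iota> C (paulis C)"
  "pauli_form (coarse_code \<Gamma> \<iota> C) p q =
    (\<lambda>x. if x \<in> carrier \<Gamma> then pauli_form C p q (\<iota> x) else \<zero>\<^bsub>scalars C\<^esub>)"
  "scalars (coarse_code \<Gamma> \<iota> C) = scalars C"
  by (simp_all add: coarse_code_def scalars_def)

theorem proposition34:
  fixes C :: "('l, 'l \<Rightarrow> 'p) code_data" and \<Gamma> :: "'g monoid" and \<iota> :: "'g \<Rightarrow> 'l"
  assumes "stabilizer_code C"
    and "comm_group \<Gamma>"
    and "\<iota> \<in> hom \<Gamma> (translation_group C)" and "inj_on \<iota> (carrier \<Gamma>)"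
    and "finite (rcosets\<^bsub>translation_group C\<^esub> (\<iota> ` carrier \<Gamma>))"
  shows "S_module (coarse_code \<Gamma> \<iota> C) = coarse_module \<Gamma> \<iota> C (S_module C) \<and>
    Z_module (coarse_code \<Gamma> \<iota> C) = coarse_module \<Gamma> \<iota> C (Z_module C) \<and>
    (\<forall>i. mod_iso (code_ring (coarse_code \<Gamma> \<iota> C))
      (Q_module i (coarse_code \<Gamma> \<iota> C)) (coarse_module \<Gamma> \<iota> C (Q_module i C)))"
proof -
  let ?A = "scalars C" and ?G = "translation_group C" and ?C' = "coarse_code \<Gamma> \<iota> C"
  let ?L = "stabilizers C"
  obtain P w where comm: "comm_group ?G" and P: "module ?A P" and w: "bilinear_form ?A P w"
    and paulis: "paulis C = group_module ?A ?G P" and form: "pauli_form C = group_form ?A ?G P w"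
    and L: "submodule ?L (code_ring C) (paulis C)"
    using assms(1) unfolding stabilizer_code_def by blast
  have A: "cring ?A" unfolding scalars_def by (rule ZFact_is_cring)
  interpret P: group_algebra_module ?A ?G P
    by (intro group_algebra_module.intro group_algebra.intro A comm P)
  interpret coarse_graining ?A ?G \<Gamma> \<iota>
    by (intro coarse_graining.intro coarse_graining_axioms.intro group_algebra.intro A comm assms(2-4))
  let ?AG = "group_ring ?A ?G" and ?AH = "group_ring ?A \<Gamma>"
  let ?\<phi> = "group_ring_map ?A \<Gamma> \<iota>"
  have rings: "code_ring C = ?AG" "code_ring ?C' = ?AH" by (simp_all add: code_ring_def)
  have PM: "module ?AG (paulis C)" unfolding paulis by (rule P.group_module_is_module)
  have coarse: "coarse_module \<Gamma> \<iota> C M = restrict_scalars ?\<phi> M" for M :: "(_, 'x) module"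
    by (simp add: coarse_module_def)

  \<comment> \<open>Invariance under the monomials with coefficient 1: these are the translations
    that move any coefficient of the form to the unit.\<close>
  define T where "T N \<longleftrightarrow> N \<subseteq> carrier (paulis C) \<and>
    (\<forall>g\<in>carrier ?G. \<forall>m\<in>N. single ?A g \<one>\<^bsub>?A\<^esub> \<odot>\<^bsub>paulis C\<^esub> m \<in> N)" for N
  have orth: "p \<in> orthogonal C N \<longleftrightarrow> p \<in> carrier (paulis C) \<and>
      (\<forall>m\<in>N. \<forall>g\<in>carrier ?G. pauli_form C m p g = \<zero>\<^bsub>?A\<^esub>)" for p N
    by (auto simp: orthogonal_def rings group_ring_simps form fun_eq_iff group_form_def)
  have T_orth: "T (orthogonal C N)" if "T N" for N
    unfolding T_def
  proof (intro conjI ballI)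
    show "orthogonal C N \<subseteq> carrier (paulis C)" by (auto simp: orthogonal_def)
    fix g p assume g: "g \<in> carrier ?G" and p: "p \<in> orthogonal C N"
    then have pf: "p \<in> finsupp (carrier ?G) P" by (simp add: orth paulis group_module_simps)
    have "m \<in> finsupp (carrier ?G) P" if "m \<in> N" for m
      using \<open>T N\<close> that by (auto simp: T_def paulis group_module_simps)
    then show "single ?A g \<one>\<^bsub>?A\<^esub> \<odot>\<^bsub>paulis C\<^esub> p \<in> orthogonal C N"
      using p g P.act_single_closed[OF g P.A.one_closed pf]
      by (simp add: orth paulis form group_module_simps(1) P.group_form_translate_right[OF w _ pf g])
  qed
  have orth_eq: "orthogonal ?C' N = orthogonal C N" if N: "T N" for N
  proof (intro equalityI subsetI)
    fix p assume "p \<in> orthogonal C N"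
    then show "p \<in> orthogonal ?C' N"
      unfolding orth by (auto simp: orthogonal_def rings group_ring_simps coarse fun_eq_iff)
  next
    fix p assume p: "p \<in> orthogonal ?C' N"
    then have pc: "p \<in> carrier (paulis C)"
      and p0: "\<And>m x. m \<in> N \<Longrightarrow> x \<in> carrier \<Gamma> \<Longrightarrow> pauli_form C m p (\<iota> x) = \<zero>\<^bsub>?A\<^esub>"
      by (auto simp: orthogonal_def rings group_ring_simps coarse fun_eq_iff split: if_splits)
    have "pauli_form C m p g = \<zero>\<^bsub>?A\<^esub>" if m: "m \<in> N" and g: "g \<in> carrier ?G" for m g
    proof -
      \<comment> \<open>The unit coefficient is the value of the coarse form at the unit of
        \<Gamma>, hence zero on the translate of \<open>m\<close>. Translating back gives the
        coefficient of \<open>m\<close> at \<open>g\<close>, even for \<open>g\<close> outside the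
        image of \<iota>.\<close>
      have "pauli_form C (single ?A g \<one>\<^bsub>?A\<^esub> \<odot>\<^bsub>paulis C\<^esub> m) p \<one>\<^bsub>?G\<^esub> = \<zero>\<^bsub>?A\<^esub>"
        using p0[of _ "\<one>\<^bsub>\<Gamma>\<^esub>"] N m g by (simp add: T_def \<iota>_one)
      then show ?thesis
        using N m g pc P.group_form_translate_left[OF w, of m p g "\<one>\<^bsub>?G\<^esub>"]
        by (auto simp: T_def paulis form group_module_simps)
    qed
    with pc show "p \<in> orthogonal C N" unfolding orth by blast
  qed
  have "T ?L"
    using module.submoduleE(1)[OF PM L[unfolded rings]] submodule.smult_closed[OF L]
    by (auto simp: T_def rings group_ring_simps single_finsupp)
  \<comment> \<open>Invariance of L handles its complement, and invariance of the complement handles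
    the double complement.\<close>
  note TL = this T_orth[OF this]
  have "S_module ?C' = coarse_module \<Gamma> \<iota> C (S_module C)"
    and "Z_module ?C' = coarse_module \<Gamma> \<iota> C (Z_module C)"
    by (simp_all add: S_module_def Z_module_def coarse orth_eq TL restrict_scalars_quotient)
  moreover have "mod_iso (code_ring ?C') (Q_module i ?C') (coarse_module \<Gamma> \<iota> C (Q_module i C))" for i
  proof -
    let ?Q = "quotient_module (paulis C) ?L"
    have Q: "module ?AG ?Q" by (rule quotient_module_is_module[OF PM L[unfolded rings]])
    \<comment> \<open>Over \<Gamma> the quotient is restricted and then conjugated; on the right it
      is conjugated over \<Lambda> before \<open>Ext\<close> is formed and restricted.
      \<open>group_ring_map_antipode\<close> reconciles the two actions.\<close>
    have "mod_iso ?AH (Ext ?AH (Suc i) (restrict_scalars (antipode ?A \<Gamma>) (restrict_scalars ?\<phi> ?Q)) RH)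
      (restrict_scalars ?\<phi> (Ext ?AG (Suc i) (restrict_scalars (antipode ?A ?G) ?Q) RG))"
    proof (rule restricted_Ext[OF assms(5)])
      show "module ?AG (restrict_scalars (antipode ?A ?G) ?Q)"
        by (rule restrict_scalars_module[OF P.group_ring_cring Q P.antipode_ring_hom])
      show "module ?AH (restrict_scalars (antipode ?A \<Gamma>) (restrict_scalars ?\<phi> ?Q))"
        by (rule restrict_scalars_module[OF H.group_ring_cring restricted_module[OF Q] H.antipode_ring_hom])
    qed (simp_all add: group_ring_map_antipode)
    then show ?thesis
      by (simp add: Q_module_def rings conjugate_module_def coarse restrict_scalars_quotient_module)
  qed
  ultimately show ?thesis by blast
qed

end
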